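(* Let $H=\left(-\frac{d^2}{dx^2}\right)^{1/2}+x^2$ on $L^2(\mathbb{R})$, with eigenfunctions $\varphi_n$, $n=1,2,\dots$. Then every eigenfunction $\varphi_n$ has a finite number of zeroes on $\mathbb{R}$.
   Context: $\left(-\frac{d^2}{dx^2}\right)^{1/2}$ is the Fourier multiplier operator with symbol $|k|$. The operator $H$ is the self-adjoint operator on $L^2(\mathbb{R})$ with $e^{-tH}=T_t$, where $(T_tf)(x)=\mathbb{E}^x\left[e^{-\int_0^t X_s^2\,ds}f(X_t)\right]$ and $(X_t)_{t\ge0}$ is the one-dimensional Cauchy process (the Lévy process with $\mathbb{E}^0[e^{i\xi X_t}]=e^{-t|\xi|}$). The operators $T_t$, $t>0$, are compact, so the spectrum of $H$ is purely discrete, with eigenvalues $0<\lambda_1<\lambda_2\le\lambda_3\le\dots\to\infty$ and an orthonormal basis of $L^2(\mathbb{R})$ of eigenfunctions $\varphi_n$, $H\varphi_n=\lambda_n\varphi_n$; the eigenvalues are simple and each $\varphi_n$ is taken to be its continuous version. *)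

theory Defs
  imports "HOL-Probability.Probability"
begin

definition cadlag_on_nonneg :: "(real \<Rightarrow> real) \<Rightarrow> bool" where
  "cadlag_on_nonneg p \<longleftrightarrow>
     (\<forall>t\<ge>0. continuous (at_right t) p) \<and> (\<forall>t>0. \<exists>l. (p \<longlongrightarrow> l) (at_left t))"

text \<open>Only the times \<open>t \<ge> 0\<close> matter. The process starts at 0, so expectations under the law
  started at \<open>x\<close> are expectations of functionals of \<open>x + X\<close>.\<close>

definition levy_process :: "'w measure \<Rightarrow> (real \<Rightarrow> 'w \<Rightarrow> real) \<Rightarrow> bool" where
  "levy_process M X \<longleftrightarrow>
     prob_space M \<and>
     (\<forall>t\<ge>0. X t \<in> borel_measurable M) \<and>
     (AE \<omega> in M. X 0 \<omega> = 0) \<and>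
     (\<forall>(n::nat) (u::nat \<Rightarrow> real). 0 \<le> u 0 \<and> mono u \<longrightarrow>
        prob_space.indep_vars M (\<lambda>_. borel) (\<lambda>i \<omega>. X (u (Suc i)) \<omega> - X (u i) \<omega>) {..<n}) \<and>
     (\<forall>s\<ge>0. \<forall>t\<ge>0. distr M borel (\<lambda>\<omega>. X (s + t) \<omega> - X s \<omega>) = distr M borel (X t)) \<and>
     (\<forall>\<omega>\<in>space M. cadlag_on_nonneg (\<lambda>t. X t \<omega>))"

definition cauchy_process :: "'w measure \<Rightarrow> (real \<Rightarrow> 'w \<Rightarrow> real) \<Rightarrow> bool" where
  "cauchy_process M X \<longleftrightarrow>
     levy_process M X \<and>
     (\<forall>t\<ge>0. \<forall>\<xi>. char (distr M borel (X t)) \<xi> = of_real (exp (- t * \<bar>\<xi>\<bar>)))"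

definition feynman_kac ::
    "'w measure \<Rightarrow> (real \<Rightarrow> 'w \<Rightarrow> real) \<Rightarrow> real \<Rightarrow> (real \<Rightarrow> complex) \<Rightarrow> real \<Rightarrow> complex" where
  "feynman_kac M X t f x =
     (LINT \<omega>|M. exp (- (LINT s:{0..t}|lborel. (x + X s \<omega>)\<^sup>2)) *\<^sub>R f (x + X t \<omega>))"

text \<open>Elements of \<open>L\<^sup>2(\<real>)\<close> are represented by Borel functions, and an unbounded operator by its
  graph, a relation between representatives.\<close>

definition square_integrable :: "(real \<Rightarrow> complex) \<Rightarrow> bool" where
  "square_integrable f \<longleftrightarrow>
     f \<in> borel_measurable lborel \<and> integrable lborel (\<lambda>x. (cmod (f x))\<^sup>2)"

text \<open>The operator \<open>H\<close> with \<open>e\<^sup>-\<^sup>t\<^sup>H = T t\<close>, i.e. minus the generator of \<open>T\<close>: a function \<open>f\<close>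
  lies in the domain and is mapped to \<open>g\<close> iff \<open>(f - T t f) / t\<close> tends to \<open>g\<close> in \<open>L\<^sup>2(\<real>)\<close>
  as \<open>t\<close> decreases to 0. For a self-adjoint \<open>H\<close> bounded below, this recovers \<open>H\<close>, domain
  included, from its exponentials.\<close>

definition semigroup_operator ::
    "(real \<Rightarrow> (real \<Rightarrow> complex) \<Rightarrow> real \<Rightarrow> complex) \<Rightarrow> (real \<Rightarrow> complex) \<Rightarrow> (real \<Rightarrow> complex) \<Rightarrow> bool"
  where
  "semigroup_operator T f g \<longleftrightarrow>
     square_integrable f \<and> square_integrable g \<and>
     ((\<lambda>t. \<integral>\<^sup>+x. ennreal ((cmod ((f x - T t f x) / of_real t - g x))\<^sup>2) \<partial>lborel)
        \<longlongrightarrow> 0) (at_right 0)"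

text \<open>The self-adjoint realisation of \<open>(-d\<^sup>2/dx\<^sup>2)\<^sup>1\<^sup>/\<^sup>2 + x\<^sup>2\<close>: the Cauchy process is generated by
  minus the Fourier multiplier with symbol \<open>\<bar>k\<bar>\<close>, and the potential \<open>x\<^sup>2\<close> enters through the
  Feynman-Kac weight.\<close>

definition cauchy_oscillator ::
    "'w measure \<Rightarrow> (real \<Rightarrow> 'w \<Rightarrow> real) \<Rightarrow> (real \<Rightarrow> complex) \<Rightarrow> (real \<Rightarrow> complex) \<Rightarrow> bool" where
  "cauchy_oscillator M X = semigroup_operator (feynman_kac M X)"

definition eigenfunction ::
    "((real \<Rightarrow> complex) \<Rightarrow> (real \<Rightarrow> complex) \<Rightarrow> bool) \<Rightarrow> real \<Rightarrow> (real \<Rightarrow> complex) \<Rightarrow> bool" where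
  "eigenfunction H \<mu> \<phi> \<longleftrightarrow>
     H \<phi> (\<lambda>x. of_real \<mu> * \<phi> x) \<and> \<not> (AE x in lborel. \<phi> x = 0)"

end

theory Submission
  imports Defs "HOL-Complex_Analysis.Complex_Analysis"
begin

text \<open>
On the Fourier side the operator \<open>\<bar>p\<bar> + x\<^sup>2\<close> becomes \<open>\<bar>k\<bar> - d\<^sup>2/dk\<^sup>2\<close>, so the transform \<open>u\<close> of an eigenfunction
\<open>\<phi>\<close> solves \<open>u'' = (\<bar>k\<bar> - \<mu>) u\<close>: this is Airy's equation on each half-line. Its square-integrable
solutions decay faster than every exponential, so \<open>\<phi>\<close> is the restriction of an entire function and has
finitely many zeros in every bounded interval (\<open>fourier_finite_zeros\<close>). The behaviour of \<open>\<phi>\<close> at infinity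
comes from the kink of \<open>\<bar>k\<bar>\<close> at the origin, the only point where \<open>u\<close> is not smooth: its third derivative
jumps there by \<open>2 u 0\<close> and its fourth by \<open>4 u' 0\<close>. Repeated integration by parts on the half-lines therefore
gives
\<open>fourier u y = 2 u 0 / y\<^sup>4 + 4 \<i> u' 0 / y\<^sup>5 + O(1 / \<bar>y\<bar>\<^sup>6)\<close>,
and since a nonzero solution cannot have \<open>u 0 = u' 0 = 0\<close>, there are no zeros outside a bounded interval
(\<open>airy_transform_zeros_bounded\<close>).

It remains to derive the differential equation from the definition of the operator, which gives only
the \<open>L\<^sup>2\<close> derivative at time 0 of the Feynman-Kac semigroup. This is done weakly. For a compactly supported
\<open>v\<close> with Lipschitz second derivative, pairing with \<open>fourier v\<close> yields
\<open>\<integral> \<phi> (fourier (- v'' + (\<bar>k\<bar> - \<mu>) v)) = 0\<close> (\<open>weak_eigen_equation\<close>). The free part of the semigroup acts as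
a Fourier multiplier and is controlled by the Plancherel bound. The killing part needs care, as the
Cauchy process has no second moment; a maximal inequality for its paths (\<open>maximal_inequality\<close>) shows that
large jumps before a small time do not contribute in the limit (\<open>potential_limit\<close>).

By variation of parameters, every Lipschitz \<open>g\<close> with compact support which is orthogonal to the two
solutions of the homogeneous equation has the form \<open>- v'' + (\<bar>k\<bar> - \<mu>) v\<close>. Hence the functional
\<open>g \<mapsto> \<integral> \<phi> (fourier g)\<close> is integration against a combination \<open>u\<close> of these two solutions
(\<open>eigenfunction_representation\<close>). The Plancherel bound shows that \<open>u\<close> is square-integrable, so it decays,
and testing with Gaussians recovers \<open>\<phi>\<close> from \<open>u\<close> at every point (\<open>fourier_inversion\<close>).
\<close>

section \<open>Fourier transforms and the Plancherel bound\<close>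

text \<open>No factor \<open>1 / (2 \<pi>)\<close> and the sign \<open>+\<close> in the exponent, the convention of characteristic functions.\<close>

definition fourier :: "(real \<Rightarrow> complex) \<Rightarrow> real \<Rightarrow> complex" where
  "fourier g x = (LINT k|lborel. iexp (k * x) * g k)"

abbreviation in_L2 :: "(real \<Rightarrow> complex) \<Rightarrow> bool" where
  "in_L2 f \<equiv> integrable lborel (\<lambda>x. (cmod (f x))\<^sup>2)"

abbreviation L2_sq :: "(real \<Rightarrow> complex) \<Rightarrow> real" where
  "L2_sq f \<equiv> LINT x|lborel. (cmod (f x))\<^sup>2"

lemma iexp_measurable [measurable]: "f \<in> borel_measurable M \<Longrightarrow> (\<lambda>x. iexp (f x)) \<in> borel_measurable M"
  for f :: "'a \<Rightarrow> real"
  by measurable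

lemma borel_measurable_cnj [measurable]: "f \<in> borel_measurable M \<Longrightarrow> (\<lambda>x. cnj (f x)) \<in> borel_measurable M"
  by (rule measurable_compose[where g = cnj and N=borel]) (auto intro!: borel_measurable_continuous_onI continuous_intros)

lemma integrable_iexp_mult:
  assumes "integrable lborel g"
  shows "integrable lborel (\<lambda>k. iexp (k * x) * g k)"
  by (rule Bochner_Integration.integrable_bound[OF assms]) (use assms in \<open>auto simp: norm_mult\<close>)

lemma norm_fourier_le:
  assumes "integrable lborel g"
  shows "cmod (fourier g x) \<le> (LINT k|lborel. cmod (g k))"
proof -
  have "cmod (fourier g x) \<le> (LINT k|lborel. cmod (iexp (k * x) * g k))"
    unfolding fourier_def by (rule integral_norm_bound)
  then show ?thesis by (simp add: norm_mult)
qed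

lemma fourier_measurable [measurable]:
  assumes [measurable]: "g \<in> borel_measurable borel"
  shows "fourier g \<in> borel_measurable borel"
  unfolding fourier_def by measurable

lemma integrable_mult_fourier:
  assumes g: "integrable lborel g" and h: "integrable lborel h"
  shows "integrable lborel (\<lambda>k. g k * fourier h k)"
proof (rule Bochner_Integration.integrable_bound)
  have [measurable]: "g \<in> borel_measurable borel" "h \<in> borel_measurable borel" using g h by auto
  show "integrable lborel (\<lambda>k. g k * (LINT x|lborel. cmod (h x)))" using g by simp
  show "(\<lambda>k. g k * fourier h k) \<in> borel_measurable lborel" by simp
  show "AE k in lborel. cmod (g k * fourier h k) \<le> cmod (g k * (LINT x|lborel. cmod (h x)))"
    using norm_fourier_le[OF h] by (auto simp: norm_mult intro!: mult_left_mono)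
qed

lemma continuous_fourier:
  assumes g: "integrable lborel g"
  shows "isCont (fourier g) x"
  unfolding continuous_at_sequentially comp_def
proof safe
  fix y :: "nat \<Rightarrow> real" assume y: "y \<longlonglongrightarrow> x"
  have [measurable]: "g \<in> borel_measurable lborel" using g by auto
  show "(\<lambda>n. fourier g (y n)) \<longlonglongrightarrow> fourier g x"
    unfolding fourier_def
  proof (rule integral_dominated_convergence[where w = "\<lambda>k. cmod (g k)"])
    show "AE k in lborel. (\<lambda>n. iexp (k * y n) * g k) \<longlonglongrightarrow> iexp (k * x) * g k"
      by (intro AE_I2 tendsto_intros y)
  qed (use g in \<open>auto simp: norm_mult\<close>)
qed

lemma fourier_diff:
  assumes "integrable lborel f" "integrable lborel g"
  shows "fourier (\<lambda>k. f k - c * g k) x = fourier f x - c * fourier g x"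
proof -
  have "fourier (\<lambda>k. f k - c * g k) x = (LINT k|lborel. iexp (k * x) * f k - c * (iexp (k * x) * g k))"
    unfolding fourier_def by (simp add: algebra_simps)
  also have "\<dots> = fourier f x - c * fourier g x"
    unfolding fourier_def using integrable_iexp_mult[OF assms(1)] integrable_iexp_mult[OF assms(2)] by simp
  finally show ?thesis .
qed

lemma normal_density_scale:
  assumes "\<sigma> > 0"
  shows "\<sigma> * normal_density y \<sigma> (y + \<sigma> * z) = std_normal_density z"
  using assms unfolding normal_density_def by (simp add: power_mult_distrib real_sqrt_mult field_simps)

lemma normal_density_fourier:
  assumes s: "\<sigma> > 0"
  shows "(LINT x|lborel. iexp (t * x) * of_real (normal_density 0 \<sigma> x)) = of_real (exp (- (\<sigma> * t)\<^sup>2 / 2))"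
proof -
  have "(LINT x|lborel. iexp (t * x) * of_real (normal_density 0 \<sigma> x))
      = \<bar>\<sigma>\<bar> *\<^sub>R (LINT x|lborel. iexp (t * (0 + \<sigma> * x)) * of_real (normal_density 0 \<sigma> (0 + \<sigma> * x)))"
    using s by (intro lborel_integral_real_affine) auto
  also have "\<dots> = (LINT x|lborel. \<sigma> *\<^sub>R (iexp (t * (0 + \<sigma> * x)) * of_real (normal_density 0 \<sigma> (0 + \<sigma> * x))))"
    using s by simp
  also have "\<dots> = (LINT x|lborel. std_normal_density x *\<^sub>R iexp ((\<sigma> * t) * x))"
  proof (rule Bochner_Integration.integral_cong[OF refl])
    fix x :: real
    have *: "\<sigma> * normal_density 0 \<sigma> (\<sigma> * x) = std_normal_density x"
      using normal_density_scale[OF s, of 0 x] by simp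
    have "\<sigma> *\<^sub>R (iexp (t * (0 + \<sigma> * x)) * of_real (normal_density 0 \<sigma> (0 + \<sigma> * x)))
      = of_real (\<sigma> * normal_density 0 \<sigma> (\<sigma> * x)) * iexp ((\<sigma> * t) * x)"
      by (simp add: scaleR_conv_of_real mult_ac)
    then show "\<sigma> *\<^sub>R (iexp (t * (0 + \<sigma> * x)) * of_real (normal_density 0 \<sigma> (0 + \<sigma> * x)))
      = std_normal_density x *\<^sub>R iexp ((\<sigma> * t) * x)" unfolding * by (simp add: scaleR_conv_of_real)
  qed
  also have "\<dots> = char std_normal_distribution (\<sigma> * t)"
    unfolding char_def by (subst integral_density) auto
  also have "\<dots> = of_real (exp (- (\<sigma> * t)\<^sup>2 / 2))"
    by (simp add: char_std_normal_distribution)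
  finally show ?thesis .
qed

text \<open>The bilinear form without a conjugation, which is how eigenfunctions and test functions are paired
  throughout.\<close>

lemma cauchy_schwarz_L2:
  fixes f g :: "'a \<Rightarrow> complex"
  assumes [measurable]: "f \<in> borel_measurable M" "g \<in> borel_measurable M"
    and f: "integrable M (\<lambda>x. (cmod (f x))\<^sup>2)" and g: "integrable M (\<lambda>x. (cmod (g x))\<^sup>2)"
  shows "integrable M (\<lambda>x. f x * g x)"
    and "cmod (LINT x|M. f x * g x) \<le> sqrt (LINT x|M. (cmod (f x))\<^sup>2) * sqrt (LINT x|M. (cmod (g x))\<^sup>2)"
proof -
  have *: "cmod (f x * g x) \<le> (cmod (f x))\<^sup>2 + (cmod (g x))\<^sup>2" for x
    using sum_squares_bound[of "cmod (f x)" "cmod (g x)"]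
      mult_nonneg_nonneg[OF norm_ge_zero norm_ge_zero, of "f x" "g x"] unfolding norm_mult by linarith
  show i: "integrable M (\<lambda>x. f x * g x)"
    by (rule Bochner_Integration.integrable_bound[OF Bochner_Integration.integrable_add[OF f g]]) (use * in auto)
  define I where "I = (LINT x|M. cmod (f x * g x))"
  have I0: "0 \<le> I" unfolding I_def by simp
  have "ennreal (I\<^sup>2) = (\<integral>\<^sup>+x. ennreal (cmod (f x)) * ennreal (cmod (g x)) \<partial>M)\<^sup>2"
  proof -
    have "ennreal I = (\<integral>\<^sup>+x. ennreal (cmod (f x * g x)) \<partial>M)"
      unfolding I_def using i by (intro nn_integral_eq_integral[symmetric]) auto
    then show ?thesis using I0 by (simp add: ennreal_power[symmetric] norm_mult ennreal_mult)
  qed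
  also have "\<dots> \<le> (\<integral>\<^sup>+x. ennreal (cmod (f x)) ^ 2 \<partial>M) * (\<integral>\<^sup>+x. ennreal (cmod (g x)) ^ 2 \<partial>M)"
    by (rule Cauchy_Schwarz_nn_integral) auto
  also have "\<dots> = ennreal ((LINT x|M. (cmod (f x))\<^sup>2) * (LINT x|M. (cmod (g x))\<^sup>2))"
    using f g by (simp add: ennreal_power nn_integral_eq_integral ennreal_mult)
  finally have "I\<^sup>2 \<le> (LINT x|M. (cmod (f x))\<^sup>2) * (LINT x|M. (cmod (g x))\<^sup>2)"
    by (subst (asm) ennreal_le_iff) auto
  then have "I \<le> sqrt ((LINT x|M. (cmod (f x))\<^sup>2) * (LINT x|M. (cmod (g x))\<^sup>2))"
    by (rule real_le_rsqrt)
  moreover have "cmod (LINT x|M. f x * g x) \<le> I" unfolding I_def by (rule integral_norm_bound)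
  ultimately show "cmod (LINT x|M. f x * g x) \<le> sqrt (LINT x|M. (cmod (f x))\<^sup>2) * sqrt (LINT x|M. (cmod (g x))\<^sup>2)"
    by (simp add: real_sqrt_mult)
qed


lemma fourier_multiplication_formula:
  assumes g: "integrable lborel g" and h: "integrable lborel h"
  shows "(LINT x|lborel. fourier g x * h x) = (LINT k|lborel. g k * fourier h k)"
proof -
  have [measurable]: "g \<in> borel_measurable borel" "h \<in> borel_measurable borel" using g h by auto
  have int: "integrable (lborel \<Otimes>\<^sub>M lborel) (\<lambda>(x, k). iexp (k * x) * g k * h x)"
  proof (rule lborel_pair.Fubini_integrable)
    show "integrable lborel (\<lambda>x. LINT k|lborel. norm (case (x, k) of (x, k) \<Rightarrow> iexp (k * x) * g k * h x))"
      using h by (auto simp: norm_mult)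
    show "AE x in lborel. integrable lborel (\<lambda>k. case (x, k) of (x, k) \<Rightarrow> iexp (k * x) * g k * h x)"
      using integrable_iexp_mult[OF g] by auto
  qed measurable
  have "(LINT x|lborel. fourier g x * h x) = (LINT x|lborel. LINT k|lborel. iexp (k * x) * g k * h x)"
    unfolding fourier_def by simp
  also have "\<dots> = (LINT k|lborel. LINT x|lborel. iexp (k * x) * g k * h x)"
    using lborel_pair.Fubini_integral[OF int] by simp
  also have "\<dots> = (LINT k|lborel. LINT x|lborel. g k * (iexp (x * k) * h x))"
    by (simp add: mult_ac)
  also have "\<dots> = (LINT k|lborel. g k * fourier h k)"
    unfolding fourier_def by simp
  finally show ?thesis .
qed

text \<open>The core of the bound \<open>\<integral> \<bar>fourier g\<bar>\<^sup>2 \<le> 2 \<pi> \<integral> \<bar>g\<bar>\<^sup>2\<close>. Against a Gaussian weight, two uses of the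
  multiplication formula turn the integral of \<open>\<bar>fourier g\<bar>\<^sup>2\<close> into a double integral with a
  Gaussian kernel, which Schur's test bounds by the total mass of that kernel. As the weight is
  flattened to 1, the kernel's mass cancels its normalisation.\<close>

lemma fourier_gaussian_weight:
  assumes g: "integrable lborel g" and g2: "in_L2 g" and s: "\<sigma> > 0"
  shows "(LINT x|lborel. (cmod (fourier g x))\<^sup>2 * normal_density 0 \<sigma> x) \<le> sqrt (2 * pi) / \<sigma> * (L2_sq g)"
proof -
  have [measurable]: "g \<in> borel_measurable borel" using g by auto
  define n where "n = normal_density 0 \<sigma>"
  have [measurable]: "n \<in> borel_measurable borel" unfolding n_def by simp
  have n0: "0 \<le> n x" for x unfolding n_def by simp
  have n_int: "integrable lborel n" unfolding n_def using s by auto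
  define e where "e = (\<lambda>t. exp (- (\<sigma> * t)\<^sup>2 / 2))"
  have e_n: "e = (\<lambda>t. sqrt (2 * pi) / \<sigma> * normal_density 0 (1 / \<sigma>) t)"
    unfolding e_def normal_density_def using s by (intro ext) (simp add: power_mult_distrib real_sqrt_divide field_simps)
  have e_int: "integrable lborel e" and e_val: "(LINT t|lborel. e t) = sqrt (2 * pi) / \<sigma>"
    unfolding e_n using s by auto
  have [measurable]: "e \<in> borel_measurable borel" unfolding e_def by measurable
  have e0: "0 \<le> e t" for t unfolding e_def by simp
  define g' where "g' = (\<lambda>l. cnj (g (- l)))"
  have [measurable]: "g' \<in> borel_measurable borel" unfolding g'_def by measurable
  have g'_int: "integrable lborel g'"
    unfolding g'_def using lborel_integrable_real_affine[OF g, of "-1" 0] by simp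
  have g'2: "integrable lborel (\<lambda>k. (cmod (g' k))\<^sup>2)" 
    unfolding g'_def using lborel_integrable_real_affine[OF g2, of "-1" 0] by simp
  have g'2_val: "(LINT k|lborel. (cmod (g' k))\<^sup>2) = (L2_sq g)"
    unfolding g'_def using lborel_integral_real_affine[of "-1" "\<lambda>k. (cmod (g k))\<^sup>2" 0] by simp
  have cnj_F: "cnj (fourier g x) = fourier g' x" for x
  proof -
    have "cnj (fourier g x) = (LINT k|lborel. cnj (iexp (k * x) * g k))"
      unfolding fourier_def by (rule Bochner_Integration.integral_cnj[symmetric])
    also have "\<dots> = (LINT k|lborel. iexp (- k * x) * cnj (g k))"
      by (simp add: exp_cnj)
    also have "\<dots> = fourier g' x"
      unfolding fourier_def g'_def
      using lborel_integral_real_affine[of "-1" "\<lambda>k. iexp (- k * x) * cnj (g k)" 0] by simp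
    finally show ?thesis .
  qed
  have F_bd: "cmod (fourier g' x) \<le> (LINT k|lborel. cmod (g' k))" for x
    by (rule norm_fourier_le[OF g'_int])
  define h where "h = (\<lambda>x. of_real (n x) * fourier g' x)"
  have h_int: "integrable lborel h"
  proof (rule Bochner_Integration.integrable_bound)
    show "integrable lborel (\<lambda>x. n x * (LINT k|lborel. cmod (g' k)))" using n_int by simp
    show "h \<in> borel_measurable lborel" unfolding h_def by simp
    show "AE x in lborel. cmod (h x) \<le> norm (n x * (LINT k|lborel. cmod (g' k)))"
      unfolding h_def using F_bd n0 by (auto simp: norm_mult abs_mult intro!: mult_mono)
  qed
  have Fh: "fourier h k = (LINT l|lborel. g' l * of_real (e (k + l)))" for k
  proof -
    have i: "integrable lborel (\<lambda>x. iexp (k * x) * of_real (n x))"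
      by (rule Bochner_Integration.integrable_bound[OF n_int]) (use n0 in \<open>auto simp: norm_mult\<close>)
    have Fe: "fourier (\<lambda>x. iexp (k * x) * of_real (n x)) l = of_real (e (k + l))" for l
    proof -
      have "fourier (\<lambda>x. iexp (k * x) * of_real (n x)) l = (LINT x|lborel. iexp ((k + l) * x) * of_real (n x))"
        unfolding fourier_def by (rule Bochner_Integration.integral_cong) (auto simp: exp_add[symmetric] algebra_simps)
      then show ?thesis unfolding n_def e_def using normal_density_fourier[OF s, of "k + l"] by simp
    qed
    have "fourier h k = (LINT x|lborel. fourier g' x * (iexp (k * x) * of_real (n x)))"
      by (simp only: fourier_def[of h]) (simp add: h_def mult_ac)
    also have "\<dots> = (LINT l|lborel. g' l * fourier (\<lambda>x. iexp (k * x) * of_real (n x)) l)"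
      by (rule fourier_multiplication_formula[OF g'_int i])
    also have "\<dots> = (LINT l|lborel. g' l * of_real (e (k + l)))" by (simp only: Fe)
    finally show ?thesis .
  qed
  have "of_real (LINT x|lborel. (cmod (fourier g x))\<^sup>2 * n x) = (LINT x|lborel. fourier g x * h x)"
    unfolding integral_complex_of_real[symmetric] h_def cnj_F[symmetric]
    by (rule Bochner_Integration.integral_cong) (auto simp: complex_norm_square mult_ac simp del: of_real_power)
  also have "\<dots> = (LINT k|lborel. g k * fourier h k)"
    by (rule fourier_multiplication_formula[OF g h_int])
  finally have eq: "of_real (LINT x|lborel. (cmod (fourier g x))\<^sup>2 * n x) = (LINT k|lborel. g k * fourier h k)" .
  define G where "G = (L2_sq g)"
  have esh: "integrable lborel (\<lambda>l. e (k + l))" "(LINT l|lborel. e (k + l)) = sqrt (2 * pi) / \<sigma>" for k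
    using lborel_integrable_real_affine[OF e_int, of 1 k] lborel_integral_real_affine[of 1 e k] e_val by auto
  have sh: "(\<integral>\<^sup>+k. \<integral>\<^sup>+l. ennreal ((cmod (f k))\<^sup>2 / 2 * e (k + l)) \<partial>lborel \<partial>lborel) = ennreal ((L2_sq f) / 2 * (sqrt (2 * pi) / \<sigma>))"
    if f: "in_L2 f" for f :: "real \<Rightarrow> complex"
  proof -
    have "(\<integral>\<^sup>+l. ennreal ((cmod (f k))\<^sup>2 / 2 * e (k + l)) \<partial>lborel) = ennreal ((cmod (f k))\<^sup>2 / 2 * (sqrt (2 * pi) / \<sigma>))" for k
      using esh[of k] e0 by (subst nn_integral_eq_integral) (auto simp: field_simps)
    then have "(\<integral>\<^sup>+k. \<integral>\<^sup>+l. ennreal ((cmod (f k))\<^sup>2 / 2 * e (k + l)) \<partial>lborel \<partial>lborel) = (\<integral>\<^sup>+k. ennreal ((cmod (f k))\<^sup>2 / 2 * (sqrt (2 * pi) / \<sigma>)) \<partial>lborel)"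
      by simp
    also have "\<dots> = ennreal (LINT k|lborel. (cmod (f k))\<^sup>2 / 2 * (sqrt (2 * pi) / \<sigma>))"
      using f s by (intro nn_integral_eq_integral) auto
    finally show ?thesis by simp
  qed
  \<comment> \<open>Schur's test, by \<open>2 a b \<le> a\<^sup>2 + b\<^sup>2\<close>\<close>
  have "ennreal (cmod (LINT k|lborel. g k * fourier h k)) \<le> (\<integral>\<^sup>+k. ennreal (cmod (g k * fourier h k)) \<partial>lborel)"
    by (rule integral_norm_bound_ennreal[OF integrable_mult_fourier[OF g h_int]])
  also have "\<dots> \<le> (\<integral>\<^sup>+k. \<integral>\<^sup>+l. ennreal ((cmod (g k))\<^sup>2 / 2 * e (k + l)) + ennreal ((cmod (g' l))\<^sup>2 / 2 * e (k + l)) \<partial>lborel \<partial>lborel)"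
  proof (rule nn_integral_mono)
    fix k :: real
    have ii: "integrable lborel (\<lambda>l. g k * (g' l * of_real (e (k + l))))"
      by (rule Bochner_Integration.integrable_bound[OF Bochner_Integration.integrable_mult_right[OF g'_int, of "g k"]])
         (auto simp: norm_mult e_def intro!: mult_left_le mult_left_mono)
    have "ennreal (cmod (g k * fourier h k)) = ennreal (cmod (LINT l|lborel. g k * (g' l * of_real (e (k + l)))))"
      unfolding Fh by simp
    also have "\<dots> \<le> (\<integral>\<^sup>+l. ennreal (cmod (g k * (g' l * of_real (e (k + l))))) \<partial>lborel)"
      by (rule integral_norm_bound_ennreal[OF ii])
    also have "\<dots> \<le> (\<integral>\<^sup>+l. ennreal ((cmod (g k))\<^sup>2 / 2 * e (k + l)) + ennreal ((cmod (g' l))\<^sup>2 / 2 * e (k + l)) \<partial>lborel)"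
    proof (rule nn_integral_mono)
      fix l :: real
      have "cmod (g k) * cmod (g' l) \<le> (cmod (g k))\<^sup>2 / 2 + (cmod (g' l))\<^sup>2 / 2"
        using sum_squares_bound[of "cmod (g k)" "cmod (g' l)"] by simp
      from mult_right_mono[OF this e0[of "k + l"]]
      have "cmod (g k * (g' l * of_real (e (k + l)))) \<le> (cmod (g k))\<^sup>2 / 2 * e (k + l) + (cmod (g' l))\<^sup>2 / 2 * e (k + l)"
        using e0[of "k + l"] by (simp add: norm_mult algebra_simps)
      then show "ennreal (cmod (g k * (g' l * of_real (e (k + l))))) \<le> ennreal ((cmod (g k))\<^sup>2 / 2 * e (k + l)) + ennreal ((cmod (g' l))\<^sup>2 / 2 * e (k + l))"
        using e0[of "k + l"] ennreal_plus[of "(cmod (g k))\<^sup>2 / 2 * e (k + l)" "(cmod (g' l))\<^sup>2 / 2 * e (k + l)"]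
        by (metis ennreal_leI mult_nonneg_nonneg zero_le_divide_iff zero_le_numeral zero_le_power2)
    qed
    finally show "ennreal (cmod (g k * fourier h k)) \<le> (\<integral>\<^sup>+l. ennreal ((cmod (g k))\<^sup>2 / 2 * e (k + l)) + ennreal ((cmod (g' l))\<^sup>2 / 2 * e (k + l)) \<partial>lborel)" .
  qed
  also have "\<dots> = (\<integral>\<^sup>+k. \<integral>\<^sup>+l. ennreal ((cmod (g k))\<^sup>2 / 2 * e (k + l)) \<partial>lborel \<partial>lborel) + (\<integral>\<^sup>+k. \<integral>\<^sup>+l. ennreal ((cmod (g' l))\<^sup>2 / 2 * e (k + l)) \<partial>lborel \<partial>lborel)"
    by (simp add: nn_integral_add)
  also have "(\<integral>\<^sup>+k. \<integral>\<^sup>+l. ennreal ((cmod (g' l))\<^sup>2 / 2 * e (k + l)) \<partial>lborel \<partial>lborel) = (\<integral>\<^sup>+l. \<integral>\<^sup>+k. ennreal ((cmod (g' l))\<^sup>2 / 2 * e (l + k)) \<partial>lborel \<partial>lborel)"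
    by (subst lborel_pair.Fubini') (auto simp: add.commute)
  also note sh[OF g2]
  also note sh[OF g'2]
  also have "ennreal ((L2_sq g) / 2 * (sqrt (2 * pi) / \<sigma>)) + ennreal ((LINT k|lborel. (cmod (g' k))\<^sup>2) / 2 * (sqrt (2 * pi) / \<sigma>)) = ennreal (sqrt (2 * pi) / \<sigma> * G)"
    unfolding g'2_val G_def[symmetric] using s by (subst ennreal_plus[symmetric]) (auto simp: G_def field_simps)
  finally have "cmod (LINT k|lborel. g k * fourier h k) \<le> sqrt (2 * pi) / \<sigma> * G"
    using s by (subst (asm) ennreal_le_iff) (auto simp: G_def)
  then show ?thesis unfolding eq[symmetric] G_def n_def norm_of_real by simp
qed

lemma gaussian_eq_normal_density:
  assumes "\<sigma> > 0"
  shows "exp (- (x / \<sigma>)\<^sup>2 / 2) = sqrt (2 * pi) * \<sigma> * normal_density 0 \<sigma> x"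
  unfolding normal_density_def using assms by (simp add: power_divide real_sqrt_mult field_simps)

lemma gaussian_weight_lim: "(\<lambda>n. exp (- (x / real (Suc n))\<^sup>2 / 2)) \<longlonglongrightarrow> 1"
proof -
  have "(\<lambda>n. x / Suc n) \<longlonglongrightarrow> 0"
    using tendsto_mult[OF tendsto_const[of x] LIMSEQ_inverse_real_of_nat] by (simp add: field_simps)
  then have "(\<lambda>n. exp (- (x / real (Suc n))\<^sup>2 / 2)) \<longlonglongrightarrow> exp (- 0\<^sup>2 / 2)" by (intro tendsto_intros) auto
  then show ?thesis by simp
qed

lemma plancherel_bound:
  assumes g: "integrable lborel g" and g2: "in_L2 g"
  shows "in_L2 (fourier g)"
    and "(L2_sq (fourier g)) \<le> 2 * pi * (L2_sq g)"
proof -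
  have [measurable]: "g \<in> borel_measurable borel" using g by auto
  define G where "G = (L2_sq g)"
  define w where "w = (\<lambda>(n::nat) x::real. exp (- (x / Suc n)\<^sup>2 / 2))"
  have w_n: "w n x = sqrt (2 * pi) * Suc n * normal_density 0 (Suc n) x" for n x
    unfolding w_def by (rule gaussian_eq_normal_density) simp
  have [measurable]: "w n \<in> borel_measurable borel" for n unfolding w_def by measurable
  have bd: "(\<integral>\<^sup>+x. ennreal ((cmod (fourier g x))\<^sup>2 * w n x) \<partial>lborel) \<le> ennreal (2 * pi * G)" for n
  proof -
    have i: "integrable lborel (\<lambda>x. (cmod (fourier g x))\<^sup>2 * w n x)"
    proof (rule Bochner_Integration.integrable_bound)
      show "integrable lborel (\<lambda>x. (LINT k|lborel. cmod (g k))\<^sup>2 * w n x)"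
        unfolding w_n by simp
      show "AE x in lborel. norm ((cmod (fourier g x))\<^sup>2 * w n x) \<le> norm ((LINT k|lborel. cmod (g k))\<^sup>2 * w n x)"
        unfolding w_def using norm_fourier_le[OF g] by (auto intro!: mult_right_mono power_mono)
    qed measurable
    have "(LINT x|lborel. (cmod (fourier g x))\<^sup>2 * w n x) = sqrt (2 * pi) * Suc n * (LINT x|lborel. (cmod (fourier g x))\<^sup>2 * normal_density 0 (Suc n) x)"
      unfolding w_n integral_mult_right_zero[symmetric] by (simp add: mult_ac)
    also have "\<dots> \<le> sqrt (2 * pi) * Suc n * (sqrt (2 * pi) / Suc n * G)"
      unfolding G_def by (intro mult_left_mono fourier_gaussian_weight g g2) auto
    also have "\<dots> = 2 * pi * G" by (simp add: field_simps)
    finally show ?thesis using i by (subst nn_integral_eq_integral) (auto simp: w_def intro: ennreal_leI)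
  qed
  have lim: "(\<lambda>n. ennreal ((cmod (fourier g x))\<^sup>2 * w n x)) \<longlonglongrightarrow> ennreal ((cmod (fourier g x))\<^sup>2)" for x
  proof -
    have "(\<lambda>n. (cmod (fourier g x))\<^sup>2 * w n x) \<longlonglongrightarrow> (cmod (fourier g x))\<^sup>2 * 1"
      unfolding w_def by (intro tendsto_intros gaussian_weight_lim)
    then show ?thesis by (intro tendsto_ennrealI) simp
  qed
  have "(\<integral>\<^sup>+x. ennreal ((cmod (fourier g x))\<^sup>2) \<partial>lborel) = (\<integral>\<^sup>+x. liminf (\<lambda>n. ennreal ((cmod (fourier g x))\<^sup>2 * w n x)) \<partial>lborel)"
    by (rule nn_integral_cong) (use lim_imp_Liminf[OF _ lim] in auto)
  also have "\<dots> \<le> liminf (\<lambda>n. \<integral>\<^sup>+x. ennreal ((cmod (fourier g x))\<^sup>2 * w n x) \<partial>lborel)"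
    by (rule nn_integral_liminf) measurable
  also have "\<dots> \<le> ennreal (2 * pi * G)"
    using bd by (intro Liminf_le) auto
  finally have le: "(\<integral>\<^sup>+x. ennreal ((cmod (fourier g x))\<^sup>2) \<partial>lborel) \<le> ennreal (2 * pi * G)" .
  then show i: "in_L2 (fourier g)"
    by (intro integrableI_bounded) (auto intro: le_less_trans)
  show "(L2_sq (fourier g)) \<le> 2 * pi * (L2_sq g)"
    using le unfolding nn_integral_eq_integral[OF i AE_I2[OF zero_le_power2]] G_def
    by (subst (asm) ennreal_le_iff) auto
qed

text \<open>Extends every identity for \<open>g \<mapsto> \<integral> f (fourier g)\<close> along \<open>L\<^sup>2\<close> limits of \<open>g\<close>.\<close>

lemma pairing_fourier_bound:
  assumes f[measurable]: "f \<in> borel_measurable lborel" and f2: "in_L2 f"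
    and g: "integrable lborel g" and g2: "in_L2 g"
  shows "integrable lborel (\<lambda>x. f x * fourier g x)"
    and "cmod (LINT x|lborel. f x * fourier g x)
      \<le> sqrt (2 * pi * (L2_sq f)) * sqrt (L2_sq g)"
proof -
  have [measurable]: "g \<in> borel_measurable borel" using g by auto
  note p = plancherel_bound[OF g g2]
  show "integrable lborel (\<lambda>x. f x * fourier g x)" by (intro cauchy_schwarz_L2 f2 p) measurable
  have "cmod (LINT x|lborel. f x * fourier g x) \<le> sqrt (L2_sq f) * sqrt (L2_sq (fourier g))"
    by (intro cauchy_schwarz_L2 f2 p) measurable
  also have "\<dots> \<le> sqrt (L2_sq f) * sqrt (2 * pi * (L2_sq g))"
    using p(2) by (intro mult_left_mono) auto
  finally show "cmod (LINT x|lborel. f x * fourier g x)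
      \<le> sqrt (2 * pi * (L2_sq f)) * sqrt (L2_sq g)"
    by (simp add: real_sqrt_mult mult_ac)
qed

section \<open>Compactly supported Lipschitz functions\<close>

text \<open>The transforms of the test functions are compactly supported and Lipschitz. Smoothness cannot be
  asked for: solving \<open>- v'' + (\<bar>k\<bar> - \<mu>) v = g\<close> with the kink of \<open>\<bar>k\<bar>\<close> leaves \<open>v''\<close> only Lipschitz.\<close>

definition compact_supp :: "(real \<Rightarrow> complex) \<Rightarrow> bool" where
  "compact_supp g \<longleftrightarrow> (\<exists>N. \<forall>k. N < \<bar>k\<bar> \<longrightarrow> g k = 0)"

definition loc_lipschitz :: "(real \<Rightarrow> complex) \<Rightarrow> bool" where
  "loc_lipschitz g \<longleftrightarrow> (\<forall>N. \<exists>L. L-lipschitz_on {-N..N} g)"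

lemma compact_supp_diff:
  assumes "compact_supp f" "compact_supp g"
  shows "compact_supp (\<lambda>k. f k - c * g k)"
proof -
  obtain N1 where "\<And>k. N1 < \<bar>k\<bar> \<Longrightarrow> f k = 0" using assms(1) unfolding compact_supp_def by metis
  moreover obtain N2 where "\<And>k. N2 < \<bar>k\<bar> \<Longrightarrow> g k = 0" using assms(2) unfolding compact_supp_def by metis
  ultimately have "f k - c * g k = 0" if "max N1 N2 < \<bar>k\<bar>" for k using that by simp
  then show ?thesis unfolding compact_supp_def by blast
qed

lemma compact_supp_mult: "compact_supp g \<Longrightarrow> compact_supp (\<lambda>k. f k * g k)"
  unfolding compact_supp_def by (metis mult_zero_right)

lemma loc_lipschitz_imp_continuous:
  assumes "loc_lipschitz g"
  shows "continuous_on UNIV g"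
proof (intro continuous_at_imp_continuous_on ballI)
  fix x :: real
  obtain L where "L-lipschitz_on {- (\<bar>x\<bar> + 1)..\<bar>x\<bar> + 1} g" using assms unfolding loc_lipschitz_def by blast
  then have "continuous_on {- (\<bar>x\<bar> + 1)..\<bar>x\<bar> + 1} g" by (rule lipschitz_on_continuous_on)
  then have "continuous_on {- (\<bar>x\<bar> + 1)<..<\<bar>x\<bar> + 1} g" by (rule continuous_on_subset) auto
  then have "\<forall>y\<in>{- (\<bar>x\<bar> + 1)<..<\<bar>x\<bar> + 1}. isCont g y"
    by (subst continuous_on_eq_continuous_at[symmetric]) auto
  moreover have "x \<in> {- (\<bar>x\<bar> + 1)<..<\<bar>x\<bar> + 1}" by auto
  ultimately show "isCont g x" by blast
qed

lemma loc_lipschitz_const: "loc_lipschitz (\<lambda>_. c)"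
  unfolding loc_lipschitz_def using lipschitz_on_constant by blast

lemma loc_lipschitz_mult:
  assumes "loc_lipschitz f" "loc_lipschitz g"
  shows "loc_lipschitz (\<lambda>k. f k * g k)"
  unfolding loc_lipschitz_def
proof
  fix N :: real
  obtain Lf Lg where Lf: "Lf-lipschitz_on {-N..N} f" and Lg: "Lg-lipschitz_on {-N..N} g"
    using assms unfolding loc_lipschitz_def by metis
  have "compact (f ` {-N..N})" "compact (g ` {-N..N})"
    using Lf Lg by (auto intro!: compact_continuous_image lipschitz_on_continuous_on)
  then obtain F G where F0: "F > 0" and F: "\<And>k. k \<in> {-N..N} \<Longrightarrow> cmod (f k) \<le> F" and G0: "G > 0" and G: "\<And>k. k \<in> {-N..N} \<Longrightarrow> cmod (g k) \<le> G"
    by (metis bounded_pos compact_imp_bounded imageI)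
  have nn: "0 \<le> Lf" "0 \<le> Lg" using Lf Lg lipschitz_on_nonneg by auto
  have "(F * Lg + Lf * G)-lipschitz_on {-N..N} (\<lambda>k. f k * g k)"
  proof (rule lipschitz_onI)
    fix x y assume xy: "x \<in> {-N..N}" "y \<in> {-N..N}"
    have "cmod (f x * g x - f y * g y) = cmod (f x * (g x - g y) + (f x - f y) * g y)"
      by (simp add: algebra_simps)
    also have "\<dots> \<le> cmod (f x) * cmod (g x - g y) + cmod (f x - f y) * cmod (g y)"
      by (metis norm_mult norm_triangle_ineq)
    also have "\<dots> \<le> F * (Lg * dist x y) + (Lf * dist x y) * G"
      using lipschitz_onD[OF Lf xy] lipschitz_onD[OF Lg xy] F[OF xy(1)] G[OF xy(2)] F0 nn
      by (intro add_mono mult_mono) (auto simp: dist_norm)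
    finally show "dist (f x * g x) (f y * g y) \<le> (F * Lg + Lf * G) * dist x y"
      by (simp add: dist_norm algebra_simps)
  qed (use F0 G0 nn in auto)
  then show "\<exists>L. L-lipschitz_on {-N..N} (\<lambda>k. f k * g k)" by blast
qed

lemma loc_lipschitz_diff:
  assumes "loc_lipschitz f" "loc_lipschitz g"
  shows "loc_lipschitz (\<lambda>k. f k - c * g k)"
proof -
  have cg: "loc_lipschitz (\<lambda>k. c * g k)"
    by (rule loc_lipschitz_mult[OF loc_lipschitz_const assms(2)])
  show ?thesis unfolding loc_lipschitz_def
  proof
    fix N :: real
    obtain Lf Lg where Lf: "Lf-lipschitz_on {-N..N} f" and Lg: "Lg-lipschitz_on {-N..N} (\<lambda>k. c * g k)"
      using assms(1) cg unfolding loc_lipschitz_def by metis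
    from lipschitz_on_diff[OF this] show "\<exists>L. L-lipschitz_on {-N..N} (\<lambda>k. f k - c * g k)" by blast
  qed
qed

lemma loc_lipschitz_of_real:
  fixes f :: "real \<Rightarrow> real"
  assumes "\<And>x y. \<bar>f x - f y\<bar> \<le> \<bar>x - y\<bar>"
  shows "loc_lipschitz (\<lambda>k. of_real (f k))"
  unfolding loc_lipschitz_def
proof (intro allI exI lipschitz_onI)
  show "dist (complex_of_real (f x)) (of_real (f y)) \<le> 1 * dist x y" for x y
    using assms[of x y] by (simp add: dist_norm flip: of_real_diff)
qed auto

lemma loc_lipschitz_C1:
  assumes f: "\<And>k. (f has_vector_derivative f' k) (at k)" and c: "continuous_on UNIV f'"
  shows "loc_lipschitz f"
  unfolding loc_lipschitz_def
proof
  fix N :: real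
  have "compact (f' ` {-N..N})" by (intro compact_continuous_image continuous_on_subset[OF c]) auto
  then obtain B where B0: "B > 0" and B: "\<And>k. k \<in> {-N..N} \<Longrightarrow> cmod (f' k) \<le> B"
    by (metis bounded_pos compact_imp_bounded imageI)
  have "B-lipschitz_on {-N..N} f"
  proof (rule lipschitz_onI)
    fix x y assume xy: "x \<in> {-N..N}" "y \<in> {-N..N}"
    have "norm (f x - f y) \<le> B * norm (x - y)"
    proof (rule differentiable_bound[of "{-N..N}" f "\<lambda>k h. h *\<^sub>R f' k"])
      show "(f has_derivative (\<lambda>h. h *\<^sub>R f' k)) (at k within {-N..N})" for k
        using f[of k] unfolding has_vector_derivative_def by (rule has_derivative_at_withinI)
      show "onorm (\<lambda>h. h *\<^sub>R f' k) \<le> B" if "k \<in> {-N..N}" for k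
        using B[OF that] by (intro onorm_le) (simp add: mult.commute[of B] mult_left_mono)
    qed (use xy in auto)
    then show "dist (f x) (f y) \<le> B * dist x y" by (simp add: dist_norm)
  qed (use B0 in auto)
  then show "\<exists>L. L-lipschitz_on {-N..N} f" by blast
qed

lemma integrable_compact_supp:
  fixes g :: "real \<Rightarrow> 'b :: {banach, second_countable_topology}"
  assumes c: "continuous_on UNIV g" and N: "\<And>k. N < \<bar>k\<bar> \<Longrightarrow> g k = 0"
  shows "integrable lborel g"
proof -
  have "set_integrable lborel {-N..N} g"
    unfolding set_integrable_def by (rule borel_integrable_compact) (auto intro: continuous_on_subset[OF c])
  moreover have "(\<lambda>k. indicator {-N..N} k *\<^sub>R g k) = g"
    using N by (auto simp: fun_eq_iff indicator_def)
  ultimately show ?thesis unfolding set_integrable_def by simp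
qed

lemma integrable_compact_supp_complex:
  assumes c: "continuous_on UNIV g" and s: "compact_supp g"
  shows "integrable lborel g" "in_L2 g"
proof -
  obtain N where N: "\<And>k. N < \<bar>k\<bar> \<Longrightarrow> g k = 0" using s unfolding compact_supp_def by blast
  show "integrable lborel g" by (rule integrable_compact_supp[OF c N])
  show "in_L2 g"
    by (rule integrable_compact_supp[where N = N]) (auto intro!: continuous_intros continuous_on_subset[OF c] simp: N)
qed

lemma iexp_has_vector_derivative:
  "((\<lambda>k. iexp (k * x)) has_vector_derivative \<i> * of_real x * iexp (k * x)) (at k within S)"
proof -
  have "((\<lambda>z. exp (\<i> * (z * of_real x))) has_field_derivative \<i> * of_real x * iexp (k * x)) (at (of_real k))"
    by (auto intro!: derivative_eq_intros)
  from has_vector_derivative_real_field[OF this] show ?thesis by simp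
qed

lemma fourier_deriv:
  assumes v: "\<And>k. (v has_vector_derivative v' k) (at k)" and c: "continuous_on UNIV v'" and s: "compact_supp v"
  shows "fourier v' x = - \<i> * of_real x * fourier v x"
    and "compact_supp v'"
proof -
  obtain N0 where N0: "\<And>k. N0 < \<bar>k\<bar> \<Longrightarrow> v k = 0" using s unfolding compact_supp_def by blast
  define N where "N = \<bar>N0\<bar> + 1"
  have N: "v k = 0" if "N \<le> \<bar>k\<bar>" for k using that by (intro N0) (auto simp: N_def)
  have Npos: "N > 0" unfolding N_def by simp
  have v'0: "v' k = 0" if "N < \<bar>k\<bar>" for k
  proof -
    have "open {k. N < \<bar>k\<bar>}" by (intro open_Collect_less continuous_intros)
    then have "(v has_vector_derivative 0) (at k)"
      by (intro has_vector_derivative_transform_within_open[of "\<lambda>_. 0" 0 k "{k. N < \<bar>k\<bar>}" v]) (use that N in auto)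
    then show ?thesis using v[of k] vector_derivative_unique_at by blast
  qed
  then show s': "compact_supp v'" unfolding compact_supp_def by blast
  have cv: "continuous_on UNIV v"
    using v by (meson continuous_at_imp_continuous_on has_vector_derivative_continuous)
  let ?F = "\<lambda>k. iexp (k * x) * v k"
  let ?f = "\<lambda>k. iexp (k * x) * v' k + \<i> * of_real x * (iexp (k * x) * v k)"
  have d: "(?F has_vector_derivative ?f k) (at k)" for k
    using has_vector_derivative_mult[OF iexp_has_vector_derivative[where x = x] v[of k]] by (simp only: mult.assoc)
  have "(LINT k|lborel. indicator {-N..N} k *\<^sub>R ?f k) = ?F N - ?F (-N)"
  proof (rule integral_FTC_Icc)
    show "- N \<le> N" using Npos by simp
    show "(?F has_vector_derivative ?f k) (at k within {-N..N})" for k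
      by (rule has_vector_derivative_at_within[OF d])
    have ci: "continuous_on {-N..N} (\<lambda>k. iexp (k * x))" by (intro continuous_intros)
    show "continuous_on {-N..N} ?f"
      by (rule continuous_on_add[OF continuous_on_mult[OF ci continuous_on_subset[OF c subset_UNIV]]
            continuous_on_mult[OF continuous_on_const continuous_on_mult[OF ci continuous_on_subset[OF cv subset_UNIV]]]])
  qed
  also have "\<dots> = 0" using N[of N] N[of "-N"] Npos by simp
  also have "(\<lambda>k. indicator {-N..N} k *\<^sub>R ?f k) = ?f"
    using N v'0 by (auto simp: fun_eq_iff indicator_def)
  finally have "(LINT k|lborel. ?f k) = 0" .
  moreover have "(LINT k|lborel. ?f k) = fourier v' x + \<i> * of_real x * fourier v x"
    unfolding fourier_def integral_mult_right_zero[symmetric]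
    by (intro Bochner_Integration.integral_add integrable_mult_right integrable_iexp_mult
          integrable_compact_supp_complex c cv s s')
  ultimately show "fourier v' x = - \<i> * of_real x * fourier v x"
    by (simp add: add_eq_0_iff2)
qed

text \<open>Translating \<open>g\<close> by \<open>\<pi> / x\<close> flips the sign of the exponential, so \<open>2 fourier g x\<close> is the transform of
  a difference of translates, of size \<open>O(1 / \<bar>x\<bar>)\<close>.\<close>

lemma fourier_lipschitz_decay:
  assumes l: "loc_lipschitz g" and s: "compact_supp g"
  shows "\<exists>C. \<forall>x. (1 + \<bar>x\<bar>) * cmod (fourier g x) \<le> C"
proof -
  obtain N0 where N0: "\<And>k. N0 < \<bar>k\<bar> \<Longrightarrow> g k = 0" using s unfolding compact_supp_def by blast
  define N where "N = \<bar>N0\<bar>"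
  have N: "g k = 0" if "N < \<bar>k\<bar>" for k using that by (intro N0) (auto simp: N_def)
  obtain L where L: "L-lipschitz_on {- (N + 8)..N + 8} g" using l unfolding loc_lipschitz_def by blast
  have L0: "0 \<le> L" using L lipschitz_on_nonneg by auto
  have c: "continuous_on UNIV g" by (rule loc_lipschitz_imp_continuous[OF l])
  have int: "integrable lborel g" by (rule integrable_compact_supp_complex[OF c s])
  define I where "I = (LINT k|lborel. cmod (g k))"
  have I0: "0 \<le> I" unfolding I_def by simp
  have "(1 + \<bar>x\<bar>) * cmod (fourier g x) \<le> 2 * I + L * 4 * (2 * (N + 4))" for x
  proof (cases "\<bar>x\<bar> \<le> 1")
    case True
    have "(1 + \<bar>x\<bar>) * cmod (fourier g x) \<le> 2 * I"
      using True norm_fourier_le[OF int, of x] unfolding I_def by (intro mult_mono) auto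
    moreover have "0 \<le> L * 4 * (2 * (N + 4))" using L0 by (auto simp: N_def)
    ultimately show ?thesis by linarith
  next
    case False
    \<comment> \<open>half a period of the exponential\<close>
    define h where "h = pi / x"
    have x0: "x \<noteq> 0" using False by auto
    have h_le: "\<bar>h\<bar> \<le> 4 / \<bar>x\<bar>" unfolding h_def using pi_less_4 x0 by (simp add: divide_right_mono)
    have h4: "\<bar>h\<bar> \<le> 4" 
    proof -
      have "4 / \<bar>x\<bar> \<le> 4" using False by (simp add: field_simps)
      then show ?thesis using h_le by linarith
    qed
    have "fourier g x = (LINT k|lborel. iexp ((h + 1 * k) * x) * g (h + 1 * k))"
      unfolding fourier_def by (subst lborel_integral_real_affine[of 1 _ h]) auto
    also have "\<dots> = (LINT k|lborel. - (iexp (k * x) * g (k + h)))"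
    proof (rule Bochner_Integration.integral_cong[OF refl])
      fix k
      have "(h + 1 * k) * x = k * x + pi" unfolding h_def using x0 by (simp add: field_simps)
      then have "iexp ((h + 1 * k) * x) = - iexp (k * x)" by (simp add: exp_add distrib_left)
      then show "iexp ((h + 1 * k) * x) * g (h + 1 * k) = - (iexp (k * x) * g (k + h))" by (simp add: add.commute)
    qed
    finally have sh: "fourier g x = - (LINT k|lborel. iexp (k * x) * g (k + h))" by simp
    have int': "integrable lborel (\<lambda>k. g (k + h))"
      using lborel_integrable_real_affine[OF int, of 1 h] by (simp add: add.commute)
    have "2 * fourier g x = (LINT k|lborel. iexp (k * x) * g k) - (LINT k|lborel. iexp (k * x) * g (k + h))"
      using sh unfolding fourier_def by simp
    also have "\<dots> = (LINT k|lborel. iexp (k * x) * g k - iexp (k * x) * g (k + h))"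
      by (intro Bochner_Integration.integral_diff[symmetric] integrable_iexp_mult int int')
    finally have "2 * cmod (fourier g x) = cmod (LINT k|lborel. iexp (k * x) * g k - iexp (k * x) * g (k + h))"
      by (metis norm_mult norm_numeral)
    also have "\<dots> \<le> (LINT k|lborel. cmod (iexp (k * x) * g k - iexp (k * x) * g (k + h)))"
      by (rule integral_norm_bound)
    also have "\<dots> \<le> (LINT k|lborel. (L * (4 / \<bar>x\<bar>)) * indicator {- (N + 4)..N + 4} k)"
    proof (rule integral_mono)
      show "integrable lborel (\<lambda>k. cmod (iexp (k * x) * g k - iexp (k * x) * g (k + h)))"
        by (intro integrable_norm Bochner_Integration.integrable_diff integrable_iexp_mult int int')
      show "integrable lborel (\<lambda>k. (L * (4 / \<bar>x\<bar>)) * indicator {- (N + 4)..N + 4} k)"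
        by (intro integrable_mult_right integrable_real_indicator) (auto simp: emeasure_lborel_Icc_eq)
      fix k
      have eq: "cmod (iexp (k * x) * g k - iexp (k * x) * g (k + h)) = cmod (g k - g (k + h))"
        by (simp add: norm_mult flip: right_diff_distrib)
      show "cmod (iexp (k * x) * g k - iexp (k * x) * g (k + h)) \<le> (L * (4 / \<bar>x\<bar>)) * indicator {- (N + 4)..N + 4} k"
      proof (cases "k \<in> {- (N + 4)..N + 4}")
        case True
        then have "dist (g k) (g (k + h)) \<le> L * dist k (k + h)" using h4 by (intro lipschitz_onD[OF L]) auto
        also have "\<dots> \<le> L * (4 / \<bar>x\<bar>)" using h_le L0 by (intro mult_left_mono) (auto simp: dist_norm)
        finally show ?thesis unfolding eq using True by (simp add: dist_norm)
      next
        case False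
        then have "g k = 0" "g (k + h) = 0" using h4 by (auto intro!: N simp: abs_real_def split: if_splits)
        then show ?thesis unfolding eq using False by simp
      qed
    qed
    also have "\<dots> = L * 4 * (2 * (N + 4)) / \<bar>x\<bar>"
      by (simp add: N_def)
    finally have "2 * cmod (fourier g x) * \<bar>x\<bar> \<le> L * 4 * (2 * (N + 4))"
      using x0 by (simp add: field_simps)
    moreover have "(1 + \<bar>x\<bar>) * cmod (fourier g x) \<le> 2 * cmod (fourier g x) * \<bar>x\<bar>"
      using False mult_right_mono[of 1 "\<bar>x\<bar>" "cmod (fourier g x)"] by (simp add: algebra_simps)
    ultimately show ?thesis using I0 by linarith
  qed
  then show ?thesis by blast
qed

text \<open>Two integrations by parts give \<open>x\<^sup>2\<close>, and the Lipschitz second derivative one more power. Cubic decay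
  makes \<open>(1 + \<bar>x\<bar>)\<^sup>2 fourier v\<close> square-integrable with room for small shifts of its argument, which
  is what the potential term \<open>x\<^sup>2\<close> needs.\<close>

lemma fourier_C2_decay:
  assumes v: "\<And>k. (v has_vector_derivative v' k) (at k)" and v': "\<And>k. (v' has_vector_derivative v'' k) (at k)"
    and l: "loc_lipschitz v''" and s: "compact_supp v"
  shows "fourier v'' x = - (of_real (x\<^sup>2) * fourier v x)"
    and "\<exists>C. \<forall>x. (1 + \<bar>x\<bar>) ^ 3 * cmod (fourier v x) \<le> C"
proof -
  have c'': "continuous_on UNIV v''" by (rule loc_lipschitz_imp_continuous[OF l])
  have c': "continuous_on UNIV v'"
    using v' by (meson continuous_at_imp_continuous_on has_vector_derivative_continuous)
  have c: "continuous_on UNIV v"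
    using v by (meson continuous_at_imp_continuous_on has_vector_derivative_continuous)
  note s' = fourier_deriv(2)[OF v c' s]
  note s'' = fourier_deriv(2)[OF v' c'' s']
  have sq: "fourier v'' x = - (of_real (x\<^sup>2) * fourier v x)" for x
    using fourier_deriv(1)[OF v c' s, of x] fourier_deriv(1)[OF v' c'' s', of x]
    by (simp add: power2_eq_square algebra_simps)
  then show "fourier v'' x = - (of_real (x\<^sup>2) * fourier v x)" .
  obtain C0 where C0: "\<And>x. (1 + \<bar>x\<bar>) * cmod (fourier v x) \<le> C0"
    using fourier_lipschitz_decay[OF loc_lipschitz_C1[OF v c'] s] by blast
  obtain C2 where C2: "\<And>x. (1 + \<bar>x\<bar>) * cmod (fourier v'' x) \<le> C2"
    using fourier_lipschitz_decay[OF l s''] by blast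
  have "(1 + \<bar>x\<bar>) ^ 3 * cmod (fourier v x) \<le> 2 * C0 + 2 * C2" for x
  proof -
    have "(1 + \<bar>x\<bar>)\<^sup>2 \<le> 2 + 2 * x\<^sup>2"
      using sum_squares_bound[of 1 "\<bar>x\<bar>"] by (simp add: power2_eq_square algebra_simps)
    then have "(1 + \<bar>x\<bar>)\<^sup>2 * ((1 + \<bar>x\<bar>) * cmod (fourier v x)) \<le> (2 + 2 * x\<^sup>2) * ((1 + \<bar>x\<bar>) * cmod (fourier v x))"
      by (rule mult_right_mono) auto
    also have "\<dots> = 2 * ((1 + \<bar>x\<bar>) * cmod (fourier v x)) + 2 * ((1 + \<bar>x\<bar>) * cmod (fourier v'' x))"
      unfolding sq by (simp add: norm_mult norm_power algebra_simps)
    also have "\<dots> \<le> 2 * C0 + 2 * C2" using C0[of x] C2[of x] by linarith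
    finally show ?thesis by (simp add: power3_eq_cube power2_eq_square mult_ac)
  qed
  then show "\<exists>C. \<forall>x. (1 + \<bar>x\<bar>) ^ 3 * cmod (fourier v x) \<le> C" by blast
qed

text \<open>Since \<open>(x - y)\<^sup>2 \<ge> 1\<close>, shrinking the variance costs a factor that does not depend on \<open>x\<close>.\<close>

lemma normal_density_tail:
  assumes s: "0 < \<sigma>" "\<sigma> \<le> 1" and d: "1 \<le> \<bar>x - y\<bar>"
  shows "normal_density y \<sigma> x \<le> exp (- (1 / \<sigma>\<^sup>2 - 1) / 2) / \<sigma> * normal_density y 1 x"
proof -
  have d2: "1 \<le> (x - y)\<^sup>2" using d by (metis abs_le_square_iff abs_one one_power2)
  have "1 \<le> 1 / \<sigma>\<^sup>2" using s by (simp add: power_le_one)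
  then have "1 * (1 / \<sigma>\<^sup>2 - 1) \<le> (x - y)\<^sup>2 * (1 / \<sigma>\<^sup>2 - 1)"
    using d2 by (intro mult_right_mono) auto
  then have "- ((x - y)\<^sup>2 / (2 * \<sigma>\<^sup>2)) \<le> - (1 / \<sigma>\<^sup>2 - 1) / 2 + - ((x - y)\<^sup>2 / 2)"
    by (simp add: algebra_simps)
  then have "exp (- ((x - y)\<^sup>2 / (2 * \<sigma>\<^sup>2))) \<le> exp (- (1 / \<sigma>\<^sup>2 - 1) / 2) * exp (- ((x - y)\<^sup>2 / 2))"
    by (simp add: exp_add[symmetric])
  then have "exp (- ((x - y)\<^sup>2 / (2 * \<sigma>\<^sup>2))) / (sqrt (2 * pi) * \<sigma>) \<le> exp (- (1 / \<sigma>\<^sup>2 - 1) / 2) * exp (- ((x - y)\<^sup>2 / 2)) / (sqrt (2 * pi) * \<sigma>)"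
    using s by (intro divide_right_mono) auto
  then show ?thesis unfolding normal_density_def using s by (simp add: real_sqrt_mult mult_ac)
qed

text \<open>As \<open>f\<close> may be unbounded, its part near \<open>y\<close> is treated by dominated convergence and its part at distance
  at least 1 by square integrability against the uniformly small Gaussian tails.\<close>

lemma gaussian_approx_identity:
  fixes f :: "real \<Rightarrow> complex"
  assumes c: "continuous_on UNIV f" and f2: "in_L2 f"
  shows "(\<lambda>n. LINT x|lborel. f x * of_real (normal_density y (1 / Suc n) x)) \<longlonglongrightarrow> f y"
proof -
  have [measurable]: "f \<in> borel_measurable borel" using c by (rule borel_measurable_continuous_onI)
  define near far where "near = (\<lambda>x. indicator {y - 1..y + 1} x *\<^sub>R f x)" and "far = (\<lambda>x. indicator (- {y - 1..y + 1}) x *\<^sub>R f x)"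
  have [measurable]: "near \<in> borel_measurable borel" "far \<in> borel_measurable borel"
    unfolding near_def far_def by measurable
  have nf: "f x = near x + far x" for x unfolding near_def far_def by (simp add: indicator_def)
  have "compact (f ` {y - 1..y + 1})" by (intro compact_continuous_image continuous_on_subset[OF c]) auto
  then obtain B where B0: "B > 0" and B: "\<And>x. x \<in> {y - 1..y + 1} \<Longrightarrow> cmod (f x) \<le> B"
    by (metis bounded_pos compact_imp_bounded imageI)
  have near_bd: "cmod (near x) \<le> B" for x unfolding near_def using B[of x] B0 by (auto simp: indicator_def)
  have near_int: "integrable lborel (\<lambda>x. near x * of_real (normal_density y (1 / Suc n) x))" for n
    by (rule Bochner_Integration.integrable_bound[of _ "\<lambda>x. B * normal_density y (1 / Suc n) x"])
       (use near_bd B0 in \<open>auto simp: norm_mult abs_mult intro!: mult_right_mono\<close>)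
  have far2: "in_L2 far"
    by (rule Bochner_Integration.integrable_bound[OF f2]) (auto simp: far_def indicator_def)
  have nd2: "integrable lborel (\<lambda>x. (cmod (of_real (normal_density y 1 x)))\<^sup>2)"
  proof (rule Bochner_Integration.integrable_bound[of _ "normal_density y 1"])
    have "normal_density y 1 x \<le> 1" for x
    proof -
      have "1 \<le> sqrt (2 * pi)" using pi_ge_two by simp
      then show ?thesis unfolding normal_density_def by (simp add: divide_le_eq order_trans[of _ 1])
    qed
    then show "AE x in lborel. norm ((cmod (of_real (normal_density y 1 x)))\<^sup>2) \<le> norm (normal_density y 1 x)"
      by (auto simp: power2_eq_square intro!: mult_left_le)
  qed auto
  have fn: "integrable lborel (\<lambda>x. far x * of_real (normal_density y 1 x))"
    by (intro cauchy_schwarz_L2 far2 nd2) measurable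
  define c where "c = (\<lambda>n::nat. exp (- ((Suc n)\<^sup>2 - 1) / 2) * real (Suc n))"
  have far_le: "cmod (far x * of_real (normal_density y (1 / Suc n) x)) \<le> c n * cmod (far x * of_real (normal_density y 1 x))" for n x
  proof (cases "x \<in> {y - 1..y + 1}")
    case True then show ?thesis unfolding far_def by simp
  next
    case False
    have "normal_density y (1 / Suc n) x \<le> exp (- (1 / (1 / Suc n)\<^sup>2 - 1) / 2) / (1 / Suc n) * normal_density y 1 x"
      by (rule normal_density_tail) (use False in auto)
    also have "\<dots> = c n * normal_density y 1 x" unfolding c_def by (simp add: power_divide)
    finally show ?thesis using mult_left_mono[of "normal_density y (1 / Suc n) x" "c n * normal_density y 1 x" "cmod (far x)"]
      by (simp add: norm_mult mult_ac)
  qed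
  have c0: "c \<longlonglongrightarrow> 0" unfolding c_def by real_asymp
  have cn0: "0 \<le> c n" for n unfolding c_def by simp
  have far_int: "integrable lborel (\<lambda>x. far x * of_real (normal_density y (1 / Suc n) x))" for n
    by (rule Bochner_Integration.integrable_bound[OF integrable_mult_right[OF integrable_norm[OF fn], of "c n"]])
       (use far_le cn0 in \<open>auto simp: abs_mult\<close>)
  have far_lim: "(\<lambda>n. LINT x|lborel. far x * of_real (normal_density y (1 / Suc n) x)) \<longlonglongrightarrow> 0"
  proof (rule Lim_null_comparison)
    show "(\<lambda>n. c n * (LINT x|lborel. cmod (far x * of_real (normal_density y 1 x)))) \<longlonglongrightarrow> 0"
      using tendsto_mult_right[OF c0] by simp
    show "\<forall>\<^sub>F n in sequentially. cmod (LINT x|lborel. far x * of_real (normal_density y (1 / Suc n) x)) \<le> c n * (LINT x|lborel. cmod (far x * of_real (normal_density y 1 x)))"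
    proof (intro always_eventually allI)
      fix n
      have "cmod (LINT x|lborel. far x * of_real (normal_density y (1 / Suc n) x)) \<le> (LINT x|lborel. cmod (far x * of_real (normal_density y (1 / Suc n) x)))"
        by (rule integral_norm_bound)
      also have "\<dots> \<le> (LINT x|lborel. c n * cmod (far x * of_real (normal_density y 1 x)))"
        by (intro integral_mono far_le integrable_norm far_int integrable_mult_right fn)
      finally show "cmod (LINT x|lborel. far x * of_real (normal_density y (1 / Suc n) x)) \<le> c n * (LINT x|lborel. cmod (far x * of_real (normal_density y 1 x)))"
        by simp
    qed
  qed
  have near_eq: "(LINT x|lborel. near x * of_real (normal_density y (1 / Suc n) x)) = (LINT z|lborel. near (y + 1 / Suc n * z) * of_real (std_normal_density z))" for n
  proof -
    have "(LINT x|lborel. near x * of_real (normal_density y (1 / Suc n) x)) =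
      \<bar>1 / Suc n\<bar> *\<^sub>R (LINT z|lborel. near (y + 1 / Suc n * z) * of_real (normal_density y (1 / Suc n) (y + 1 / Suc n * z)))"
      by (rule lborel_integral_real_affine) auto
    also have "\<dots> = (LINT z|lborel. (1 / Suc n) *\<^sub>R (near (y + 1 / Suc n * z) * of_real (normal_density y (1 / Suc n) (y + 1 / Suc n * z))))"
      by simp
    also have "\<dots> = (LINT z|lborel. near (y + 1 / Suc n * z) * of_real (std_normal_density z))"
    proof (rule Bochner_Integration.integral_cong[OF refl])
      fix z
      have "(1 / Suc n) *\<^sub>R (near (y + 1 / Suc n * z) * of_real (normal_density y (1 / Suc n) (y + 1 / Suc n * z)))
        = near (y + 1 / Suc n * z) * of_real ((1 / Suc n) * normal_density y (1 / Suc n) (y + 1 / Suc n * z))"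
        by (simp only: scaleR_conv_of_real of_real_mult mult_ac)
      also have "(1 / Suc n) * normal_density y (1 / Suc n) (y + 1 / Suc n * z) = std_normal_density z"
        by (rule normal_density_scale) simp
      finally show "(1 / Suc n) *\<^sub>R (near (y + 1 / Suc n * z) * of_real (normal_density y (1 / Suc n) (y + 1 / Suc n * z))) = near (y + 1 / Suc n * z) * of_real (std_normal_density z)" .
    qed
    finally show ?thesis .
  qed
  have near_lim: "(\<lambda>n. LINT x|lborel. near x * of_real (normal_density y (1 / Suc n) x)) \<longlonglongrightarrow> (LINT z|lborel. f y * of_real (std_normal_density z))"
    unfolding near_eq
  proof (rule integral_dominated_convergence[where w = "\<lambda>z. B * std_normal_density z"])
    show "AE z in lborel. (\<lambda>n. near (y + 1 / Suc n * z) * of_real (std_normal_density z)) \<longlonglongrightarrow> f y * of_real (std_normal_density z)"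
    proof (intro AE_I2 tendsto_mult tendsto_const)
      fix z
      have a: "(\<lambda>n. y + 1 / Suc n * z) \<longlonglongrightarrow> y" by real_asymp
      have "isCont f y" using c by (simp add: continuous_on_eq_continuous_at)
      then have b: "(\<lambda>n. f (y + 1 / Suc n * z)) \<longlonglongrightarrow> f y" using a by (rule isCont_tendsto_compose)
      have "\<forall>\<^sub>F n in sequentially. y + 1 / Suc n * z \<in> {y - 1<..<y + 1}"
        using topological_tendstoD[OF a, of "{y - 1<..<y + 1}"] by auto
      then have "\<forall>\<^sub>F n in sequentially. f (y + 1 / Suc n * z) = near (y + 1 / Suc n * z)"
        by eventually_elim (auto simp: near_def)
      then show "(\<lambda>n. near (y + 1 / Suc n * z)) \<longlonglongrightarrow> f y" using b by (rule Lim_transform_eventually[rotated])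
    qed
    show "AE z in lborel. cmod (near (y + 1 / Suc n * z) * of_real (std_normal_density z)) \<le> B * std_normal_density z" for n
      using near_bd by (auto simp: norm_mult intro!: mult_right_mono)
  qed auto
  have "(LINT z|lborel. f y * of_real (std_normal_density z)) = f y"
    by (simp add: integral_complex_of_real)
  with tendsto_add[OF near_lim far_lim] show ?thesis
    unfolding nf distrib_right using near_int far_int by simp
qed

section \<open>Tails and suprema of the Cauchy process\<close>

text \<open>The process is written as \<open>X\<close> with \<open>X 0 = 0\<close> almost surely; paths started at \<open>x\<close> are \<open>x + X\<close>.\<close>

locale cauchy_motion = prob_space M for M :: "'w measure" +
  fixes X :: "real \<Rightarrow> 'w \<Rightarrow> real"
  assumes cauchy_process: "cauchy_process M X"
begin

lemma X_measurable [measurable]: "0 \<le> t \<Longrightarrow> X t \<in> borel_measurable M"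
  using cauchy_process unfolding cauchy_process_def levy_process_def by blast

lemma X_start: "AE \<omega> in M. X 0 \<omega> = 0"
  using cauchy_process unfolding cauchy_process_def levy_process_def by blast

lemma X_indep:
  "0 \<le> u 0 \<Longrightarrow> mono u \<Longrightarrow> indep_vars (\<lambda>_. borel) (\<lambda>i \<omega>. X (u (Suc i)) \<omega> - X (u i) \<omega>) {..<n}" for n :: nat
  using cauchy_process unfolding cauchy_process_def levy_process_def by blast

lemma X_stationary: "0 \<le> s \<Longrightarrow> 0 \<le> t \<Longrightarrow> distr M borel (\<lambda>\<omega>. X (s + t) \<omega> - X s \<omega>) = distr M borel (X t)"
  using cauchy_process unfolding cauchy_process_def levy_process_def by blast

lemma X_right_continuous: "\<omega> \<in> space M \<Longrightarrow> 0 \<le> t \<Longrightarrow> continuous (at_right t) (\<lambda>t. X t \<omega>)"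
  using cauchy_process unfolding cauchy_process_def levy_process_def cadlag_on_nonneg_def by blast

lemma X_char:
  assumes "0 \<le> t"
  shows "(LINT \<omega>|M. iexp (k * X t \<omega>)) = of_real (exp (- t * \<bar>k\<bar>))"
proof -
  have "of_real (exp (- t * \<bar>k\<bar>)) = char (distr M borel (X t)) k"
    using cauchy_process assms unfolding cauchy_process_def by simp
  also have "\<dots> = (LINT \<omega>|M. iexp (k * X t \<omega>))"
    unfolding char_def using assms by (subst integral_distr) auto
  finally show ?thesis ..
qed

lemma X_gaussian_average:
  assumes t: "0 \<le> t"
  shows "(LINT \<omega>|M. exp (- (X t \<omega> * s)\<^sup>2 / 2)) = (LINT z|lborel. std_normal_density z * exp (- t * \<bar>s * z\<bar>))"
proof -
  interpret pair_sigma_finite M lborel ..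
  have [measurable]: "X t \<in> borel_measurable M" using t by simp
  have int: "integrable (M \<Otimes>\<^sub>M lborel) (\<lambda>(\<omega>, z). iexp ((X t \<omega> * s) * z) * of_real (std_normal_density z))"
  proof (rule Fubini_integrable)
    show "integrable M (\<lambda>\<omega>. LINT z|lborel. norm (case (\<omega>, z) of (\<omega>, z) \<Rightarrow> iexp ((X t \<omega> * s) * z) * of_real (std_normal_density z)))"
      by (simp add: norm_mult)
    show "AE \<omega> in M. integrable lborel (\<lambda>z. case (\<omega>, z) of (\<omega>, z) \<Rightarrow> iexp ((X t \<omega> * s) * z) * of_real (std_normal_density z))"
    proof (rule AE_I2)
      fix \<omega>
      show "integrable lborel (\<lambda>z. case (\<omega>, z) of (\<omega>, z) \<Rightarrow> iexp ((X t \<omega> * s) * z) * of_real (std_normal_density z))"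
        by (rule Bochner_Integration.integrable_bound[of _ std_normal_density]) (auto simp: norm_mult)
    qed
  qed measurable
  have "of_real (LINT \<omega>|M. exp (- (X t \<omega> * s)\<^sup>2 / 2)) = (LINT \<omega>|M. of_real (exp (- (1 * (X t \<omega> * s))\<^sup>2 / 2)) :: complex)"
    by (simp only: integral_complex_of_real mult_1)
  also have "\<dots> = (LINT \<omega>|M. LINT z|lborel. iexp ((X t \<omega> * s) * z) * of_real (std_normal_density z))"
    by (subst normal_density_fourier[symmetric]) auto
  also have "\<dots> = (LINT z|lborel. LINT \<omega>|M. iexp ((X t \<omega> * s) * z) * of_real (std_normal_density z))"
    using Fubini_integral[OF int] by simp
  also have "\<dots> = (LINT z|lborel. of_real (std_normal_density z) * (LINT \<omega>|M. iexp ((s * z) * X t \<omega>)))"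
    by (simp add: mult_ac)
  also have "\<dots> = (LINT z|lborel. of_real (std_normal_density z * exp (- t * \<bar>s * z\<bar>)))"
    unfolding X_char[OF t] by simp
  also have "\<dots> = of_real (LINT z|lborel. std_normal_density z * exp (- t * \<bar>s * z\<bar>))"
    by (simp only: integral_complex_of_real)
  finally show ?thesis unfolding of_real_eq_iff .
qed

text \<open>Averaging the characteristic function against a Gaussian converts its modulus of continuity
  \<open>1 - exp (- t \<bar>k\<bar>) \<le> t \<bar>k\<bar>\<close> at the origin into a tail estimate.\<close>

lemma X_tail:
  assumes t: "0 \<le> t" and r: "0 < r"
  shows "prob {\<omega> \<in> space M. r \<le> \<bar>X t \<omega>\<bar>} \<le> 4 * t / r"
proof -
  have [measurable]: "X t \<in> borel_measurable M" using t by simp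
  \<comment> \<open>makes the averaged quantity at least one half where \<open>\<bar>X t\<bar> \<ge> r\<close>\<close>
  define s where "s = 2 / r"
  have s0: "s > 0" using r by (simp add: s_def)
  have half: "exp (-2) \<le> (1/2 :: real)"
  proof -
    have "2 \<le> exp (2::real)" using exp_ge_add_one_self[of "2::real"] by simp
    then show ?thesis by (simp add: exp_minus inverse_eq_divide divide_le_eq)
  qed
  have exp_int: "integrable M (\<lambda>\<omega>. exp (- (X t \<omega> * s)\<^sup>2 / 2))"
    by (rule integrable_const_bound[where B = 1]) auto
  have n_int: "integrable lborel (\<lambda>z. std_normal_density z * exp (- t * \<bar>s * z\<bar>))"
    by (rule Bochner_Integration.integrable_bound[of _ std_normal_density]) (use t in \<open>auto simp: abs_mult intro!: mult_left_le\<close>)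
  have "prob {\<omega> \<in> space M. r \<le> \<bar>X t \<omega>\<bar>} = (LINT \<omega>|M. indicator {\<omega> \<in> space M. r \<le> \<bar>X t \<omega>\<bar>} \<omega>)"
    by simp
  also have "\<dots> \<le> (LINT \<omega>|M. 2 * (1 - exp (- (X t \<omega> * s)\<^sup>2 / 2)))"
  proof (rule integral_mono)
    show "integrable M (\<lambda>\<omega>. 2 * (1 - exp (- (X t \<omega> * s)\<^sup>2 / 2)))" using exp_int by auto
    show "indicat_real {\<omega> \<in> space M. r \<le> \<bar>X t \<omega>\<bar>} \<omega> \<le> 2 * (1 - exp (- (X t \<omega> * s)\<^sup>2 / 2))" for \<omega>
    proof (cases "\<omega> \<in> {\<omega> \<in> space M. r \<le> \<bar>X t \<omega>\<bar>}")
      case True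
      then have "2 \<le> \<bar>X t \<omega> * s\<bar>" using r unfolding s_def by (simp add: abs_mult field_simps)
      then have "4 \<le> (X t \<omega> * s)\<^sup>2" using power_mono[of 2 "\<bar>X t \<omega> * s\<bar>" 2] by simp
      then have "exp (- (X t \<omega> * s)\<^sup>2 / 2) \<le> exp (-2)" by simp
      then have "exp (- (X t \<omega> * s)\<^sup>2 / 2) \<le> 1 / 2" using half by linarith
      then show ?thesis using True by simp
    qed simp
  qed (auto intro!: integrable_const_bound[where B = 1])
  also have "\<dots> = 2 * (1 - (LINT z|lborel. std_normal_density z * exp (- t * \<bar>s * z\<bar>)))"
    unfolding X_gaussian_average[OF t, symmetric] using exp_int by (simp add: prob_space)
  also have "\<dots> = 2 * (LINT z|lborel. std_normal_density z * (1 - exp (- t * \<bar>s * z\<bar>)))"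
    using n_int by (simp add: right_diff_distrib)
  also have "\<dots> \<le> 2 * (LINT z|lborel. t * s * (std_normal_density z * \<bar>z\<bar> ^ 1))"
  proof (intro mult_left_mono integral_mono)
    show "integrable lborel (\<lambda>z. std_normal_density z * (1 - exp (- t * \<bar>s * z\<bar>)))"
      using n_int by (auto simp: right_diff_distrib)
    show "integrable lborel (\<lambda>z. t * s * (std_normal_density z * \<bar>z\<bar> ^ 1))"
      by (intro integrable_mult_right integrable_std_normal_moment_abs)
    fix z
    have "1 - exp (- t * \<bar>s * z\<bar>) \<le> t * \<bar>s * z\<bar>" using exp_ge_add_one_self[of "- t * \<bar>s * z\<bar>"] by simp
    then have "std_normal_density z * (1 - exp (- t * \<bar>s * z\<bar>)) \<le> std_normal_density z * (t * \<bar>s * z\<bar>)"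
      by (intro mult_left_mono) auto
    then show "std_normal_density z * (1 - exp (- t * \<bar>s * z\<bar>)) \<le> t * s * (std_normal_density z * \<bar>z\<bar> ^ 1)"
      using s0 by (simp add: abs_mult mult_ac)
  qed auto
  also have "\<dots> = 2 * t * s * (LINT z|lborel. std_normal_density z * \<bar>z\<bar> ^ 1)"
    by simp
  also have "\<dots> \<le> 2 * t * s * 1"
    using integral_std_normal_moment_abs_odd[of 0] pi_ge_two t s0 by (intro mult_left_mono) (auto simp: real_sqrt_divide)
  finally show ?thesis unfolding s_def by simp
qed

lemma increment_tail:
  assumes a: "0 \<le> a" "a \<le> b" and r: "0 < r"
  shows "prob {\<omega> \<in> space M. r \<le> \<bar>X b \<omega> - X a \<omega>\<bar>} \<le> 4 * (b - a) / r"
proof -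
  have [measurable]: "X a \<in> borel_measurable M" "X b \<in> borel_measurable M" "X (b - a) \<in> borel_measurable M" using a by auto
  have "prob {\<omega> \<in> space M. r \<le> \<bar>X b \<omega> - X a \<omega>\<bar>} = measure (distr M borel (\<lambda>\<omega>. X (a + (b - a)) \<omega> - X a \<omega>)) {x. r \<le> \<bar>x\<bar>}"
    by (subst measure_distr) (auto intro!: arg_cong[where f = prob])
  also have "\<dots> = measure (distr M borel (X (b - a))) {x. r \<le> \<bar>x\<bar>}"
    using a by (subst X_stationary) auto
  also have "\<dots> = prob {\<omega> \<in> space M. r \<le> \<bar>X (b - a) \<omega>\<bar>}"
    by (subst measure_distr) (auto intro!: arg_cong[where f = prob])
  also have "\<dots> \<le> 4 * (b - a) / r" using a by (intro X_tail r) auto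
  finally show ?thesis .
qed

text \<open>The event of first leaving \<open>[-a, a]\<close> at grid time \<open>s j\<close> depends on the increments up to that time only.\<close>

lemma past_future_indep:
  fixes n j :: nat
  assumes t: "0 \<le> t" and j: "j \<le> n" "0 < n"
  defines "s \<equiv> \<lambda>i::nat. t * (real i / real n)"
  shows "prob ({\<omega> \<in> space M. (\<forall>i<j. \<bar>X (s i) \<omega> - X 0 \<omega>\<bar> \<le> a) \<and> a < \<bar>X (s j) \<omega> - X 0 \<omega>\<bar>} \<inter> {\<omega> \<in> space M. \<bar>X t \<omega> - X (s j) \<omega>\<bar> \<le> b})
    = prob {\<omega> \<in> space M. (\<forall>i<j. \<bar>X (s i) \<omega> - X 0 \<omega>\<bar> \<le> a) \<and> a < \<bar>X (s j) \<omega> - X 0 \<omega>\<bar>} * prob {\<omega> \<in> space M. \<bar>X t \<omega> - X (s j) \<omega>\<bar> \<le> b}"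
proof -
  \<comment> \<open>stopping the grid at time \<open>s j\<close> makes the future a single increment\<close>
  define u where "u = (\<lambda>i. if i \<le> j then s i else t)"
  have s_le: "s i \<le> t" if "i \<le> n" for i
    unfolding s_def using t that j by (intro mult_left_le) (auto simp: divide_le_eq)
  have s_mono: "s i \<le> s k" if "i \<le> k" for i k
    unfolding s_def using that t by (intro mult_left_mono divide_right_mono) auto
  have u0: "u 0 = 0" by (simp add: u_def s_def)
  have "mono u"
    by (rule monoI) (use s_le s_mono j in \<open>auto simp: u_def\<close>)
  define Y where "Y = (\<lambda>i \<omega>. X (u (Suc i)) \<omega> - X (u i) \<omega>)"
  have "indep_vars (\<lambda>_. borel) Y {..<Suc j}"
    unfolding Y_def by (rule X_indep) (use u0 \<open>mono u\<close> in auto)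
  then have ind: "indep_var (PiM {..<j} (\<lambda>_. borel)) (\<lambda>\<omega>. restrict (\<lambda>i. Y i \<omega>) {..<j}) (PiM {j} (\<lambda>_. borel)) (\<lambda>\<omega>. restrict (\<lambda>i. Y i \<omega>) {j})"
    by (rule indep_var_restrict) auto
  have tel: "(\<Sum>l<i. Y l \<omega>) = X (s i) \<omega> - X 0 \<omega>" if "i \<le> j" for i \<omega>
    using sum_lessThan_telescope[of "\<lambda>l. X (u l) \<omega>" i] that u0 unfolding Y_def by (simp add: u_def)
  have Yj: "Y j \<omega> = X t \<omega> - X (s j) \<omega>" for \<omega> unfolding Y_def u_def by simp
  define Ya where "Ya = {y \<in> space (PiM {..<j} (\<lambda>_. borel :: real measure)). (\<forall>i<j. \<bar>\<Sum>l<i. y l\<bar> \<le> a) \<and> a < \<bar>\<Sum>l<j. y l\<bar>}"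
  define Yb where "Yb = {y \<in> space (PiM {j} (\<lambda>_. borel :: real measure)). \<bar>y j\<bar> \<le> b}"
  have sm: "(\<lambda>y. \<Sum>l<i. y l) \<in> borel_measurable (PiM {..<j} (\<lambda>_. borel :: real measure))" if "i \<le> j" for i
    by (rule borel_measurable_sum, rule measurable_component_singleton) (use that in auto)
  have Ya: "Ya \<in> sets (PiM {..<j} (\<lambda>_. borel))"
  proof -
    have "Ya = (\<Inter>i\<in>{..<j}. {y \<in> space (PiM {..<j} (\<lambda>_. borel :: real measure)). \<bar>\<Sum>l<i. y l\<bar> \<le> a})
       \<inter> {y \<in> space (PiM {..<j} (\<lambda>_. borel :: real measure)). a < \<bar>\<Sum>l<j. y l\<bar>}" if "j \<noteq> 0"
      unfolding Ya_def using that by auto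
    moreover have "{y \<in> space (PiM {..<j} (\<lambda>_. borel :: real measure)). \<bar>\<Sum>l<i. y l\<bar> \<le> a} \<in> sets (PiM {..<j} (\<lambda>_. borel))" if "i < j" for i
    proof -
      have [measurable]: "(\<lambda>y. \<Sum>l<i. y l) \<in> borel_measurable (PiM {..<j} (\<lambda>_. borel :: real measure))" using sm that by simp
      show ?thesis by measurable
    qed
    moreover have "{y \<in> space (PiM {..<j} (\<lambda>_. borel :: real measure)). a < \<bar>\<Sum>l<j. y l\<bar>} \<in> sets (PiM {..<j} (\<lambda>_. borel))"
    proof -
      have [measurable]: "(\<lambda>y. \<Sum>l<j. y l) \<in> borel_measurable (PiM {..<j} (\<lambda>_. borel :: real measure))" using sm by simp
      show ?thesis by measurable
    qed
    ultimately show ?thesis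
      by (cases "j = 0") (auto simp: Ya_def intro!: sets.Int sets.finite_INT)
  qed
  have Yb: "Yb \<in> sets (PiM {j} (\<lambda>_. borel))"
    unfolding Yb_def by measurable
  have C: "(\<lambda>\<omega>. restrict (\<lambda>i. Y i \<omega>) {..<j}) -` Ya \<inter> space M = {\<omega> \<in> space M. (\<forall>i<j. \<bar>X (s i) \<omega> - X 0 \<omega>\<bar> \<le> a) \<and> a < \<bar>X (s j) \<omega> - X 0 \<omega>\<bar>}"
    unfolding Ya_def by (auto simp: space_PiM tel[symmetric])
  have D: "(\<lambda>\<omega>. restrict (\<lambda>i. Y i \<omega>) {j}) -` Yb \<inter> space M = {\<omega> \<in> space M. \<bar>X t \<omega> - X (s j) \<omega>\<bar> \<le> b}"
    unfolding Yb_def by (auto simp: space_PiM Yj)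
  have "(\<lambda>\<omega>. (restrict (\<lambda>i. Y i \<omega>) {..<j}, restrict (\<lambda>i. Y i \<omega>) {j})) -` (Ya \<times> Yb) \<inter> space M =
    ((\<lambda>\<omega>. restrict (\<lambda>i. Y i \<omega>) {..<j}) -` Ya \<inter> space M) \<inter> ((\<lambda>\<omega>. restrict (\<lambda>i. Y i \<omega>) {j}) -` Yb \<inter> space M)"
    by auto
  with indep_varD[OF ind Ya Yb] show ?thesis unfolding C D by simp
qed

text \<open>Ottaviani's inequality: after the first grid time at which the path has left \<open>[-2R, 2R]\<close>, the
  independent remaining increment stays below \<open>R\<close> with probability at least one half, and then
  the path is still outside \<open>[-R, R]\<close> at the final time.\<close>

lemma maximal_inequality_grid:
  fixes n :: nat
  assumes t: "0 \<le> t" and R: "0 < R" "8 * t \<le> R" and n: "0 < n"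
  defines "s \<equiv> \<lambda>i::nat. t * (real i / real n)"
  shows "prob {\<omega> \<in> space M. \<exists>j\<le>n. 2 * R < \<bar>X (s j) \<omega> - X 0 \<omega>\<bar>} \<le> 8 * t / R"
proof -
  have s0: "0 \<le> s j" for j unfolding s_def using t by simp
  have s_le: "s i \<le> t" if "i \<le> n" for i
    unfolding s_def using t that n by (intro mult_left_le) (auto simp: divide_le_eq)
  have [measurable]: "X (s j) \<in> borel_measurable M" "X t \<in> borel_measurable M" "X 0 \<in> borel_measurable M" for j
    using s0 t by auto
  define C where "C = (\<lambda>j. {\<omega> \<in> space M. (\<forall>i<j. \<bar>X (s i) \<omega> - X 0 \<omega>\<bar> \<le> 2 * R) \<and> 2 * R < \<bar>X (s j) \<omega> - X 0 \<omega>\<bar>})"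
  define D where "D = (\<lambda>j. {\<omega> \<in> space M. \<bar>X t \<omega> - X (s j) \<omega>\<bar> \<le> R})"
  have [measurable]: "C j \<in> events" "D j \<in> events" for j unfolding C_def D_def by measurable
  have disj: "disjoint_family_on C {..n}"
    unfolding disjoint_family_on_def
  proof (intro ballI impI)
    fix i j :: nat assume "i \<noteq> j"
    then show "C i \<inter> C j = {}"
      unfolding C_def by (cases i j rule: linorder_cases) fastforce+
  qed
  have union: "{\<omega> \<in> space M. \<exists>j\<le>n. 2 * R < \<bar>X (s j) \<omega> - X 0 \<omega>\<bar>} = (\<Union>j\<in>{..n}. C j)"
  proof (intro set_eqI iffI)
    fix \<omega> assume "\<omega> \<in> {\<omega> \<in> space M. \<exists>j\<le>n. 2 * R < \<bar>X (s j) \<omega> - X 0 \<omega>\<bar>}"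
    then obtain j where \<omega>: "\<omega> \<in> space M" and j: "j \<le> n" "2 * R < \<bar>X (s j) \<omega> - X 0 \<omega>\<bar>" by auto
    define k where "k = (LEAST k. 2 * R < \<bar>X (s k) \<omega> - X 0 \<omega>\<bar>)"
    have "2 * R < \<bar>X (s k) \<omega> - X 0 \<omega>\<bar>" unfolding k_def by (rule LeastI[of _ j]) (rule j)
    moreover have "k \<le> j" unfolding k_def by (rule Least_le) (rule j)
    moreover have "\<bar>X (s i) \<omega> - X 0 \<omega>\<bar> \<le> 2 * R" if "i < k" for i
      using not_less_Least[OF that[unfolded k_def]] by simp
    ultimately have "\<omega> \<in> C k" "k \<in> {..n}" using \<omega> j unfolding C_def by auto
    then show "\<omega> \<in> (\<Union>j\<in>{..n}. C j)" by blast
  qed (auto simp: C_def)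
  have half: "1 / 2 \<le> prob (D j)" if "j \<le> n" for j
  proof -
    have "prob {\<omega> \<in> space M. R \<le> \<bar>X t \<omega> - X (s j) \<omega>\<bar>} \<le> 4 * (t - s j) / R"
      by (intro increment_tail s0 s_le R that)
    also have "\<dots> \<le> 4 * t / R" using R s0[of j] by (intro divide_right_mono) auto
    also have "\<dots> \<le> 1 / 2" using R by (simp add: field_simps)
    finally have "prob {\<omega> \<in> space M. R \<le> \<bar>X t \<omega> - X (s j) \<omega>\<bar>} \<le> 1 / 2" .
    moreover have "1 - prob (D j) \<le> prob {\<omega> \<in> space M. R \<le> \<bar>X t \<omega> - X (s j) \<omega>\<bar>}"
      unfolding prob_compl[OF \<open>D j \<in> events\<close>, symmetric] by (intro finite_measure_mono) (auto simp: D_def)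
    ultimately show ?thesis by linarith
  qed
  have "prob (\<Union>j\<in>{..n}. C j) / 2 = (\<Sum>j\<le>n. prob (C j) * (1 / 2))"
    using disj by (subst finite_measure_finite_Union) (auto simp: sum_divide_distrib)
  also have "\<dots> \<le> (\<Sum>j\<le>n. prob (C j) * prob (D j))"
    using half by (intro sum_mono mult_left_mono) auto
  also have "\<dots> = (\<Sum>j\<le>n. prob (C j \<inter> D j))"
    unfolding C_def D_def s_def using past_future_indep[OF t _ n] by (intro sum.cong) auto
  also have "\<dots> = prob (\<Union>j\<in>{..n}. C j \<inter> D j)"
    using disj by (subst finite_measure_finite_Union) (auto simp: disjoint_family_on_def)
  also have "\<dots> \<le> prob {\<omega> \<in> space M. R \<le> \<bar>X t \<omega> - X 0 \<omega>\<bar>}"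
    by (intro finite_measure_mono) (auto simp: C_def D_def)
  also have "\<dots> \<le> 4 * (t - 0) / R" by (intro increment_tail t R) auto
  finally show ?thesis unfolding union by simp
qed

lemma X_limit_right:
  assumes "\<omega> \<in> space M" "0 \<le> s" "d \<longlonglongrightarrow> s" "\<And>n. s < d n"
  shows "(\<lambda>n. X (d n) \<omega>) \<longlonglongrightarrow> X s \<omega>"
proof (rule filterlim_compose[of "\<lambda>t. X t \<omega>" "nhds (X s \<omega>)" "at_right s"])
  show "((\<lambda>t. X t \<omega>) \<longlongrightarrow> X s \<omega>) (at_right s)"
    using X_right_continuous[of \<omega> s] assms unfolding continuous_within by simp
  have "d n \<in> {s<..} \<and> d n \<noteq> s" for n using assms(4)[of n] by auto
  then show "filterlim d (at_right s) sequentially"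
    using assms(3) unfolding filterlim_at by simp
qed

text \<open>Passage to the continuous supremum along dyadic grids: the grid events increase, and right continuity
  recovers all times up to \<open>t\<close>. The null set where the path does not start at 0 goes into \<open>B\<close>.\<close>

lemma maximal_inequality:
  assumes t: "0 < t" and R: "0 < R" "8 * t \<le> R"
  obtains B where "B \<in> events" "prob B \<le> 8 * t / R"
    "\<And>\<omega> s. \<omega> \<in> space M - B \<Longrightarrow> 0 \<le> s \<Longrightarrow> s \<le> t \<Longrightarrow> \<bar>X s \<omega>\<bar> \<le> 2 * R"
proof -
  define E where "E = (\<lambda>n. {\<omega> \<in> space M. \<exists>j\<le>2^n. 2 * R < \<bar>X (t * (real j / real (2^n))) \<omega> - X 0 \<omega>\<bar>})"
  have [measurable]: "X (t * (real j / real (2^n))) \<in> borel_measurable M" "X 0 \<in> borel_measurable M" for j n :: nat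
    using t by auto
  have "E n \<in> events" for n unfolding E_def by measurable
  then have E_sets: "range E \<subseteq> events" by blast
  have E_inc: "incseq E"
  proof (intro incseq_SucI subsetI)
    fix n \<omega> assume "\<omega> \<in> E n"
    then obtain j where j: "\<omega> \<in> space M" "j \<le> 2^n" "2 * R < \<bar>X (t * (real j / real (2^n))) \<omega> - X 0 \<omega>\<bar>"
      unfolding E_def by auto
    have "real (2 * j) / real (2 ^ Suc n) = real j / real (2^n)" by simp
    with j have "2 * R < \<bar>X (t * (real (2 * j) / real (2 ^ Suc n))) \<omega> - X 0 \<omega>\<bar>" by metis
    moreover have "2 * j \<le> 2 ^ Suc n" using j by simp
    ultimately show "\<omega> \<in> E (Suc n)" unfolding E_def using j(1) by blast
  qed
  have "prob (E n) \<le> 8 * t / R" for n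
    unfolding E_def using maximal_inequality_grid[of t R "2^n"] t R by simp
  then have E_prob: "prob (\<Union>n. E n) \<le> 8 * t / R"
    using finite_Lim_measure_incseq[OF E_sets E_inc] by (intro LIMSEQ_le_const2) auto
  obtain N where N: "N \<in> null_sets M" "{\<omega> \<in> space M. X 0 \<omega> \<noteq> 0} \<subseteq> N"
    using X_start by (auto simp: eventually_ae_filter)
  define B where "B = (\<Union>n. E n) \<union> N"
  have sets: "(\<Union>n. E n) \<in> events" using E_sets by auto
  show thesis
  proof
    show "B \<in> events" unfolding B_def using sets N by auto
    show "prob B \<le> 8 * t / R" unfolding B_def using measure_Un_null_set[OF sets N(1)] E_prob by simp
    fix \<omega> s assume \<omega>: "\<omega> \<in> space M - B" and s: "0 \<le> s" "s \<le> t"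
    have X0: "X 0 \<omega> = 0" using \<omega> N unfolding B_def by auto
    have grid: "\<bar>X (t * (real j / real (2^n))) \<omega>\<bar> \<le> 2 * R" if "j \<le> 2^n" for j n :: nat
      using \<omega> that X0 unfolding B_def E_def by (auto simp: not_less)
    show "\<bar>X s \<omega>\<bar> \<le> 2 * R"
    proof (cases "s = t")
      case True
      then show ?thesis using grid[of "2^0" 0] by simp
    next
      case False
      with s have st: "s < t" by simp
      define j where "j = (\<lambda>n. nat \<lfloor>s / t * 2^n\<rfloor> + 1)"
      define d where "d = (\<lambda>n::nat. t * (real (j n) / real (2^n)))"
      have r: "real (j n) = of_int \<lfloor>s / t * 2^n\<rfloor> + 1" for n
        unfolding j_def using s t by (simp add: of_nat_nat)
      have j_le: "j n \<le> 2^n" for n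
      proof -
        have "s / t * 2^n < 1 * 2^n" using st t by (intro mult_strict_right_mono) auto
        then have "\<lfloor>s / t * 2^n\<rfloor> < 2^n" by (simp add: floor_less_iff)
        then have "\<lfloor>s / t * 2^n\<rfloor> + 1 \<le> 2^n" by simp
        then have "real_of_int (\<lfloor>s / t * 2^n\<rfloor> + 1) \<le> real_of_int (2^n)" by (simp only: of_int_le_iff)
        then have "real (j n) \<le> real (2 ^ n)" unfolding r by simp
        then show ?thesis by (simp only: of_nat_le_iff)
      qed
      have d_gt: "s < d n" for n
      proof -
        have "s / t * 2^n < real (j n)" unfolding r by linarith
        then show ?thesis unfolding d_def using t by (simp add: field_simps)
      qed
      have d_le: "d n \<le> s + t / 2^n" for n
      proof -
        have "real (j n) \<le> s / t * 2^n + 1" unfolding r by linarith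
        then show ?thesis unfolding d_def using t by (simp add: field_simps)
      qed
      have "(\<lambda>n. s + t / 2^n) \<longlonglongrightarrow> s" by real_asymp
      then have "d \<longlonglongrightarrow> s"
        using d_gt d_le by (intro tendsto_sandwich[of "\<lambda>_. s" d sequentially "\<lambda>n. s + t / 2^n"]) (auto intro!: always_eventually less_imp_le)
      with \<omega> s d_gt have "(\<lambda>n. X (d n) \<omega>) \<longlonglongrightarrow> X s \<omega>" by (intro X_limit_right) auto
      then have "(\<lambda>n. \<bar>X (d n) \<omega>\<bar>) \<longlonglongrightarrow> \<bar>X s \<omega>\<bar>" by (rule tendsto_rabs)
      then show ?thesis
        by (rule LIMSEQ_le_const2) (use grid j_le in \<open>auto simp: d_def\<close>)
    qed
  qed
qed

text \<open>The process is a limit of processes that are constant on small time intervals, namely its values at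
  the next grid time to the right. The \<open>max\<close> extends it to negative times.\<close>

lemma joint_measurable: "(\<lambda>(\<omega>, s). X (max 0 s) \<omega>) \<in> borel_measurable (M \<Otimes>\<^sub>M lborel)"
proof (rule borel_measurable_LIMSEQ_metric)
  define i where "i = (\<lambda>n s. nat \<lfloor>max 0 s * Suc n\<rfloor> + 1)"
  fix n
  have [measurable]: "X (real j / Suc n) \<in> borel_measurable M" for j by simp
  have "(\<lambda>s. \<lfloor>max 0 s * Suc n\<rfloor>) \<in> measurable borel (count_space UNIV)"
    by (rule measurable_compose[OF _ measurable_real_floor]) (auto intro!: borel_measurable_continuous_onI continuous_intros)
  then have [measurable]: "i n \<in> measurable borel (count_space UNIV)"
    unfolding i_def by (rule measurable_compose) simp
  show "(\<lambda>(\<omega>, s). X (real (nat \<lfloor>max 0 s * Suc n\<rfloor> + 1) / Suc n) \<omega>) \<in> borel_measurable (M \<Otimes>\<^sub>M lborel)"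
    unfolding i_def[symmetric] split_beta'
    by (rule measurable_compose_countable[where f = "\<lambda>j p. X (real j / Suc n) (fst p)"]) measurable
next
  fix p :: "'w \<times> real" assume p: "p \<in> space (M \<Otimes>\<^sub>M lborel)"
  obtain \<omega> s where ps: "p = (\<omega>, s)" by (cases p)
  have \<omega>: "\<omega> \<in> space M" using p ps by (auto simp: space_pair_measure)
  define d where "d = (\<lambda>n. real (nat \<lfloor>max 0 s * Suc n\<rfloor> + 1) / Suc n)"
  have r: "real (nat \<lfloor>max 0 s * Suc n\<rfloor> + 1) = of_int \<lfloor>max 0 s * Suc n\<rfloor> + 1" for n by simp
  have d_gt: "max 0 s < d n" for n
  proof -
    have "max 0 s * Suc n < real (nat \<lfloor>max 0 s * Suc n\<rfloor> + 1)" unfolding r by linarith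
    then show ?thesis unfolding d_def by (simp add: less_divide_eq)
  qed
  have d_le: "d n \<le> max 0 s + 1 / Suc n" for n
  proof -
    have "real (nat \<lfloor>max 0 s * Suc n\<rfloor> + 1) \<le> max 0 s * Suc n + 1" unfolding r by linarith
    then show ?thesis unfolding d_def by (simp add: divide_le_eq distrib_right)
  qed
  have "(\<lambda>n. max 0 s + 1 / Suc n) \<longlonglongrightarrow> max 0 s" by real_asymp
  then have "d \<longlonglongrightarrow> max 0 s"
    using d_gt d_le by (intro tendsto_sandwich[of "\<lambda>_. max 0 s" d sequentially "\<lambda>n. max 0 s + 1 / Suc n"]) (auto intro!: always_eventually less_imp_le)
  with \<omega> d_gt have "(\<lambda>n. X (d n) \<omega>) \<longlonglongrightarrow> X (max 0 s) \<omega>" by (intro X_limit_right) auto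
  then show "(\<lambda>n. case p of (\<omega>, s) \<Rightarrow> X (real (nat \<lfloor>max 0 s * Suc n\<rfloor> + 1) / Suc n) \<omega>) \<longlonglongrightarrow> (case p of (\<omega>, s) \<Rightarrow> X (max 0 s) \<omega>)"
    unfolding ps d_def by simp
qed

end

section \<open>The Feynman-Kac semigroup at small times\<close>

context cauchy_motion
begin

text \<open>The Feynman-Kac weight is \<open>exp (- action t x \<omega>)\<close>.\<close>

definition action :: "real \<Rightarrow> real \<Rightarrow> 'w \<Rightarrow> real" where
  "action t x \<omega> = (LINT s:{0..t}|lborel. (x + X s \<omega>)\<^sup>2)"

text \<open>Minus the difference quotient at time 0 of the Feynman-Kac weight; it tends to \<open>x\<^sup>2\<close> along almost every path.\<close>

definition killing_rate :: "real \<Rightarrow> real \<Rightarrow> 'w \<Rightarrow> real" where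
  "killing_rate t x \<omega> = (1 - exp (- action t x \<omega>)) / t"

lemma action_eq: "action t x \<omega> = (LINT s|lborel. indicator {0..t} s * (x + X (max 0 s) \<omega>)\<^sup>2)"
  unfolding action_def set_lebesgue_integral_def
  by (rule Bochner_Integration.integral_cong) (auto simp: indicator_def)

lemma action_nonneg: "0 \<le> action t x \<omega>"
  unfolding action_eq by simp

lemma measurable_action [measurable]:
  assumes f[measurable]: "f \<in> borel_measurable N" and g[measurable]: "g \<in> measurable N M"
  shows "(\<lambda>p. action t (f p) (g p)) \<in> borel_measurable N"
proof -
  have "(\<lambda>q. (g (fst q), snd q)) \<in> measurable (N \<Otimes>\<^sub>M lborel) (M \<Otimes>\<^sub>M lborel)" by measurable
  from measurable_compose[OF this joint_measurable]
  have [measurable]: "(\<lambda>q. X (max 0 (snd q)) (g (fst q))) \<in> borel_measurable (N \<Otimes>\<^sub>M lborel)" by simp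
  have "(\<lambda>(p, s). indicator {0..t} s * (f p + X (max 0 s) (g p))\<^sup>2) \<in> borel_measurable (N \<Otimes>\<^sub>M lborel)"
    unfolding split_beta' by measurable
  from lborel.borel_measurable_lebesgue_integral[OF this] show ?thesis unfolding action_eq by simp
qed

lemma action_bounds:
  assumes \<omega>: "\<omega> \<in> space M" and t: "0 \<le> t" and l: "\<And>s. 0 \<le> s \<Longrightarrow> s \<le> t \<Longrightarrow> l \<le> (x + X s \<omega>)\<^sup>2"
    and h: "\<And>s. 0 \<le> s \<Longrightarrow> s \<le> t \<Longrightarrow> (x + X s \<omega>)\<^sup>2 \<le> h"
  shows "t * l \<le> action t x \<omega>" and "action t x \<omega> \<le> t * h"
proof -
  have h0: "0 \<le> h" using h[of 0] t by (meson order_trans order_refl zero_le_power2)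
  have sec: "(\<lambda>s. X (max 0 s) \<omega>) \<in> borel_measurable lborel"
    using measurable_compose[OF measurable_Pair1'[OF \<omega>] joint_measurable] by simp
  have ih: "integrable lborel (\<lambda>s. indicator {0..t} s * c)" for c :: real
    by (intro integrable_mult_left integrable_real_indicator) (auto simp: emeasure_lborel_Icc_eq)
  have val: "(LINT s|lborel. indicator {0..t} s * c) = t * c" for c :: real using t by simp
  have i: "integrable lborel (\<lambda>s. indicator {0..t} s * (x + X (max 0 s) \<omega>)\<^sup>2)"
    by (rule Bochner_Integration.integrable_bound[OF ih[of h]]) (use sec h h0 in \<open>auto simp: indicator_def\<close>)
  show "action t x \<omega> \<le> t * h" unfolding action_eq val[symmetric]
    by (rule integral_mono[OF i ih]) (use h in \<open>auto simp: indicator_def\<close>)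
  show "t * l \<le> action t x \<omega>" unfolding action_eq val[symmetric]
    by (rule integral_mono[OF ih i]) (use l in \<open>auto simp: indicator_def\<close>)
qed

lemma killing_rate_nonneg: "0 < t \<Longrightarrow> 0 \<le> killing_rate t x \<omega>"
  unfolding killing_rate_def using action_nonneg[of t x \<omega>] by simp

lemma killing_rate_le_inverse: "0 < t \<Longrightarrow> killing_rate t x \<omega> \<le> 1 / t"
  unfolding killing_rate_def by (simp add: divide_right_mono)

lemma killing_rate_bounds:
  assumes t: "0 < t"
  shows "killing_rate t x \<omega> \<le> action t x \<omega> / t"
    and "(action t x \<omega> / t) / (1 + action t x \<omega>) \<le> killing_rate t x \<omega>"
proof -
  define A where "A = action t x \<omega>"
  have A0: "0 \<le> A" unfolding A_def by (rule action_nonneg)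
  have "1 - exp (- A) \<le> A" using exp_ge_add_one_self[of "- A"] by simp
  then show "killing_rate t x \<omega> \<le> action t x \<omega> / t"
    unfolding killing_rate_def A_def[symmetric] using t by (intro divide_right_mono) auto
  have "exp (- A) \<le> 1 / (1 + A)"
    using exp_ge_add_one_self[of A] A0 by (simp add: exp_minus inverse_eq_divide frac_le)
  then have "A / (1 + A) \<le> 1 - exp (- A)" using A0 by (simp add: field_simps)
  then have "A / (1 + A) / t \<le> (1 - exp (- A)) / t" using t by (intro divide_right_mono) auto
  then show "(action t x \<omega> / t) / (1 + action t x \<omega>) \<le> killing_rate t x \<omega>"
    unfolding killing_rate_def A_def[symmetric] by (simp add: mult.commute)
qed

lemma killing_rate_le:
  assumes "\<omega> \<in> space M" and t: "0 < t" and R: "\<And>s. 0 \<le> s \<Longrightarrow> s \<le> t \<Longrightarrow> \<bar>X s \<omega>\<bar> \<le> R"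
  shows "killing_rate t x \<omega> \<le> (\<bar>x\<bar> + R)\<^sup>2"
proof -
  have "(x + X s \<omega>)\<^sup>2 \<le> (\<bar>x\<bar> + R)\<^sup>2" if "0 \<le> s" "s \<le> t" for s
    using R[OF that] by (intro power2_le_iff_abs_le[THEN iffD2]) auto
  then have "action t x \<omega> \<le> t * (\<bar>x\<bar> + R)\<^sup>2"
    using t by (intro action_bounds(2)[OF assms(1), where l = 0]) auto
  then have "action t x \<omega> / t \<le> (\<bar>x\<bar> + R)\<^sup>2" using t by (simp add: field_simps)
  then show ?thesis using killing_rate_bounds(1)[OF t, of x \<omega>] by linarith
qed

lemma path_small:
  assumes \<omega>: "\<omega> \<in> space M" "X 0 \<omega> = 0" and d: "0 < d" and \<tau>: "\<tau> \<longlonglongrightarrow> 0"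
  shows "\<forall>\<^sub>F n in sequentially. \<forall>s. 0 \<le> s \<longrightarrow> s \<le> \<tau> n \<longrightarrow> \<bar>X s \<omega>\<bar> \<le> d"
proof -
  have "((\<lambda>t. X t \<omega>) \<longlongrightarrow> 0) (at_right 0)"
    using X_right_continuous[of \<omega> 0] \<omega> unfolding continuous_within by simp
  from tendstoD[OF this d] obtain b where b: "b > 0" "\<And>s. 0 < s \<Longrightarrow> s < b \<Longrightarrow> \<bar>X s \<omega>\<bar> < d"
    unfolding eventually_at_right_field by auto
  have "\<forall>\<^sub>F n in sequentially. \<tau> n < b" using order_tendstoD(2)[OF \<tau> b(1)] .
  then show ?thesis
  proof eventually_elim
    case (elim n)
    show ?case
    proof (intro allI impI)
      fix s assume "0 \<le> s" "s \<le> \<tau> n"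
      then show "\<bar>X s \<omega>\<bar> \<le> d" using b(2)[of s] elim d \<omega>(2) by (cases "s = 0") auto
    qed
  qed
qed

text \<open>Seen from the endpoint \<open>y\<close> of the path: after the substitution \<open>y = x + X t\<close> the eigenfunction, about which
  only square integrability is known, no longer depends on the path.\<close>

lemma killing_rate_limit:
  assumes \<omega>: "\<omega> \<in> space M" "X 0 \<omega> = 0" and \<tau>: "\<tau> \<longlonglongrightarrow> 0" "\<And>n. 0 < \<tau> n"
  shows "(\<lambda>n. killing_rate (\<tau> n) (y - X (\<tau> n) \<omega>) \<omega>) \<longlonglongrightarrow> y\<^sup>2"
proof -
  define a where "a = (\<lambda>n. action (\<tau> n) (y - X (\<tau> n) \<omega>) \<omega> / \<tau> n)"
  have a: "a \<longlonglongrightarrow> y\<^sup>2"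
  proof (rule tendstoI)
    fix e :: real assume e: "0 < e"
    define d where "d = min 1 (e / (8 * (1 + \<bar>y\<bar>)))"
    have d: "0 < d" "d \<le> 1" "d \<le> e / (8 * (1 + \<bar>y\<bar>))" using e unfolding d_def by auto
    have de: "4 * d * (1 + \<bar>y\<bar>) \<le> e / 2"
    proof -
      have "d * (8 * (1 + \<bar>y\<bar>)) \<le> e" using d(3) by (simp add: field_simps)
      then show ?thesis by (simp add: algebra_simps)
    qed
    show "\<forall>\<^sub>F n in sequentially. dist (a n) (y\<^sup>2) < e"
      using path_small[OF \<omega> d(1) \<tau>(1)]
    proof eventually_elim
      case (elim n)
      have sq: "\<bar>(y - X (\<tau> n) \<omega> + X s \<omega>)\<^sup>2 - y\<^sup>2\<bar> \<le> e / 2" if "0 \<le> s" "s \<le> \<tau> n" for s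
      proof -
        define p where "p = X s \<omega> - X (\<tau> n) \<omega>"
        have "\<bar>X s \<omega>\<bar> \<le> d" "\<bar>X (\<tau> n) \<omega>\<bar> \<le> d" using elim that \<tau>(2)[of n] by auto
        then have p: "\<bar>p\<bar> \<le> 2 * d" unfolding p_def by linarith
        have "(y - X (\<tau> n) \<omega> + X s \<omega>)\<^sup>2 - y\<^sup>2 = p * (p + 2 * y)"
          unfolding p_def by (simp add: power2_eq_square algebra_simps)
        then have "\<bar>(y - X (\<tau> n) \<omega> + X s \<omega>)\<^sup>2 - y\<^sup>2\<bar> = \<bar>p\<bar> * \<bar>p + 2 * y\<bar>" by (simp add: abs_mult)
        also have "\<dots> \<le> (2 * d) * (2 + 2 * \<bar>y\<bar>)" using p d by (intro mult_mono) auto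
        also have "\<dots> = 4 * d * (1 + \<bar>y\<bar>)" by (simp add: algebra_simps)
        finally show ?thesis using de by linarith
      qed
      have lo: "y\<^sup>2 - e / 2 \<le> (y - X (\<tau> n) \<omega> + X s \<omega>)\<^sup>2" and hi: "(y - X (\<tau> n) \<omega> + X s \<omega>)\<^sup>2 \<le> y\<^sup>2 + e / 2"
        if "0 \<le> s" "s \<le> \<tau> n" for s
        using sq[OF that] by linarith+
      note ab = action_bounds[OF \<omega>(1) less_imp_le[OF \<tau>(2)], of n "y\<^sup>2 - e / 2" "y - X (\<tau> n) \<omega>" "y\<^sup>2 + e / 2", OF lo hi]
      have "\<tau> n * (y\<^sup>2 - e / 2) \<le> action (\<tau> n) (y - X (\<tau> n) \<omega>) \<omega>"
        by (rule ab(1))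
      moreover have "action (\<tau> n) (y - X (\<tau> n) \<omega>) \<omega> \<le> \<tau> n * (y\<^sup>2 + e / 2)"
        by (rule ab(2))
      ultimately have "y\<^sup>2 - e / 2 \<le> a n" "a n \<le> y\<^sup>2 + e / 2"
        unfolding a_def using \<tau>(2)[of n] by (auto simp: field_simps)
      then show ?case using e by (simp add: dist_real_def abs_le_iff)
    qed
  qed
  show ?thesis
  proof (rule tendsto_sandwich[of "\<lambda>n. a n / (1 + \<tau> n * a n)" _ _ a])
    show "\<forall>\<^sub>F n in sequentially. killing_rate (\<tau> n) (y - X (\<tau> n) \<omega>) \<omega> \<le> a n"
      unfolding a_def by (intro always_eventually allI killing_rate_bounds \<tau>)
    have "\<tau> n * a n = action (\<tau> n) (y - X (\<tau> n) \<omega>) \<omega>" for n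
      unfolding a_def using \<tau>(2)[of n] by simp
    then show "\<forall>\<^sub>F n in sequentially. a n / (1 + \<tau> n * a n) \<le> killing_rate (\<tau> n) (y - X (\<tau> n) \<omega>) \<omega>"
      unfolding a_def using killing_rate_bounds(2)[OF \<tau>(2)] by auto
    have "(\<lambda>n. a n / (1 + \<tau> n * a n)) \<longlonglongrightarrow> y\<^sup>2 / (1 + 0 * y\<^sup>2)"
      by (intro tendsto_intros a \<tau>) auto
    then show "(\<lambda>n. a n / (1 + \<tau> n * a n)) \<longlonglongrightarrow> y\<^sup>2" by simp
  qed (rule a)
qed

text \<open>By translation invariance, a correlation of two square-integrable functions with a random
  shift is jointly integrable.\<close>

lemma integrable_shifted_product:
  fixes f g :: "real \<Rightarrow> complex" and w :: "'w \<times> real \<Rightarrow> real"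
  assumes f[measurable]: "f \<in> borel_measurable borel" and f2: "in_L2 f"
    and g[measurable]: "g \<in> borel_measurable borel" and g2: "in_L2 g"
    and Z[measurable]: "Z \<in> borel_measurable M"
    and w[measurable]: "w \<in> borel_measurable (M \<Otimes>\<^sub>M lborel)" and wC: "\<And>p. \<bar>w p\<bar> \<le> C"
  shows "integrable (M \<Otimes>\<^sub>M lborel) (\<lambda>(\<omega>, y). w (\<omega>, y) *\<^sub>R (f y * g (y + Z \<omega>)))"
proof -
  interpret pair_sigma_finite M lborel ..
  have sq: "integrable (M \<Otimes>\<^sub>M lborel) (\<lambda>(\<omega>, y). (cmod (h (y + Z' \<omega>)))\<^sup>2)"
    if [measurable]: "h \<in> borel_measurable borel" "Z' \<in> borel_measurable M" and h2: "in_L2 h"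
    for h :: "real \<Rightarrow> complex" and Z'
  proof (rule Fubini_integrable)
    have v: "(LINT y|lborel. (cmod (h (y + c)))\<^sup>2) = (L2_sq h)" for c
      using lborel_integral_real_affine[of 1 "\<lambda>y. (cmod (h y))\<^sup>2" c] by (simp add: add.commute)
    have iv: "integrable lborel (\<lambda>y. (cmod (h (y + c)))\<^sup>2)" for c
      using lborel_integrable_real_affine[OF h2, of 1 c] by (simp add: add.commute)
    show "integrable M (\<lambda>\<omega>. LINT y|lborel. norm (case (\<omega>, y) of (\<omega>, y) \<Rightarrow> (cmod (h (y + Z' \<omega>)))\<^sup>2))"
      by (simp add: v)
    show "AE \<omega> in M. integrable lborel (\<lambda>y. case (\<omega>, y) of (\<omega>, y) \<Rightarrow> (cmod (h (y + Z' \<omega>)))\<^sup>2)"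
      using iv by simp
  qed measurable
  have 1: "integrable (M \<Otimes>\<^sub>M lborel) (\<lambda>p. f (snd p) * g (snd p + Z (fst p)))"
    using sq[OF f _ f2, of "\<lambda>_. 0"] sq[OF g Z g2]
    by (intro cauchy_schwarz_L2) (auto simp: split_beta')
  show ?thesis
  proof (rule Bochner_Integration.integrable_bound[OF integrable_mult_right[OF integrable_norm[OF 1], of C]])
    show "AE p in M \<Otimes>\<^sub>M lborel. norm (case p of (\<omega>, y) \<Rightarrow> w (\<omega>, y) *\<^sub>R (f y * g (y + Z \<omega>)))
      \<le> norm (C * norm (f (snd p) * g (snd p + Z (fst p))))"
      using wC order_trans[OF abs_ge_zero wC] by (auto simp: split_beta' abs_mult intro!: mult_right_mono)
  qed measurable
qed

lemma killing_rate_measurable [measurable]: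
  assumes [measurable]: "f \<in> borel_measurable N" "g \<in> measurable N M"
  shows "(\<lambda>p. killing_rate t (f p) (g p)) \<in> borel_measurable N"
  unfolding killing_rate_def by measurable

lemma killing_rate_abs: "0 < t \<Longrightarrow> \<bar>killing_rate t x \<omega>\<bar> \<le> 1 / t"
  using killing_rate_nonneg[of t x \<omega>] killing_rate_le_inverse[of t x \<omega>] by simp

text \<open>The free part of the semigroup acts on a test function through its Fourier multiplier.\<close>

lemma free_pairing:
  assumes [measurable]: "\<phi> \<in> borel_measurable borel" and \<phi>2: "in_L2 \<phi>"
    and v: "integrable lborel v" and v2: "in_L2 v" and t: "0 \<le> t"
  shows "(LINT \<omega>|M. LINT y|lborel. \<phi> y * fourier v (y - X t \<omega>))
    = (LINT y|lborel. \<phi> y * fourier (\<lambda>k. of_real (exp (- t * \<bar>k\<bar>)) * v k) y)"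
proof -
  interpret pair_sigma_finite M lborel ..
  have [measurable]: "X t \<in> borel_measurable M" using t by simp
  have [measurable]: "v \<in> borel_measurable borel" using v by auto
  have int: "integrable (M \<Otimes>\<^sub>M lborel) (\<lambda>(\<omega>, y). 1 *\<^sub>R (\<phi> y * fourier v (y + - X t \<omega>)))"
    by (rule integrable_shifted_product[where C = 1]) (auto intro: \<phi>2 plancherel_bound v v2)
  have "(LINT \<omega>|M. LINT y|lborel. \<phi> y * fourier v (y - X t \<omega>)) = (LINT y|lborel. LINT \<omega>|M. \<phi> y * fourier v (y - X t \<omega>))"
    using Fubini_integral[OF int] by simp
  also have "\<dots> = (LINT y|lborel. \<phi> y * (LINT \<omega>|M. fourier v (y - X t \<omega>)))"
    by simp
  also have "\<dots> = (LINT y|lborel. \<phi> y * fourier (\<lambda>k. of_real (exp (- t * \<bar>k\<bar>)) * v k) y)"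
  proof -
    have "(LINT \<omega>|M. fourier v (y - X t \<omega>)) = fourier (\<lambda>k. of_real (exp (- t * \<bar>k\<bar>)) * v k) y" for y
    proof -
      have i2: "integrable (M \<Otimes>\<^sub>M lborel) (\<lambda>(\<omega>, k). iexp (k * (y - X t \<omega>)) * v k)"
      proof (rule Fubini_integrable)
        show "integrable M (\<lambda>\<omega>. LINT k|lborel. norm (case (\<omega>, k) of (\<omega>, k) \<Rightarrow> iexp (k * (y - X t \<omega>)) * v k))"
          by (simp add: norm_mult)
        show "AE \<omega> in M. integrable lborel (\<lambda>k. case (\<omega>, k) of (\<omega>, k) \<Rightarrow> iexp (k * (y - X t \<omega>)) * v k)"
          unfolding prod.case by (intro AE_I2 integrable_iexp_mult v)
      qed measurable
      have "(LINT \<omega>|M. fourier v (y - X t \<omega>)) = (LINT k|lborel. LINT \<omega>|M. iexp (k * (y - X t \<omega>)) * v k)"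
        unfolding fourier_def using Fubini_integral[OF i2] by simp
      also have "\<dots> = (LINT k|lborel. LINT \<omega>|M. iexp ((- k) * X t \<omega>) * (iexp (k * y) * v k))"
        by (intro Bochner_Integration.integral_cong) (auto simp: algebra_simps simp flip: exp_add)
      also have "\<dots> = (LINT k|lborel. (LINT \<omega>|M. iexp ((- k) * X t \<omega>)) * (iexp (k * y) * v k))"
        by simp
      also have "\<dots> = fourier (\<lambda>k. of_real (exp (- t * \<bar>k\<bar>)) * v k) y"
        unfolding X_char[OF t] fourier_def by (simp add: mult_ac)
      finally show ?thesis .
    qed
    then show ?thesis by simp
  qed
  finally show ?thesis .
qed

text \<open>By the Plancherel bound it suffices that the multipliers \<open>(1 - exp (- t \<bar>k\<bar>)) / t\<close> converge to \<open>\<bar>k\<bar>\<close>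
  uniformly on the compact support of \<open>v\<close>, at rate \<open>t k\<^sup>2\<close>.\<close>

lemma free_generator_limit:
  assumes [measurable]: "\<phi> \<in> borel_measurable borel" and \<phi>2: "in_L2 \<phi>"
    and c: "continuous_on UNIV v" and s: "compact_supp v"
    and \<tau>: "\<tau> \<longlonglongrightarrow> 0" "\<And>n. 0 < \<tau> n"
  shows "(\<lambda>n. LINT y|lborel. \<phi> y * fourier (\<lambda>k. of_real ((1 - exp (- \<tau> n * \<bar>k\<bar>)) / \<tau> n) * v k) y)
    \<longlonglongrightarrow> (LINT y|lborel. \<phi> y * fourier (\<lambda>k. of_real \<bar>k\<bar> * v k) y)"
proof -
  define m where "m = (\<lambda>n k. (1 - exp (- \<tau> n * \<bar>k\<bar>)) / \<tau> n)"
  have m_le: "m n k \<le> \<bar>k\<bar>" and m_ge: "\<bar>k\<bar> - m n k \<le> \<tau> n * k\<^sup>2" for n k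
  proof -
    have t: "0 < \<tau> n" by (rule \<tau>)
    have "1 - exp (- \<tau> n * \<bar>k\<bar>) \<le> \<tau> n * \<bar>k\<bar>" using exp_ge_add_one_self[of "- \<tau> n * \<bar>k\<bar>"] by simp
    then show "m n k \<le> \<bar>k\<bar>" unfolding m_def using t by (simp add: field_simps)
    define a where "a = \<tau> n * \<bar>k\<bar>"
    have a0: "0 \<le> a" unfolding a_def using t by simp
    have "exp (- a) * (1 + a) \<le> 1"
    proof -
      have "(1 + a) \<le> exp a" by (rule exp_ge_add_one_self)
      then have "exp (- a) * (1 + a) \<le> exp (- a) * exp a" by (intro mult_left_mono) auto
      then show ?thesis by (simp add: exp_minus)
    qed
    moreover have "1 - a + a\<^sup>2 \<ge> 1 / (1 + a)"
    proof -
      have "(1 - a + a\<^sup>2) * (1 + a) = 1 + a ^ 3" by (simp add: power2_eq_square power3_eq_cube algebra_simps)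
      then show ?thesis using a0 by (simp add: divide_le_eq)
    qed
    ultimately have "exp (- a) \<le> 1 - a + a\<^sup>2" 
    proof -
      have "exp (- a) \<le> 1 / (1 + a)" using \<open>exp (- a) * (1 + a) \<le> 1\<close> a0 by (simp add: le_divide_eq)
      then show ?thesis using \<open>1 - a + a\<^sup>2 \<ge> 1 / (1 + a)\<close> by linarith
    qed
    moreover have "\<tau> n * (\<bar>k\<bar> - m n k) = a - (1 - exp (- a))"
      unfolding m_def a_def right_diff_distrib[of "\<tau> n" "\<bar>k\<bar>"] using t by simp
    moreover have "a\<^sup>2 = \<tau> n * (\<tau> n * k\<^sup>2)" unfolding a_def by (simp add: power_mult_distrib power2_eq_square)
    ultimately have "\<tau> n * (\<bar>k\<bar> - m n k) \<le> \<tau> n * (\<tau> n * k\<^sup>2)" by linarith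
    then show "\<bar>k\<bar> - m n k \<le> \<tau> n * k\<^sup>2" using t by simp
  qed
  have cm: "continuous_on UNIV (\<lambda>k. of_real (m n k) * v k)" for n
    unfolding m_def using \<tau>(2)[of n] by (intro continuous_intros c) auto
  have ca: "continuous_on UNIV (\<lambda>k. of_real \<bar>k\<bar> * v k)" by (intro continuous_intros c)
  have c2: "continuous_on UNIV (\<lambda>k. of_real (k\<^sup>2) * v k)" by (intro continuous_intros c)
  have cd: "continuous_on UNIV (\<lambda>k. of_real (m n k - \<bar>k\<bar>) * v k)" for n
    using continuous_on_diff[OF cm ca] by (simp add: algebra_simps)
  define I where "I = (LINT k|lborel. (cmod (of_real (k\<^sup>2) * v k))\<^sup>2)"
  define K where "K = sqrt (2 * pi * (L2_sq \<phi>))"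
  have bd: "cmod ((LINT y|lborel. \<phi> y * fourier (\<lambda>k. of_real (m n k) * v k) y) - (LINT y|lborel. \<phi> y * fourier (\<lambda>k. of_real \<bar>k\<bar> * v k) y)) \<le> K * (\<tau> n * sqrt I)" for n
  proof -
    note im = integrable_compact_supp_complex[OF cm compact_supp_mult[OF s]]
    note ia = integrable_compact_supp_complex[OF ca compact_supp_mult[OF s]]
    note id = integrable_compact_supp_complex[OF cd compact_supp_mult[OF s]]
    have fd: "fourier (\<lambda>k. of_real (m n k) * v k) y - fourier (\<lambda>k. of_real \<bar>k\<bar> * v k) y = fourier (\<lambda>k. of_real (m n k - \<bar>k\<bar>) * v k) y" for y
      using fourier_diff[OF im(1)[of n] ia(1), of 1 y] by (simp add: left_diff_distrib)
    have "(LINT y|lborel. \<phi> y * fourier (\<lambda>k. of_real (m n k) * v k) y) - (LINT y|lborel. \<phi> y * fourier (\<lambda>k. of_real \<bar>k\<bar> * v k) y)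
      = (LINT y|lborel. \<phi> y * fourier (\<lambda>k. of_real (m n k) * v k) y - \<phi> y * fourier (\<lambda>k. of_real \<bar>k\<bar> * v k) y)"
      by (intro Bochner_Integration.integral_diff[symmetric] pairing_fourier_bound im ia \<phi>2) simp_all
    also have "\<dots> = (LINT y|lborel. \<phi> y * fourier (\<lambda>k. of_real (m n k - \<bar>k\<bar>) * v k) y)"
      by (simp only: fd right_diff_distrib[symmetric])
    finally have "cmod ((LINT y|lborel. \<phi> y * fourier (\<lambda>k. of_real (m n k) * v k) y) - (LINT y|lborel. \<phi> y * fourier (\<lambda>k. of_real \<bar>k\<bar> * v k) y))
      \<le> K * sqrt (LINT k|lborel. (cmod (of_real (m n k - \<bar>k\<bar>) * v k))\<^sup>2)"
      unfolding K_def using pairing_fourier_bound(2)[OF _ \<phi>2 id[of n]] by simp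
    also have "\<dots> \<le> K * sqrt (LINT k|lborel. (\<tau> n)\<^sup>2 * (cmod (of_real (k\<^sup>2) * v k))\<^sup>2)"
    proof (intro mult_left_mono real_sqrt_le_mono integral_mono id(2) integrable_mult_right integrable_compact_supp_complex(2)[OF c2 compact_supp_mult[OF s]])
      fix k
      have "\<bar>m n k - \<bar>k\<bar>\<bar> \<le> \<tau> n * k\<^sup>2" using m_le[of n k] m_ge[of k n] by simp
      then have "(cmod (of_real (m n k - \<bar>k\<bar>) * v k))\<^sup>2 \<le> (\<tau> n * k\<^sup>2 * cmod (v k))\<^sup>2"
        by (intro power_mono) (auto simp: norm_mult simp del: of_real_diff intro!: mult_right_mono)
      then show "(cmod (of_real (m n k - \<bar>k\<bar>) * v k))\<^sup>2 \<le> (\<tau> n)\<^sup>2 * (cmod (of_real (k\<^sup>2) * v k))\<^sup>2"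
        by (simp add: norm_mult norm_power power_mult_distrib mult_ac)
    qed (simp add: K_def)
    also have "\<dots> = K * (\<tau> n * sqrt I)"
      unfolding I_def using \<tau>(2)[of n] by (simp add: real_sqrt_mult)
    finally show ?thesis .
  qed
  have "(\<lambda>n. K * (\<tau> n * sqrt I)) \<longlonglongrightarrow> K * (0 * sqrt I)" by (intro tendsto_intros \<tau>)
  then have z: "(\<lambda>n. K * (\<tau> n * sqrt I)) \<longlonglongrightarrow> 0" by simp
  have "(\<lambda>n. (LINT y|lborel. \<phi> y * fourier (\<lambda>k. of_real (m n k) * v k) y) - (LINT y|lborel. \<phi> y * fourier (\<lambda>k. of_real \<bar>k\<bar> * v k) y)) \<longlonglongrightarrow> 0"
    by (rule Lim_null_comparison[OF _ z]) (use bd in auto)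
  then show ?thesis unfolding m_def by (simp add: LIM_zero_iff)
qed

end

lemma integrable_inverse_square: "integrable lborel (\<lambda>x::real. (1 / (1 + \<bar>x\<bar>))\<^sup>2)"
proof (rule Bochner_Integration.integrable_bound)
  show "integrable lborel (\<lambda>x::real. inverse (1 + x\<^sup>2))"
    using integrable_inverse_1_plus_square by (simp add: set_integrable_def einterval_def)
  show "AE x::real in lborel. norm ((1 / (1 + \<bar>x\<bar>))\<^sup>2) \<le> norm (inverse (1 + x\<^sup>2))"
  proof (rule AE_I2)
    fix x :: real
    have "1 + x\<^sup>2 \<le> (1 + \<bar>x\<bar>)\<^sup>2" by (simp add: power2_eq_square algebra_simps)
    moreover have "0 < 1 + x\<^sup>2" by (simp add: add_pos_nonneg)
    ultimately have "inverse ((1 + \<bar>x\<bar>)\<^sup>2) \<le> inverse (1 + x\<^sup>2)" by (intro le_imp_inverse_le)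
    then show "norm ((1 / (1 + \<bar>x\<bar>))\<^sup>2) \<le> norm (inverse (1 + x\<^sup>2))"
      by (simp add: power_divide inverse_eq_divide)
  qed
qed measurable

context cauchy_motion
begin

text \<open>The obstacle is that a single large jump of size \<open>r\<close>, which has probability of order \<open>t / r\<close>, can raise the
  killing rate to the order \<open>r\<^sup>2\<close>, and the Cauchy process has no second moment. Three bounds on the inner integral
  are combined, according to the supremum of the path up to time \<open>t\<close>: at most 1, where dominated
  convergence applies; at most \<open>R\<close>, where it is \<open>O(R\<^sup>2)\<close> on an event of probability \<open>O(t)\<close>; and the rest,
  where it is \<open>O(1 / t)\<close> on an event of probability \<open>O(t / R)\<close>. All errors vanish if \<open>R \<rightarrow> \<infinity>\<close> and
  \<open>t R\<^sup>2 \<rightarrow> 0\<close>; here \<open>R = n + 1\<close> and \<open>t\<close> is of order \<open>1 / R\<^sup>3\<close>. The factor 16 keeps \<open>t\<close> small enough for the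
  maximal inequality at every \<open>n\<close>.\<close>

lemma potential_limit:
  fixes \<psi> :: "real \<Rightarrow> complex"
  assumes [measurable]: "\<phi> \<in> borel_measurable borel" and \<phi>2: "in_L2 \<phi>"
    and \<psi>_cont: "\<And>x. isCont \<psi> x" and \<psi>_decay: "\<And>x. (1 + \<bar>x\<bar>) ^ 3 * cmod (\<psi> x) \<le> C"
  defines "\<tau> \<equiv> \<lambda>n. 1 / (16 * real (Suc n) ^ 3)"
  shows "(\<lambda>n. LINT \<omega>|M. LINT y|lborel. killing_rate (\<tau> n) (y - X (\<tau> n) \<omega>) \<omega> *\<^sub>R (\<phi> y * \<psi> (y - X (\<tau> n) \<omega>)))
    \<longlonglongrightarrow> (LINT y|lborel. y\<^sup>2 *\<^sub>R (\<phi> y * \<psi> y))"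
proof -
  interpret pair_sigma_finite M lborel ..
  have \<tau>_pos: "0 < \<tau> n" for n unfolding \<tau>_def by simp
  have \<tau>_lim: "\<tau> \<longlonglongrightarrow> 0" unfolding \<tau>_def by real_asymp
  have [measurable]: "X (\<tau> n) \<in> borel_measurable M" for n using \<tau>_pos[of n] by simp
  have "continuous_on UNIV \<psi>" using \<psi>_cont by (simp add: continuous_at_imp_continuous_on)
  then have [measurable]: "\<psi> \<in> borel_measurable borel" by (rule borel_measurable_continuous_onI)
  define h where "h = (\<lambda>x. (1 + \<bar>x\<bar>)\<^sup>2 * cmod (\<psi> x))"
  have [measurable]: "h \<in> borel_measurable borel" unfolding h_def by measurable
  have h0: "0 \<le> h x" for x unfolding h_def by simp
  have C0: "0 \<le> C" using \<psi>_decay[of 0] by (auto intro: order_trans[OF norm_ge_zero])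
  have h_le: "h x \<le> C * (1 / (1 + \<bar>x\<bar>))" for x
    using \<psi>_decay[of x] unfolding h_def by (simp add: field_simps power3_eq_cube power2_eq_square)
  have \<psi>_h: "cmod (\<psi> x) \<le> h x" for x
    unfolding h_def using mult_right_mono[of 1 "(1 + \<bar>x\<bar>)\<^sup>2" "cmod (\<psi> x)"] by simp
  have h2: "integrable lborel (\<lambda>x. (h x)\<^sup>2)"
  proof (rule Bochner_Integration.integrable_bound[OF integrable_mult_right[OF integrable_inverse_square, of "C\<^sup>2"]])
    show "AE x in lborel. norm ((h x)\<^sup>2) \<le> norm (C\<^sup>2 * (1 / (1 + \<bar>x\<bar>))\<^sup>2)"
    proof (rule AE_I2)
      fix x
      have "(h x)\<^sup>2 \<le> (C * (1 / (1 + \<bar>x\<bar>)))\<^sup>2" by (intro power_mono h_le h0)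
      then show "norm ((h x)\<^sup>2) \<le> norm (C\<^sup>2 * (1 / (1 + \<bar>x\<bar>))\<^sup>2)" by (simp add: power_mult_distrib power_divide)
    qed
  qed measurable
  have h2': "integrable lborel (\<lambda>y. (h (y - c))\<^sup>2)" and h2v: "(LINT y|lborel. (h (y - c))\<^sup>2) = (LINT y|lborel. (h y)\<^sup>2)" for c
    using lborel_integrable_real_affine[OF h2, of 1 "- c"] lborel_integral_real_affine[of 1 "\<lambda>y. (h y)\<^sup>2" "- c"] by auto
  \<comment> \<open>bounds the inner integral uniformly in the shift, by the Cauchy-Schwarz inequality\<close>
  define K where "K = sqrt (L2_sq \<phi>) * sqrt (LINT x|lborel. (h x)\<^sup>2)"
  have K0: "0 \<le> K" unfolding K_def by simp
  have K_int: "integrable lborel (\<lambda>y. cmod (\<phi> y) * h (y - c))" and K_bd: "(LINT y|lborel. cmod (\<phi> y) * h (y - c)) \<le> K" for c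
  proof -
    have 1: "integrable lborel (\<lambda>y. complex_of_real (cmod (\<phi> y)) * complex_of_real (h (y - c)))"
      by (rule cauchy_schwarz_L2) (use \<phi>2 h2' in auto)
    have 2: "cmod (LINT y|lborel. complex_of_real (cmod (\<phi> y)) * complex_of_real (h (y - c))) \<le> sqrt (LINT x|lborel. (cmod (complex_of_real (cmod (\<phi> x))))\<^sup>2) * sqrt (LINT x|lborel. (cmod (complex_of_real (h (x - c))))\<^sup>2)"
      by (rule cauchy_schwarz_L2) (use \<phi>2 h2' in auto)
    show "integrable lborel (\<lambda>y. cmod (\<phi> y) * h (y - c))"
      using 1 by (simp add: complex_of_real_integrable_eq flip: of_real_mult)
    show "(LINT y|lborel. cmod (\<phi> y) * h (y - c)) \<le> K"
      using 2 unfolding K_def of_real_mult[symmetric] integral_complex_of_real norm_of_real by (simp add: h2v)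
  qed
  let ?F = "\<lambda>n \<omega> y. killing_rate (\<tau> n) (y - X (\<tau> n) \<omega>) \<omega> *\<^sub>R (\<phi> y * \<psi> (y - X (\<tau> n) \<omega>))"
  define b where "b = (\<lambda>n \<omega>. LINT y|lborel. ?F n \<omega> y)"
  define B where "B = (LINT y|lborel. y\<^sup>2 *\<^sub>R (\<phi> y * \<psi> y))"
  have int: "integrable (M \<Otimes>\<^sub>M lborel) (\<lambda>(\<omega>, y). ?F n \<omega> y)" for n
  proof -
    have \<psi>2: "in_L2 \<psi>"
      by (rule Bochner_Integration.integrable_bound[OF h2]) (use \<psi>_h h0 in \<open>auto intro!: power_mono\<close>)
    have "integrable (M \<Otimes>\<^sub>M lborel) (\<lambda>(\<omega>, y). (\<lambda>(\<omega>, y). killing_rate (\<tau> n) (y - X (\<tau> n) \<omega>) \<omega>) (\<omega>, y) *\<^sub>R (\<phi> y * \<psi> (y + - X (\<tau> n) \<omega>)))"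
      by (rule integrable_shifted_product[where C = "1 / \<tau> n"]) (use \<phi>2 \<psi>2 killing_rate_abs[OF \<tau>_pos] in \<open>auto simp: split_beta'\<close>)
    then show ?thesis by simp
  qed
  have b_int: "integrable M (b n)" for n unfolding b_def using integrable_fst'[OF int[of n]] by simp
  have b_le: "cmod (b n \<omega>) \<le> c * K" if "\<And>x. killing_rate (\<tau> n) x \<omega> \<le> c * (1 + \<bar>x\<bar>)\<^sup>2" "0 \<le> c" for n \<omega> c
  proof -
    have "cmod (b n \<omega>) \<le> (LINT y|lborel. cmod (?F n \<omega> y))"
      unfolding b_def by (rule integral_norm_bound)
    also have "\<dots> \<le> (LINT y|lborel. c * (cmod (\<phi> y) * h (y - X (\<tau> n) \<omega>)))"
    proof (rule integral_mono')
      show "integrable lborel (\<lambda>y. c * (cmod (\<phi> y) * h (y - X (\<tau> n) \<omega>)))" by (intro integrable_mult_right K_int)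
      fix y
      show "0 \<le> c * (cmod (\<phi> y) * h (y - X (\<tau> n) \<omega>))" using that(2) h0 by simp
      have "killing_rate (\<tau> n) (y - X (\<tau> n) \<omega>) \<omega> * (cmod (\<phi> y) * cmod (\<psi> (y - X (\<tau> n) \<omega>))) \<le> c * (1 + \<bar>y - X (\<tau> n) \<omega>\<bar>)\<^sup>2 * (cmod (\<phi> y) * cmod (\<psi> (y - X (\<tau> n) \<omega>)))"
        by (intro mult_right_mono that) auto
      then show "cmod (?F n \<omega> y) \<le> c * (cmod (\<phi> y) * h (y - X (\<tau> n) \<omega>))"
        unfolding h_def using killing_rate_nonneg[OF \<tau>_pos] by (simp add: norm_mult mult_ac)
    qed
    also have "\<dots> \<le> c * K" using K_bd that(2) by (simp add: mult_left_mono)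
    finally show ?thesis .
  qed
  have b_le_path: "cmod (b n \<omega>) \<le> R\<^sup>2 * K"
    if "\<omega> \<in> space M" "1 \<le> R" "\<And>s. 0 \<le> s \<Longrightarrow> s \<le> \<tau> n \<Longrightarrow> \<bar>X s \<omega>\<bar> \<le> R" for n \<omega> R
  proof (rule b_le)
    fix x
    have "killing_rate (\<tau> n) x \<omega> \<le> (\<bar>x\<bar> + R)\<^sup>2" by (rule killing_rate_le[OF that(1) \<tau>_pos that(3)])
    also have "\<dots> \<le> (R * (1 + \<bar>x\<bar>))\<^sup>2"
      using that(2) mult_right_mono[of 1 R "\<bar>x\<bar>"] by (intro power_mono) (auto simp: algebra_simps)
    finally show "killing_rate (\<tau> n) x \<omega> \<le> R\<^sup>2 * (1 + \<bar>x\<bar>)\<^sup>2" by (simp add: power_mult_distrib)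
  qed simp
  have b_le_always: "cmod (b n \<omega>) \<le> 1 / \<tau> n * K" for n \<omega>
  proof (rule b_le)
    fix x
    have "1 / \<tau> n * 1 \<le> 1 / \<tau> n * (1 + \<bar>x\<bar>)\<^sup>2" using \<tau>_pos[of n] by (intro mult_left_mono) auto
    then show "killing_rate (\<tau> n) x \<omega> \<le> 1 / \<tau> n * (1 + \<bar>x\<bar>)\<^sup>2"
      using killing_rate_le_inverse[OF \<tau>_pos, of n x \<omega>] by linarith
  qed (use \<tau>_pos[of n] in simp)
  have b_lim: "(\<lambda>n. b n \<omega>) \<longlonglongrightarrow> B" if \<omega>: "\<omega> \<in> space M" "X 0 \<omega> = 0" for \<omega>
  proof -
    from path_small[OF \<omega> _ \<tau>_lim, of 1] obtain N where N: "\<And>n s. N \<le> n \<Longrightarrow> 0 \<le> s \<Longrightarrow> s \<le> \<tau> n \<Longrightarrow> \<bar>X s \<omega>\<bar> \<le> 1"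
      unfolding eventually_sequentially by auto
    have "(\<lambda>n. X (\<tau> n) \<omega>) \<longlonglongrightarrow> 0"
      using X_limit_right[OF \<omega>(1) _ \<tau>_lim \<tau>_pos] \<omega>(2) by simp
    then have Xl: "(\<lambda>n. y - X (\<tau> n) \<omega>) \<longlonglongrightarrow> y" for y by (auto intro!: tendsto_eq_intros)
    have "(\<lambda>n. b (n + N) \<omega>) \<longlonglongrightarrow> B"
      unfolding b_def B_def
    proof (rule integral_dominated_convergence[where w = "\<lambda>y. 2 * C * (cmod (\<phi> y) * (1 / (1 + \<bar>y\<bar>)))"])
      have "integrable lborel (\<lambda>y. complex_of_real (cmod (\<phi> y)) * complex_of_real (1 / (1 + \<bar>y\<bar>)))"
        by (rule cauchy_schwarz_L2) (use \<phi>2 integrable_inverse_square in \<open>auto simp: norm_divide simp del: of_real_divide\<close>)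
      then have "integrable lborel (\<lambda>y. cmod (\<phi> y) * (1 / (1 + \<bar>y\<bar>)))"
        by (simp only: of_real_mult[symmetric] complex_of_real_integrable_eq)
      then show "integrable lborel (\<lambda>y. 2 * C * (cmod (\<phi> y) * (1 / (1 + \<bar>y\<bar>))))" by (rule integrable_mult_right)
      show "AE y in lborel. (\<lambda>n. ?F (n + N) \<omega> y) \<longlonglongrightarrow> y\<^sup>2 *\<^sub>R (\<phi> y * \<psi> y)"
      proof (rule AE_I2)
        fix y
        have "(\<lambda>n. \<psi> (y - X (\<tau> n) \<omega>)) \<longlonglongrightarrow> \<psi> y" by (rule isCont_tendsto_compose[OF \<psi>_cont Xl])
        then have "(\<lambda>n. ?F n \<omega> y) \<longlonglongrightarrow> y\<^sup>2 *\<^sub>R (\<phi> y * \<psi> y)"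
          by (intro tendsto_intros killing_rate_limit \<omega> \<tau>_lim \<tau>_pos)
        then show "(\<lambda>n. ?F (n + N) \<omega> y) \<longlonglongrightarrow> y\<^sup>2 *\<^sub>R (\<phi> y * \<psi> y)"
          by (rule LIMSEQ_ignore_initial_segment)
      qed
      show "AE y in lborel. norm (?F (n + N) \<omega> y) \<le> 2 * C * (cmod (\<phi> y) * (1 / (1 + \<bar>y\<bar>)))" for n
      proof (rule AE_I2)
        fix y
        define x where "x = y - X (\<tau> (n + N)) \<omega>"
        have X1: "\<bar>X (\<tau> (n + N)) \<omega>\<bar> \<le> 1" using N[of "n + N" "\<tau> (n + N)"] \<tau>_pos[of "n + N"] by simp
        have "killing_rate (\<tau> (n + N)) x \<omega> \<le> (\<bar>x\<bar> + 1)\<^sup>2"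
          by (rule killing_rate_le[OF \<omega>(1) \<tau>_pos]) (use N[of "n + N"] in auto)
        then have k: "killing_rate (\<tau> (n + N)) x \<omega> \<le> (1 + \<bar>x\<bar>)\<^sup>2" by (simp add: add.commute)
        have "norm (killing_rate (\<tau> (n + N)) x \<omega> *\<^sub>R (\<phi> y * \<psi> x)) = killing_rate (\<tau> (n + N)) x \<omega> * (cmod (\<phi> y) * cmod (\<psi> x))"
          using killing_rate_nonneg[OF \<tau>_pos] by (simp add: norm_mult)
        also have "\<dots> \<le> (1 + \<bar>x\<bar>)\<^sup>2 * (cmod (\<phi> y) * cmod (\<psi> x))" by (intro mult_right_mono k) simp
        also have "\<dots> = cmod (\<phi> y) * h x" unfolding h_def by simp
        also have "\<dots> \<le> cmod (\<phi> y) * (C * (2 * (1 / (1 + \<bar>y\<bar>))))"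
        proof (intro mult_left_mono order_trans[OF h_le] C0)
          have "1 + \<bar>y\<bar> \<le> 2 * (1 + \<bar>x\<bar>)" 
            using abs_triangle_ineq[of x "X (\<tau> (n + N)) \<omega>"] X1 abs_ge_zero[of x]
            by (simp only: x_def diff_add_cancel) argo
          then show "1 / (1 + \<bar>x\<bar>) \<le> 2 * (1 / (1 + \<bar>y\<bar>))" by (simp add: field_simps)
        qed simp
        finally show "norm (?F (n + N) \<omega> y) \<le> 2 * C * (cmod (\<phi> y) * (1 / (1 + \<bar>y\<bar>)))"
          unfolding x_def by (simp add: mult_ac)
      qed
    next
      have [measurable]: "(\<lambda>y. \<omega>) \<in> measurable lborel M" using \<omega> by simp
      show "(\<lambda>y. ?F (n + N) \<omega> y) \<in> borel_measurable lborel" for n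
        by measurable
    qed measurable
    then show ?thesis by (rule LIMSEQ_offset)
  qed
  \<comment> \<open>paths confined to \<open>[-1, 1]\<close>, to \<open>[-n-1, n+1]\<close>, and the rest\<close>
  have "\<exists>E. E \<in> events \<and> prob E \<le> 16 * \<tau> n \<and> (\<forall>\<omega> s. \<omega> \<in> space M - E \<longrightarrow> 0 \<le> s \<longrightarrow> s \<le> \<tau> n \<longrightarrow> \<bar>X s \<omega>\<bar> \<le> 1)" for n
  proof -
    have "8 * \<tau> n \<le> 1 / 2" unfolding \<tau>_def by (simp add: field_simps)
    from maximal_inequality[OF \<tau>_pos _ this] obtain E where "E \<in> events" "prob E \<le> 8 * \<tau> n / (1/2)"
      "\<And>\<omega> s. \<omega> \<in> space M - E \<Longrightarrow> 0 \<le> s \<Longrightarrow> s \<le> \<tau> n \<Longrightarrow> \<bar>X s \<omega>\<bar> \<le> 2 * (1/2)" by auto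
    then show ?thesis by (intro exI[of _ E]) auto
  qed
  then obtain E1 where E1 [measurable]: "\<And>n. E1 n \<in> events" and E1_prob: "\<And>n. prob (E1 n) \<le> 16 * \<tau> n"
    and E1_path: "\<And>n \<omega> s. \<omega> \<in> space M - E1 n \<Longrightarrow> 0 \<le> s \<Longrightarrow> s \<le> \<tau> n \<Longrightarrow> \<bar>X s \<omega>\<bar> \<le> 1" by metis
  have "\<exists>E. E \<in> events \<and> prob E \<le> 16 * \<tau> n / Suc n \<and> (\<forall>\<omega> s. \<omega> \<in> space M - E \<longrightarrow> 0 \<le> s \<longrightarrow> s \<le> \<tau> n \<longrightarrow> \<bar>X s \<omega>\<bar> \<le> real (Suc n))" for n
  proof -
    have "8 * \<tau> n \<le> 1 / 2" unfolding \<tau>_def by (simp add: field_simps)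
    then have "8 * \<tau> n \<le> real (Suc n) / 2" by simp
    from maximal_inequality[OF \<tau>_pos _ this] obtain E where E: "E \<in> events" "prob E \<le> 8 * \<tau> n / (Suc n / 2)"
      "\<And>\<omega> s. \<omega> \<in> space M - E \<Longrightarrow> 0 \<le> s \<Longrightarrow> s \<le> \<tau> n \<Longrightarrow> \<bar>X s \<omega>\<bar> \<le> 2 * (Suc n / 2)" by auto
    have "\<bar>X s \<omega>\<bar> \<le> real (Suc n)" if "\<omega> \<in> space M - E" "0 \<le> s" "s \<le> \<tau> n" for \<omega> s
      using E(3)[OF that] by simp
    moreover have "prob E \<le> 16 * \<tau> n / Suc n" using E(2) by simp
    ultimately show ?thesis using E(1) by blast
  qed
  then obtain E2 where E2 [measurable]: "\<And>n. E2 n \<in> events" and E2_prob: "\<And>n. prob (E2 n) \<le> 16 * \<tau> n / Suc n"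
    and E2_path: "\<And>n \<omega> s. \<omega> \<in> space M - E2 n \<Longrightarrow> 0 \<le> s \<Longrightarrow> s \<le> \<tau> n \<Longrightarrow> \<bar>X s \<omega>\<bar> \<le> real (Suc n)" by metis
  define e where "e = (\<lambda>n \<omega>. indicator (space M - E1 n) \<omega> * cmod (b n \<omega> - B))"
  have [measurable]: "b n \<in> borel_measurable M" for n using b_int[of n] by auto
  have e_le: "e n \<omega> \<le> K + cmod B" if "\<omega> \<in> space M" for n \<omega>
  proof (cases "\<omega> \<in> E1 n")
    case False
    have "cmod (b n \<omega>) \<le> 1\<^sup>2 * K" by (rule b_le_path) (use False that E1_path in auto)
    then have "cmod (b n \<omega> - B) \<le> K + cmod B" using norm_triangle_ineq4[of "b n \<omega>" B] by simp
    then show ?thesis unfolding e_def using False that by (simp add: indicator_def)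
  qed (use K0 in \<open>simp add: e_def\<close>)
  have e0: "0 \<le> e n \<omega>" for n \<omega> unfolding e_def by simp
  have e_int: "integrable M (e n)" for n
    by (rule integrable_const_bound[where B = "K + cmod B"]) (use e_le e0 in \<open>auto simp: e_def\<close>)
  have e_lim: "(\<lambda>n. LINT \<omega>|M. e n \<omega>) \<longlonglongrightarrow> (LINT \<omega>|M. 0)"
  proof (rule integral_dominated_convergence[where w = "\<lambda>_. K + cmod B"])
    show "AE \<omega> in M. (\<lambda>n. e n \<omega>) \<longlonglongrightarrow> 0"
      using X_start
    proof (rule AE_mp, intro AE_I2 impI)
      fix \<omega> assume \<omega>: "\<omega> \<in> space M" "X 0 \<omega> = 0"
      have "(\<lambda>n. cmod (b n \<omega> - B)) \<longlonglongrightarrow> 0" using b_lim[OF \<omega>] by (simp add: LIM_zero tendsto_norm_zero)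
      then show "(\<lambda>n. e n \<omega>) \<longlonglongrightarrow> 0"
        by (rule Lim_null_comparison[rotated]) (auto simp: e_def indicator_def)
    qed
    show "AE \<omega> in M. norm (e n \<omega>) \<le> K + cmod B" for n using e_le e0 by auto
    show "e n \<in> borel_measurable M" for n using e_int[of n] by auto
  qed auto
  have pw: "cmod (b n \<omega> - B) \<le> e n \<omega> + ((real (Suc n))\<^sup>2 * K + cmod B) * indicator (E1 n) \<omega> + (1 / \<tau> n * K) * indicator (E2 n) \<omega>"
    if \<omega>: "\<omega> \<in> space M" for n \<omega>
  proof -
    consider "\<omega> \<notin> E1 n" | "\<omega> \<in> E1 n" "\<omega> \<notin> E2 n" | "\<omega> \<in> E1 n" "\<omega> \<in> E2 n" by blast
    then show ?thesis
    proof cases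
      case 1
      then show ?thesis using \<omega> K0 \<tau>_pos[of n] by (simp add: e_def)
    next
      case 2
      have "cmod (b n \<omega>) \<le> (real (Suc n))\<^sup>2 * K" by (rule b_le_path) (use 2 \<omega> E2_path in auto)
      then show ?thesis using 2 norm_triangle_ineq4[of "b n \<omega>" B] by (simp add: e_def)
    next
      case 3
      have "0 \<le> (real (Suc n))\<^sup>2 * K" using K0 by simp
      then show ?thesis using 3 b_le_always[of n \<omega>] norm_triangle_ineq4[of "b n \<omega>" B] by (simp add: e_def)
    qed
  qed
  have diff_le: "cmod ((LINT \<omega>|M. b n \<omega>) - B) \<le> (LINT \<omega>|M. e n \<omega>) + ((real (Suc n))\<^sup>2 * K + cmod B) * (16 * \<tau> n) + 16 * K / Suc n" for n
  proof -
    have "(LINT \<omega>|M. b n \<omega>) - B = (LINT \<omega>|M. b n \<omega> - B)" using b_int[of n] by (simp add: prob_space)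
    then have "cmod ((LINT \<omega>|M. b n \<omega>) - B) \<le> (LINT \<omega>|M. cmod (b n \<omega> - B))" by simp
    also have "\<dots> \<le> (LINT \<omega>|M. e n \<omega> + ((real (Suc n))\<^sup>2 * K + cmod B) * indicator (E1 n) \<omega> + (1 / \<tau> n * K) * indicator (E2 n) \<omega>)"
      by (rule integral_mono) (use b_int[of n] e_int[of n] pw in \<open>auto intro!: Bochner_Integration.integrable_add integrable_mult_right integrable_real_indicator simp: less_top[symmetric] simp del: of_nat_Suc\<close>)
    also have "\<dots> = (LINT \<omega>|M. e n \<omega>) + ((real (Suc n))\<^sup>2 * K + cmod B) * prob (E1 n) + (1 / \<tau> n * K) * prob (E2 n)"
    proof -
      have "integrable M (\<lambda>\<omega>. c * indicator (E1 n) \<omega>)" "integrable M (\<lambda>\<omega>. c * indicator (E2 n) \<omega>)" for c :: real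
        by (auto intro!: integrable_mult_right integrable_real_indicator simp: less_top[symmetric])
      then show ?thesis using e_int[of n] by (simp del: of_nat_Suc)
    qed
    also have "\<dots> \<le> (LINT \<omega>|M. e n \<omega>) + ((real (Suc n))\<^sup>2 * K + cmod B) * (16 * \<tau> n) + (1 / \<tau> n * K) * (16 * \<tau> n / Suc n)"
      using K0 \<tau>_pos[of n] by (intro add_mono mult_left_mono E1_prob E2_prob) auto
    also have "(1 / \<tau> n * K) * (16 * \<tau> n / Suc n) = 16 * K / Suc n" using \<tau>_pos[of n] by simp
    finally show ?thesis .
  qed
  have l1: "(\<lambda>n. ((real (Suc n))\<^sup>2 * K + cmod B) * (16 * \<tau> n) + 16 * K / Suc n) \<longlonglongrightarrow> 0"
    unfolding \<tau>_def by real_asymp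
  have "(\<lambda>n. (LINT \<omega>|M. e n \<omega>) + ((real (Suc n))\<^sup>2 * K + cmod B) * (16 * \<tau> n) + 16 * K / Suc n) \<longlonglongrightarrow> 0"
    using tendsto_add[OF e_lim l1] by (simp add: add.assoc)
  then have "(\<lambda>n. (LINT \<omega>|M. b n \<omega>) - B) \<longlonglongrightarrow> 0"
    by (rule Lim_null_comparison[rotated]) (use diff_le in auto)
  then show ?thesis unfolding b_def B_def by (simp add: LIM_zero_iff)
qed

lemma feynman_kac_action: "feynman_kac M X t f x = (LINT \<omega>|M. exp (- action t x \<omega>) *\<^sub>R f (x + X t \<omega>))"
  unfolding feynman_kac_def action_def ..

lemma exp_action: "0 < t \<Longrightarrow> exp (- action t x \<omega>) = 1 - t * killing_rate t x \<omega>"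
  unfolding killing_rate_def by simp

text \<open>Translating by the endpoint of the path moves all randomness onto the test function; the weight then
  splits into the free part and the killing part.\<close>

lemma feynman_kac_pairing:
  fixes \<phi> \<psi> :: "real \<Rightarrow> complex"
  assumes [measurable]: "\<phi> \<in> borel_measurable borel" "\<psi> \<in> borel_measurable borel"
    and \<phi>2: "in_L2 \<phi>" and \<psi>2: "in_L2 \<psi>" and t: "0 < t"
  shows "integrable lborel (\<lambda>x. feynman_kac M X t \<phi> x * \<psi> x)"
    and "(LINT x|lborel. feynman_kac M X t \<phi> x * \<psi> x) = (LINT \<omega>|M. LINT y|lborel. \<phi> y * \<psi> (y - X t \<omega>))
      - of_real t * (LINT \<omega>|M. LINT y|lborel. killing_rate t (y - X t \<omega>) \<omega> *\<^sub>R (\<phi> y * \<psi> (y - X t \<omega>)))"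
proof -
  interpret pair_sigma_finite M lborel ..
  have [measurable]: "X t \<in> borel_measurable M" using t by simp
  have int: "integrable (M \<Otimes>\<^sub>M lborel) (\<lambda>(\<omega>, x). (\<lambda>p. exp (- action t (snd p) (fst p))) (\<omega>, x) *\<^sub>R (\<psi> x * \<phi> (x + X t \<omega>)))"
    by (rule integrable_shifted_product[where C = 1]) (use \<phi>2 \<psi>2 action_nonneg in auto)
  then have int: "integrable (M \<Otimes>\<^sub>M lborel) (\<lambda>(\<omega>, x). exp (- action t x \<omega>) *\<^sub>R (\<psi> x * \<phi> (x + X t \<omega>)))" by simp
  have eq: "(LINT \<omega>|M. exp (- action t x \<omega>) *\<^sub>R (\<psi> x * \<phi> (x + X t \<omega>))) = feynman_kac M X t \<phi> x * \<psi> x" for x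
  proof -
    have "feynman_kac M X t \<phi> x * \<psi> x = (LINT \<omega>|M. (exp (- action t x \<omega>) *\<^sub>R \<phi> (x + X t \<omega>)) * \<psi> x)"
      unfolding feynman_kac_action by (rule integral_mult_left_zero[symmetric])
    then show ?thesis by (simp add: mult_ac)
  qed
  show "integrable lborel (\<lambda>x. feynman_kac M X t \<phi> x * \<psi> x)"
    using integrable_snd[OF int] unfolding eq .
  have 1: "integrable (M \<Otimes>\<^sub>M lborel) (\<lambda>(\<omega>, y). (\<lambda>_. 1) (\<omega>, y) *\<^sub>R (\<phi> y * \<psi> (y + - X t \<omega>)))"
    by (rule integrable_shifted_product[where C = 1]) (use \<phi>2 \<psi>2 in auto)
  have 2: "integrable (M \<Otimes>\<^sub>M lborel) (\<lambda>(\<omega>, y). (\<lambda>p. killing_rate t (snd p - X t (fst p)) (fst p)) (\<omega>, y) *\<^sub>R (\<phi> y * \<psi> (y + - X t \<omega>)))"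
    by (rule integrable_shifted_product[where C = "1 / t"]) (use \<phi>2 \<psi>2 killing_rate_abs[OF t] in auto)
  define G where "G = (\<lambda>p. \<phi> (snd p) * \<psi> (snd p - X t (fst p)))"
  define F where "F = (\<lambda>p. killing_rate t (snd p - X t (fst p)) (fst p) *\<^sub>R (\<phi> (snd p) * \<psi> (snd p - X t (fst p))))"
  have G: "integrable (M \<Otimes>\<^sub>M lborel) G" using 1 unfolding G_def by (simp add: split_beta')
  have F: "integrable (M \<Otimes>\<^sub>M lborel) F" using 2 unfolding F_def by (simp add: split_beta')
  have tF: "integrable (M \<Otimes>\<^sub>M lborel) (\<lambda>p. of_real t * F p)" using F by (rule integrable_mult_right)
  have "(LINT x|lborel. feynman_kac M X t \<phi> x * \<psi> x) = (LINT \<omega>|M. LINT x|lborel. exp (- action t x \<omega>) *\<^sub>R (\<psi> x * \<phi> (x + X t \<omega>)))"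
    unfolding eq[symmetric] using Fubini_integral[OF int] by simp
  also have "\<dots> = (LINT \<omega>|M. LINT y|lborel. exp (- action t (y - X t \<omega>) \<omega>) *\<^sub>R (\<psi> (y - X t \<omega>) * \<phi> y))"
  proof (rule Bochner_Integration.integral_cong[OF refl])
    fix \<omega>
    show "(LINT x|lborel. exp (- action t x \<omega>) *\<^sub>R (\<psi> x * \<phi> (x + X t \<omega>))) = (LINT y|lborel. exp (- action t (y - X t \<omega>) \<omega>) *\<^sub>R (\<psi> (y - X t \<omega>) * \<phi> y))"
      using lborel_integral_real_affine[of 1 "\<lambda>x. exp (- action t x \<omega>) *\<^sub>R (\<psi> x * \<phi> (x + X t \<omega>))" "- X t \<omega>"] by simp
  qed
  also have "\<dots> = (LINT \<omega>|M. LINT y|lborel. G (\<omega>, y) - of_real t * F (\<omega>, y))"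
    unfolding exp_action[OF t] G_def F_def
    by (intro Bochner_Integration.integral_cong refl) (simp add: scaleR_conv_of_real algebra_simps)
  also have "\<dots> = (LINT p|(M \<Otimes>\<^sub>M lborel). G p - of_real t * F p)"
    by (rule integral_fst'[OF Bochner_Integration.integrable_diff[OF G tF]])
  also have "\<dots> = (LINT p|(M \<Otimes>\<^sub>M lborel). G p) - of_real t * (LINT p|(M \<Otimes>\<^sub>M lborel). F p)"
    by (subst Bochner_Integration.integral_diff[OF G tF]) simp
  also have "\<dots> = (LINT \<omega>|M. LINT y|lborel. G (\<omega>, y)) - of_real t * (LINT \<omega>|M. LINT y|lborel. F (\<omega>, y))"
    by (simp only: integral_fst'[OF G] integral_fst'[OF F])
  finally show "(LINT x|lborel. feynman_kac M X t \<phi> x * \<psi> x) = (LINT \<omega>|M. LINT y|lborel. \<phi> y * \<psi> (y - X t \<omega>))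
      - of_real t * (LINT \<omega>|M. LINT y|lborel. killing_rate t (y - X t \<omega>) \<omega> *\<^sub>R (\<phi> y * \<psi> (y - X t \<omega>)))"
    unfolding G_def F_def by simp
qed

lemma feynman_kac_measurable [measurable]:
  assumes [measurable]: "\<phi> \<in> borel_measurable borel" and t: "0 \<le> t"
  shows "feynman_kac M X t \<phi> \<in> borel_measurable borel"
proof -
  have [measurable]: "X t \<in> borel_measurable M" using t by simp
  have "(\<lambda>(x, \<omega>). exp (- action t x \<omega>) *\<^sub>R \<phi> (x + X t \<omega>)) \<in> borel_measurable (borel \<Otimes>\<^sub>M M)"
    unfolding split_beta' by measurable
  from borel_measurable_lebesgue_integral[OF this] show ?thesis
    unfolding feynman_kac_action by simp
qed

text \<open>The operator is defined by an \<open>L\<^sup>2\<close> limit expressed through extended nonnegative integrals, which may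
  be infinite before the limit is reached.\<close>

lemma L2_limit_pairing:
  fixes D :: "nat \<Rightarrow> real \<Rightarrow> complex"
  assumes [measurable]: "\<And>n. D n \<in> borel_measurable lborel" "\<psi> \<in> borel_measurable lborel"
    and \<psi>2: "in_L2 \<psi>"
    and lim: "(\<lambda>n. \<integral>\<^sup>+x. ennreal ((cmod (D n x))\<^sup>2) \<partial>lborel) \<longlonglongrightarrow> 0"
  shows "(\<lambda>n. LINT x|lborel. D n x * \<psi> x) \<longlonglongrightarrow> 0"
proof -
  define d where "d = (\<lambda>n. enn2real (\<integral>\<^sup>+x. ennreal ((cmod (D n x))\<^sup>2) \<partial>lborel))"
  have "d \<longlonglongrightarrow> 0" unfolding d_def using tendsto_enn2real[where l = 0, OF _ order_refl] lim by simp
  then have l: "(\<lambda>n. sqrt (d n) * sqrt (L2_sq \<psi>)) \<longlonglongrightarrow> 0"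
    by (auto intro!: tendsto_eq_intros)
  have "\<forall>\<^sub>F n in sequentially. (\<integral>\<^sup>+x. ennreal ((cmod (D n x))\<^sup>2) \<partial>lborel) < 1"
    using order_tendstoD(2)[OF lim, of 1] by simp
  then have "\<forall>\<^sub>F n in sequentially. cmod (LINT x|lborel. D n x * \<psi> x) \<le> sqrt (d n) * sqrt (L2_sq \<psi>)"
  proof eventually_elim
    case (elim n)
    have i: "in_L2 (D n)"
      by (rule integrableI_bounded) (use elim in \<open>auto intro: less_trans[OF _ ennreal_one_less_top]\<close>)
    have "d n = (L2_sq (D n))"
      unfolding d_def using nn_integral_eq_integral[OF i] by simp
    then show ?case using cauchy_schwarz_L2(2)[OF _ _ i \<psi>2] by simp
  qed
  from Lim_null_comparison[OF this l] show ?thesis .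
qed

text \<open>The eigenvalue equation tested against a function with nice Fourier transform \<open>v\<close>: on the Fourier
  side \<open>\<bar>p\<bar>\<close> becomes multiplication by \<open>\<bar>k\<bar>\<close> and \<open>x\<^sup>2\<close> becomes \<open>-d\<^sup>2/dk\<^sup>2\<close>.\<close>

lemma weak_eigen_equation:
  assumes H: "cauchy_oscillator M X \<phi> (\<lambda>x. of_real \<mu> * \<phi> x)"
    and v: "\<And>k. (v has_vector_derivative v' k) (at k)" and v': "\<And>k. (v' has_vector_derivative v'' k) (at k)"
    and l: "loc_lipschitz v''" and s: "compact_supp v"
  shows "(LINT x|lborel. \<phi> x * fourier (\<lambda>k. of_real (\<bar>k\<bar> - \<mu>) * v k - v'' k) x) = 0"
proof -
  have [measurable]: "\<phi> \<in> borel_measurable borel" and \<phi>2: "in_L2 \<phi>"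
    using H unfolding cauchy_oscillator_def semigroup_operator_def square_integrable_def by auto
  define \<tau> where "\<tau> = (\<lambda>n. 1 / (16 * real (Suc n) ^ 3))"
  have \<tau>_pos: "0 < \<tau> n" for n unfolding \<tau>_def by simp
  have \<tau>_lim: "\<tau> \<longlonglongrightarrow> 0" unfolding \<tau>_def by real_asymp
  have c'': "continuous_on UNIV v''" by (rule loc_lipschitz_imp_continuous[OF l])
  have c': "continuous_on UNIV v'"
    using v' by (meson continuous_at_imp_continuous_on has_vector_derivative_continuous)
  have c: "continuous_on UNIV v"
    using v by (meson continuous_at_imp_continuous_on has_vector_derivative_continuous)
  note s' = fourier_deriv(2)[OF v c' s]
  note s'' = fourier_deriv(2)[OF v' c'' s']
  note iv = integrable_compact_supp_complex[OF c s]
  note iv'' = integrable_compact_supp_complex[OF c'' s'']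
  have [measurable]: "v \<in> borel_measurable borel" using c by (rule borel_measurable_continuous_onI)
  define \<psi> where "\<psi> = fourier v"
  have [measurable]: "\<psi> \<in> borel_measurable borel" unfolding \<psi>_def by measurable
  have \<psi>2: "in_L2 \<psi>" unfolding \<psi>_def by (rule plancherel_bound[OF iv])
  obtain C where C: "\<And>x. (1 + \<bar>x\<bar>) ^ 3 * cmod (\<psi> x) \<le> C"
    using fourier_C2_decay(2)[OF v v' l s] unfolding \<psi>_def by blast
  define D where "D = (\<lambda>n x. (\<phi> x - feynman_kac M X (\<tau> n) \<phi> x) / of_real (\<tau> n) - of_real \<mu> * \<phi> x)"
  have D_lim: "(\<lambda>n. \<integral>\<^sup>+x. ennreal ((cmod (D n x))\<^sup>2) \<partial>lborel) \<longlonglongrightarrow> 0"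
  proof -
    have "filterlim \<tau> (at_right 0) sequentially"
      unfolding filterlim_at using \<tau>_lim \<tau>_pos by (auto simp: less_imp_neq[OF \<tau>_pos, symmetric])
    with H show ?thesis
      unfolding cauchy_oscillator_def semigroup_operator_def D_def by (auto intro: filterlim_compose)
  qed
  have D_meas: "D n \<in> borel_measurable lborel" for n
    unfolding D_def using feynman_kac_measurable[of \<phi> "\<tau> n"] \<tau>_pos[of n] by simp
  have \<phi>\<psi>: "integrable lborel (\<lambda>x. \<phi> x * \<psi> x)" by (intro cauchy_schwarz_L2 \<phi>2 \<psi>2) measurable
  define I where "I = (\<lambda>n. LINT \<omega>|M. LINT y|lborel. killing_rate (\<tau> n) (y - X (\<tau> n) \<omega>) \<omega> *\<^sub>R (\<phi> y * \<psi> (y - X (\<tau> n) \<omega>)))"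
  define J where "J = (\<lambda>n. LINT y|lborel. \<phi> y * fourier (\<lambda>k. of_real ((1 - exp (- \<tau> n * \<bar>k\<bar>)) / \<tau> n) * v k) y)"
  have D_eq: "(LINT x|lborel. D n x * \<psi> x) = J n + I n - of_real \<mu> * (LINT x|lborel. \<phi> x * \<psi> x)" for n
  proof -
    define e where "e = (\<lambda>k. of_real (exp (- \<tau> n * \<bar>k\<bar>)) * v k)"
    have ce: "continuous_on UNIV e" unfolding e_def by (intro continuous_intros c)
    have se: "compact_supp e" unfolding e_def by (rule compact_supp_mult[OF s])
    note ie = integrable_compact_supp_complex[OF ce se]
    note fk = feynman_kac_pairing[OF _ _ \<phi>2 \<psi>2 \<tau>_pos[of n]]
    have t: "complex_of_real (\<tau> n) \<noteq> 0" using \<tau>_pos[of n] by simp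
    have "(LINT x|lborel. D n x * \<psi> x) = (LINT x|lborel. (\<phi> x * \<psi> x - feynman_kac M X (\<tau> n) \<phi> x * \<psi> x) / of_real (\<tau> n) - of_real \<mu> * (\<phi> x * \<psi> x))"
      unfolding D_def by (intro Bochner_Integration.integral_cong) (auto simp: algebra_simps diff_divide_distrib)
    also have "\<dots> = ((LINT x|lborel. \<phi> x * \<psi> x) - (LINT x|lborel. feynman_kac M X (\<tau> n) \<phi> x * \<psi> x)) / of_real (\<tau> n) - of_real \<mu> * (LINT x|lborel. \<phi> x * \<psi> x)"
      using \<phi>\<psi> fk(1) by simp
    also have "(LINT x|lborel. feynman_kac M X (\<tau> n) \<phi> x * \<psi> x) = (LINT y|lborel. \<phi> y * fourier e y) - of_real (\<tau> n) * I n"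
      using fk(2) free_pairing[OF _ \<phi>2 iv, of "\<tau> n"] \<tau>_pos[of n] unfolding I_def e_def \<psi>_def by simp
    also have "((LINT x|lborel. \<phi> x * \<psi> x) - ((LINT y|lborel. \<phi> y * fourier e y) - of_real (\<tau> n) * I n)) / of_real (\<tau> n)
      = ((LINT x|lborel. \<phi> x * \<psi> x) - (LINT y|lborel. \<phi> y * fourier e y)) / of_real (\<tau> n) + I n"
      using t by (simp add: field_simps)
    also have "((LINT x|lborel. \<phi> x * \<psi> x) - (LINT y|lborel. \<phi> y * fourier e y)) / of_real (\<tau> n) = (LINT y|lborel. (\<phi> y * \<psi> y - \<phi> y * fourier e y) / of_real (\<tau> n))"
      using \<phi>\<psi> pairing_fourier_bound(1)[OF _ \<phi>2 ie] by simp
    also have "\<dots> = J n"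
      unfolding J_def
    proof (rule Bochner_Integration.integral_cong[OF refl])
      fix y
      have "fourier v y - fourier e y = fourier (\<lambda>k. v k - e k) y"
        using fourier_diff[OF iv(1) ie(1), of 1 y] by simp
      also have "\<dots> / of_real (\<tau> n) = fourier (\<lambda>k. of_real ((1 - exp (- \<tau> n * \<bar>k\<bar>)) / \<tau> n) * v k) y"
        unfolding fourier_def integral_divide_zero[symmetric] e_def
        by (intro Bochner_Integration.integral_cong) (auto simp: algebra_simps diff_divide_distrib)
      finally show "(\<phi> y * \<psi> y - \<phi> y * fourier e y) / of_real (\<tau> n) = \<phi> y * fourier (\<lambda>k. of_real ((1 - exp (- \<tau> n * \<bar>k\<bar>)) / \<tau> n) * v k) y"
        unfolding \<psi>_def by (simp add: right_diff_distrib[symmetric] times_divide_eq_right[symmetric] del: times_divide_eq_right)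
    qed
    finally show ?thesis .
  qed
  have l1: "(\<lambda>n. LINT x|lborel. D n x * \<psi> x) \<longlonglongrightarrow> 0"
    by (rule L2_limit_pairing[OF D_meas _ \<psi>2 D_lim]) measurable
  have l2: "J \<longlonglongrightarrow> (LINT y|lborel. \<phi> y * fourier (\<lambda>k. of_real \<bar>k\<bar> * v k) y)"
    unfolding J_def by (rule free_generator_limit[OF _ \<phi>2 c s \<tau>_lim \<tau>_pos]) measurable
  have l3: "I \<longlonglongrightarrow> (LINT y|lborel. y\<^sup>2 *\<^sub>R (\<phi> y * \<psi> y))"
    unfolding I_def \<tau>_def by (rule potential_limit[OF _ \<phi>2 _ C]) (auto simp: \<psi>_def intro!: continuous_fourier iv)
  have "(\<lambda>n. LINT x|lborel. D n x * \<psi> x) \<longlonglongrightarrow> (LINT y|lborel. \<phi> y * fourier (\<lambda>k. of_real \<bar>k\<bar> * v k) y) + (LINT y|lborel. y\<^sup>2 *\<^sub>R (\<phi> y * \<psi> y)) - of_real \<mu> * (LINT x|lborel. \<phi> x * \<psi> x)"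
    unfolding D_eq by (intro tendsto_intros l2 l3)
  from LIMSEQ_unique[OF this l1] have *: "(LINT y|lborel. \<phi> y * fourier (\<lambda>k. of_real \<bar>k\<bar> * v k) y) + (LINT y|lborel. y\<^sup>2 *\<^sub>R (\<phi> y * \<psi> y)) - of_real \<mu> * (LINT x|lborel. \<phi> x * \<psi> x) = 0" .
  define a where "a = (\<lambda>k. of_real \<bar>k\<bar> * v k)"
  have ca: "continuous_on UNIV a" unfolding a_def by (intro continuous_intros c)
  have sa: "compact_supp a" unfolding a_def by (rule compact_supp_mult[OF s])
  note ia = integrable_compact_supp_complex[OF ca sa]
  have i2: "integrable lborel (\<lambda>k. a k - of_real \<mu> * v k)" using ia(1) iv(1) by simp
  have f: "\<phi> x * fourier (\<lambda>k. of_real (\<bar>k\<bar> - \<mu>) * v k - v'' k) x = \<phi> x * fourier a x + x\<^sup>2 *\<^sub>R (\<phi> x * \<psi> x) - of_real \<mu> * (\<phi> x * \<psi> x)" for x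
  proof -
    have "fourier (\<lambda>k. of_real (\<bar>k\<bar> - \<mu>) * v k - v'' k) x = fourier (\<lambda>k. (a k - of_real \<mu> * v k) - 1 * v'' k) x"
      unfolding a_def by (simp add: left_diff_distrib)
    also have "\<dots> = fourier a x - of_real \<mu> * fourier v x + of_real (x\<^sup>2) * fourier v x"
      using fourier_diff[OF i2 iv''(1), of 1 x] fourier_diff[OF ia(1) iv(1), of "of_real \<mu>" x] fourier_C2_decay(1)[OF v v' l s, of x] by simp
    finally have "\<phi> x * fourier (\<lambda>k. of_real (\<bar>k\<bar> - \<mu>) * v k - v'' k) x = \<phi> x * (fourier a x - of_real \<mu> * \<psi> x + of_real (x\<^sup>2) * \<psi> x)"
      unfolding \<psi>_def by (rule arg_cong)
    also have "\<dots> = \<phi> x * fourier a x + x\<^sup>2 *\<^sub>R (\<phi> x * \<psi> x) - of_real \<mu> * (\<phi> x * \<psi> x)"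
      by (simp add: scaleR_conv_of_real algebra_simps)
    finally show ?thesis .
  qed
  have i3: "integrable lborel (\<lambda>x. x\<^sup>2 *\<^sub>R (\<phi> x * \<psi> x))"
  proof -
    have "x\<^sup>2 *\<^sub>R (\<phi> x * \<psi> x) = - (\<phi> x * fourier v'' x)" for x
      using fourier_C2_decay(1)[OF v v' l s, of x] unfolding \<psi>_def by (simp add: scaleR_conv_of_real algebra_simps)
    then show ?thesis using pairing_fourier_bound(1)[OF _ \<phi>2 iv''] by simp
  qed
  have i4: "integrable lborel (\<lambda>x. \<phi> x * fourier a x)" using pairing_fourier_bound(1)[OF _ \<phi>2 ia] by simp
  show ?thesis unfolding f using * i3 i4 \<phi>\<psi> unfolding a_def by simp
qed

end

section \<open>The Airy equation on the line\<close>

text \<open>Power series coefficients at 0 of the solution of \<open>A'' = (k - \<mu>) A\<close> with \<open>A 0 = a\<close> and \<open>A' 0 = b\<close>.\<close>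

fun airy_coeff :: "real \<Rightarrow> real \<Rightarrow> real \<Rightarrow> nat \<Rightarrow> real" where
  "airy_coeff \<mu> a b 0 = a"
| "airy_coeff \<mu> a b (Suc 0) = b"
| "airy_coeff \<mu> a b (Suc (Suc 0)) = - \<mu> * a / 2"
| "airy_coeff \<mu> a b (Suc (Suc (Suc n))) =
     (airy_coeff \<mu> a b n - \<mu> * airy_coeff \<mu> a b (Suc n)) / (real (n + 3) * real (n + 2))"

text \<open>Once \<open>n\<close> exceeds \<open>r\<^sup>3 + \<bar>\<mu>\<bar> r\<^sup>2\<close>, the recursion makes each scaled coefficient at most the larger of two
  earlier ones.\<close>

lemma airy_coeff_bounded:
  assumes r: "0 < r"
  shows "\<exists>B. \<forall>n. \<bar>airy_coeff \<mu> a b n\<bar> * r ^ n \<le> B"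
proof -
  define c where "c = airy_coeff \<mu> a b"
  define d where "d = (\<lambda>n. \<bar>c n\<bar> * r ^ n)"
  obtain N :: nat where N: "r ^ 3 + \<bar>\<mu>\<bar> * r\<^sup>2 \<le> real N" using real_arch_simple by blast
  define B where "B = Max (d ` {..N + 2})"
  have small: "d n \<le> B" if "n \<le> N + 2" for n unfolding B_def using that by (intro Max_ge) auto
  have B0: "0 \<le> B" using small[of 0] by (simp add: d_def)
  have "d n \<le> B" for n
  proof (induction n rule: less_induct)
    case (less n)
    show ?case
    proof (cases "n \<le> N + 2")
      case False
      then obtain m where m: "n = Suc (Suc (Suc m))" "N \<le> m"
        by (metis Suc_le_D add_2_eq_Suc' not_less_eq_eq Suc_le_mono)
      define q where "q = real (m + 3) * real (m + 2)"
      have q: "r ^ 3 + \<bar>\<mu>\<bar> * r\<^sup>2 \<le> q" "0 < q"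
      proof -
        have "real N \<le> real (m + 3)" using m by simp
        also have "\<dots> \<le> real (m + 3) * real (m + 2)" by simp
        finally show "r ^ 3 + \<bar>\<mu>\<bar> * r\<^sup>2 \<le> q" using N unfolding q_def by linarith
        show "0 < q" unfolding q_def by (intro mult_pos_pos) auto
      qed
      have "d n = \<bar>c m - \<mu> * c (Suc m)\<bar> * r ^ n / q"
        unfolding d_def c_def m(1) q_def by (simp add: abs_mult del: of_nat_add of_nat_Suc)
      also have "\<dots> \<le> (\<bar>c m\<bar> + \<bar>\<mu>\<bar> * \<bar>c (Suc m)\<bar>) * r ^ n / q"
      proof -
        have "\<bar>c m - \<mu> * c (Suc m)\<bar> \<le> \<bar>c m\<bar> + \<bar>\<mu>\<bar> * \<bar>c (Suc m)\<bar>"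
          using abs_triangle_ineq4[of "c m" "\<mu> * c (Suc m)"] by (simp add: abs_mult)
        then show ?thesis using r q by (intro divide_right_mono mult_right_mono) auto
      qed
      also have "\<dots> = (r ^ 3 * d m + \<bar>\<mu>\<bar> * r\<^sup>2 * d (Suc m)) / q"
        unfolding d_def m(1) by (simp add: power3_eq_cube power2_eq_square algebra_simps)
      also have "\<dots> \<le> (r ^ 3 * B + \<bar>\<mu>\<bar> * r\<^sup>2 * B) / q"
        using less.IH[of m] less.IH[of "Suc m"] m r q by (intro divide_right_mono add_mono mult_left_mono) auto
      also have "\<dots> = (r ^ 3 + \<bar>\<mu>\<bar> * r\<^sup>2) / q * B" by (simp add: algebra_simps)
      also have "\<dots> \<le> 1 * B" using q B0 by (intro mult_right_mono) (auto simp: divide_le_eq)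
      finally show ?thesis by simp
    qed (rule small)
  qed
  then show ?thesis unfolding d_def c_def by blast
qed

lemma airy_summable: "summable (\<lambda>n. airy_coeff \<mu> a b n * x ^ n)"
proof -
  obtain B where B: "\<And>n. \<bar>airy_coeff \<mu> a b n\<bar> * (\<bar>x\<bar> + 1) ^ n \<le> B"
    using airy_coeff_bounded[of "\<bar>x\<bar> + 1" \<mu> a b] by (metis abs_ge_zero add_nonneg_pos zero_less_one)
  have "summable (\<lambda>n. norm (airy_coeff \<mu> a b n) * \<bar>x\<bar> ^ n)"
    by (rule Abel_lemma[of _ "\<bar>x\<bar> + 1" _ B]) (use B in auto)
  then show ?thesis by (intro summable_norm_cancel[of "\<lambda>n. airy_coeff \<mu> a b n * x ^ n"]) (simp add: abs_mult power_abs)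
qed

lemma airy_half_line:
  fixes \<mu> a b :: real
  obtains A A' where "\<And>k. (A has_real_derivative A' k) (at k)"
    "\<And>k. (A' has_real_derivative (k - \<mu>) * A k) (at k)" "A 0 = a" "A' 0 = b"
proof
  define c where "c = airy_coeff \<mu> a b"
  have s: "summable (\<lambda>n. c n * x ^ n)" for x unfolding c_def by (rule airy_summable)
  have s1: "summable (\<lambda>n. diffs c n * x ^ n)" for x by (rule termdiff_converges_all[OF s])
  let ?A = "\<lambda>x. \<Sum>n. c n * x ^ n" and ?A' = "\<lambda>x. \<Sum>n. diffs c n * x ^ n"
  show "(?A has_real_derivative ?A' k) (at k)" for k by (rule termdiffs_strong_converges_everywhere[OF s])
  have "(?A' has_real_derivative (\<Sum>n. diffs (diffs c) n * k ^ n)) (at k)" for k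
    by (rule termdiffs_strong_converges_everywhere[OF s1])
  moreover have "(\<Sum>n. diffs (diffs c) n * k ^ n) = (k - \<mu>) * ?A k" for k
  proof -
    have s2: "summable (\<lambda>n. diffs (diffs c) n * k ^ n)" by (rule termdiff_converges_all[OF s1])
    have d: "diffs (diffs c) (Suc n) = c n - \<mu> * c (Suc n)" for n
    proof -
      have nz: "real (n + 3) * real (n + 2) \<noteq> 0" by simp
      have "diffs (diffs c) (Suc n) = real (n + 3) * real (n + 2) * c (Suc (Suc (Suc n)))"
        unfolding diffs_def by (simp add: mult_ac)
      also have "c (Suc (Suc (Suc n))) = (c n - \<mu> * c (Suc n)) / (real (n + 3) * real (n + 2))" unfolding c_def by simp
      finally show ?thesis using nonzero_mult_div_cancel_left[OF nz] by (simp only: times_divide_eq_right)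
    qed
    have d0: "diffs (diffs c) 0 = - \<mu> * c 0" unfolding diffs_def c_def by (simp add: numeral_2_eq_2)
    have "(\<Sum>n. diffs (diffs c) n * k ^ n) = (\<Sum>n. diffs (diffs c) (Suc n) * k ^ Suc n) + diffs (diffs c) 0"
      using suminf_split_head[OF s2] by simp
    also have "(\<lambda>n. diffs (diffs c) (Suc n) * k ^ Suc n) = (\<lambda>n. k * (c n * k ^ n) - \<mu> * (c (Suc n) * k ^ Suc n))"
      unfolding d by (simp add: fun_eq_iff algebra_simps)
    also have "(\<Sum>n. k * (c n * k ^ n) - \<mu> * (c (Suc n) * k ^ Suc n)) = k * ?A k - \<mu> * (\<Sum>n. c (Suc n) * k ^ Suc n)"
    proof -
      have s3: "summable (\<lambda>n. c (Suc n) * k ^ Suc n)" using s[of k] by (subst summable_Suc_iff)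
      show ?thesis
        using suminf_diff[OF summable_mult[OF s, of k k] summable_mult[OF s3, of \<mu>]] suminf_mult[OF s[of k], of k] suminf_mult[OF s3, of \<mu>] by simp
    qed
    also have "(\<Sum>n. c (Suc n) * k ^ Suc n) = ?A k - c 0" using suminf_split_head[OF s[of k]] by simp
    finally show ?thesis unfolding d0 by (simp add: algebra_simps)
  qed
  ultimately show "(?A' has_real_derivative (k - \<mu>) * ?A k) (at k)" for k by simp
  have z: "(\<Sum>n. f n * 0 ^ n) = f 0" for f :: "nat \<Rightarrow> real" by (rule powser_zero)
  show "?A 0 = a" unfolding z by (simp add: c_def)
  show "?A' 0 = b" unfolding z by (simp add: c_def diffs_def)
qed

lemma deriv_glue:
  fixes f g :: "real \<Rightarrow> real"
  assumes f: "(f has_real_derivative D) (at 0)" and g: "(g has_real_derivative D) (at 0)" and fg: "f 0 = g 0"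
  shows "((\<lambda>k. if 0 \<le> k then f k else g k) has_real_derivative D) (at 0)"
  unfolding has_field_derivative_iff filterlim_at_split
proof
  let ?h = "\<lambda>k. if 0 \<le> k then f k else g k"
  have "((\<lambda>y. (g y - g 0) / (y - 0)) \<longlongrightarrow> D) (at_left 0)" "((\<lambda>y. (f y - f 0) / (y - 0)) \<longlongrightarrow> D) (at_right 0)"
    using f g unfolding has_field_derivative_iff filterlim_at_split by auto
  then show "((\<lambda>y. (?h y - ?h 0) / (y - 0)) \<longlongrightarrow> D) (at_left 0)" "((\<lambda>y. (?h y - ?h 0) / (y - 0)) \<longlongrightarrow> D) (at_right 0)"
    by (elim Lim_transform_eventually; auto simp: eventually_at_filter fg)+
qed

text \<open>The solution for the potential \<open>\<bar>k\<bar>\<close> is glued at 0 from a half-line solution and a reflected one with the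
  opposite initial slope; the first two derivatives match there because \<open>\<bar>k\<bar>\<close> is continuous.\<close>

lemma airy_line:
  fixes \<mu> a b :: real
  obtains U V where "\<And>k. (U has_real_derivative V k) (at k)"
    "\<And>k. (V has_real_derivative (\<bar>k\<bar> - \<mu>) * U k) (at k)" "U 0 = a" "V 0 = b"
proof -
  obtain A A' where A: "\<And>k. (A has_real_derivative A' k) (at k)"
    "\<And>k. (A' has_real_derivative (k - \<mu>) * A k) (at k)" "A 0 = a" "A' 0 = b" using airy_half_line[where \<mu> = \<mu> and a = a and b = b] by blast
  obtain B B' where B: "\<And>k. (B has_real_derivative B' k) (at k)"
    "\<And>k. (B' has_real_derivative (k - \<mu>) * B k) (at k)" "B 0 = a" "B' 0 = - b" using airy_half_line[where \<mu> = \<mu> and a = a and b = "- b"] by blast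
  define U where "U = (\<lambda>k. if 0 \<le> k then A k else B (- k))"
  define V where "V = (\<lambda>k. if 0 \<le> k then A' k else - B' (- k))"
  have B1: "((\<lambda>k. B (- k)) has_real_derivative - B' (- k)) (at k)" for k
    by (rule DERIV_mirror[THEN iffD1, OF B(1)])
  have B2: "((\<lambda>k. - B' (- k)) has_real_derivative (- k - \<mu>) * B (- k)) (at k)" for k
    using DERIV_minus[OF DERIV_mirror[THEN iffD1, OF B(2)]] by simp
  have loc: "(h has_real_derivative D) (at k)"
    if "(f has_real_derivative D) (at k)" "open S" "k \<in> S" "\<And>x. x \<in> S \<Longrightarrow> f x = h x" for h f D k S
    using has_field_derivative_transform_within_open[OF that(1-3)] that(4) by auto
  have "(U has_real_derivative V k) (at k)" for k
  proof (cases k "0 :: real" rule: linorder_cases)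
    case less then show ?thesis
      using loc[OF B1[of k], of "{..<0}" U] by (auto simp: U_def V_def)
  next
    case equal then show ?thesis
      using deriv_glue[of A b "\<lambda>k. B (- k)"] A(1)[of 0] A(3,4) B1[of 0] B(3,4) by (simp add: U_def V_def)
  next
    case greater then show ?thesis
      using loc[OF A(1)[of k], of "{0<..}" U] by (auto simp: U_def V_def)
  qed
  moreover have "(V has_real_derivative (\<bar>k\<bar> - \<mu>) * U k) (at k)" for k
  proof (cases k "0 :: real" rule: linorder_cases)
    case less then show ?thesis
      using loc[OF B2[of k], of "{..<0}" V] by (auto simp: U_def V_def)
  next
    case equal then show ?thesis
      using deriv_glue[of A' "- \<mu> * a" "\<lambda>k. - B' (- k)"] A(2)[of 0] A(3,4) B2[of 0] B(3,4) by (simp add: U_def V_def)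
  next
    case greater then show ?thesis
      using loc[OF A(2)[of k], of "{0<..}" V] by (auto simp: U_def V_def)
  qed
  moreover have "U 0 = a" "V 0 = b" using A by (auto simp: U_def V_def)
  ultimately show thesis by (rule that)
qed

lemma antiderivative_compact_supp:
  fixes h :: "real \<Rightarrow> complex"
  assumes c: "continuous_on UNIV h" and N: "\<And>k. N < \<bar>k\<bar> \<Longrightarrow> h k = 0" and z: "(LINT k|lborel. h k) = 0"
  obtains P where "\<And>k. (P has_vector_derivative h k) (at k)" "\<And>k. N < \<bar>k\<bar> \<Longrightarrow> P k = 0"
proof
  define P where "P = (\<lambda>k. LINT y|lborel. indicator {..k} y *\<^sub>R h y)"
  show "P k = 0" if "N < \<bar>k\<bar>" for k
  proof (cases "k \<ge> 0")
    case True
    then have "(\<lambda>y. indicator {..k} y *\<^sub>R h y) = h" using that N by (auto simp: fun_eq_iff indicator_def)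
    then show ?thesis unfolding P_def using z by simp
  next
    case False
    then have "(\<lambda>y. indicator {..k} y *\<^sub>R h y) = (\<lambda>_. 0)" using that N by (auto simp: fun_eq_iff indicator_def)
    then show ?thesis unfolding P_def by simp
  qed
  show "(P has_vector_derivative h k) (at k)" for k
  proof -
    define M where "M = \<bar>k\<bar> + \<bar>N\<bar> + 1"
    have k: "k \<in> {-M<..<M}" unfolding M_def by auto
    have eq: "P x = (LBINT y=-M..x. h y)" if "x \<in> {-M<..<M}" for x
    proof -
      have "(\<lambda>y. indicator {..x} y *\<^sub>R h y) = (\<lambda>y. indicator {-M..x} y *\<^sub>R h y)"
        using N by (auto simp: fun_eq_iff indicator_def M_def)
      then have "P x = (LINT y:{-M..x}|lborel. h y)" unfolding P_def set_lebesgue_integral_def by simp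
      also have "\<dots> = (LBINT y=-M..x. h y)" using that interval_integral_Icc[of "-M" x h] by simp
      finally show ?thesis .
    qed
    have "((\<lambda>u. LBINT y=-M..u. h y) has_vector_derivative h k) (at k within {-M..M})"
      using interval_integral_FTC2[of "-M" "-M" M h k] k continuous_on_subset[OF c] by (auto simp: M_def)
    then have "((\<lambda>u. LBINT y=-M..u. h y) has_vector_derivative h k) (at k within {-M<..<M})"
      by (rule has_vector_derivative_within_subset) auto
    then have "((\<lambda>u. LBINT y=-M..u. h y) has_vector_derivative h k) (at k)"
      using at_within_open[OF k] by simp
    then show ?thesis
      by (rule has_vector_derivative_transform_within_open[OF _ _ k]) (auto simp: eq)
  qed
qed

text \<open>Variation of parameters gives \<open>v = u1 P - u2 Q\<close> with antiderivatives \<open>P\<close> of \<open>u2 g\<close> and \<open>Q\<close> of \<open>u1 g\<close>.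
  Both vanish to the left of the support of \<open>g\<close>, and the orthogonality relations make them vanish to
  the right of it.\<close>

lemma variation_of_parameters:
  fixes q u1 u2 w1 w2 :: "real \<Rightarrow> real" and g :: "real \<Rightarrow> complex"
  assumes u1: "\<And>k. (u1 has_real_derivative w1 k) (at k)" "\<And>k. (w1 has_real_derivative q k * u1 k) (at k)"
    and u2: "\<And>k. (u2 has_real_derivative w2 k) (at k)" "\<And>k. (w2 has_real_derivative q k * u2 k) (at k)"
    and wronskian: "u1 0 * w2 0 - w1 0 * u2 0 = 1"
    and c: "continuous_on UNIV g" and s: "compact_supp g"
    and o1: "(LINT k|lborel. of_real (u1 k) * g k) = 0" and o2: "(LINT k|lborel. of_real (u2 k) * g k) = 0"
  obtains v v' where "\<And>k. (v has_vector_derivative v' k) (at k)"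
    "\<And>k. (v' has_vector_derivative of_real (q k) * v k - g k) (at k)" "compact_supp v"
proof -
  obtain N where N: "\<And>k. N < \<bar>k\<bar> \<Longrightarrow> g k = 0" using s unfolding compact_supp_def by blast
  have cu: "continuous_on UNIV u1" "continuous_on UNIV u2"
    using u1(1) u2(1) by (meson DERIV_isCont continuous_at_imp_continuous_on)+
  have c1: "continuous_on UNIV (\<lambda>k. of_real (u1 k) * g k)" and c2: "continuous_on UNIV (\<lambda>k. of_real (u2 k) * g k)"
    by (intro continuous_intros cu c)+
  obtain Q where Q: "\<And>k. (Q has_vector_derivative of_real (u1 k) * g k) (at k)" "\<And>k. N < \<bar>k\<bar> \<Longrightarrow> Q k = 0"
    using antiderivative_compact_supp[OF c1 _ o1, of N] N by (metis mult_zero_right)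
  obtain P where P: "\<And>k. (P has_vector_derivative of_real (u2 k) * g k) (at k)" "\<And>k. N < \<bar>k\<bar> \<Longrightarrow> P k = 0"
    using antiderivative_compact_supp[OF c2 _ o2, of N] N by (metis mult_zero_right)
  have W: "u1 k * w2 k - w1 k * u2 k = 1" for k
  proof -
    have "((\<lambda>k. u1 k * w2 k - w1 k * u2 k) has_real_derivative 0) (at k)" for k
      by (auto intro!: derivative_eq_intros u1 u2)
    then have "\<forall>k. ((\<lambda>k. u1 k * w2 k - w1 k * u2 k) has_real_derivative 0) (at k)" by blast
    from DERIV_isconst_all[OF this, of k 0] wronskian show ?thesis by simp
  qed
  have r: "((\<lambda>k. complex_of_real (f k)) has_vector_derivative of_real D) (at k)"
    if "(f has_real_derivative D) (at k)" for f D k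
    using that by (rule has_vector_derivative_of_real)
  define v where "v = (\<lambda>k. of_real (u1 k) * P k - of_real (u2 k) * Q k)"
  define v' where "v' = (\<lambda>k. of_real (w1 k) * P k - of_real (w2 k) * Q k)"
  show thesis
  proof
    show "(v has_vector_derivative v' k) (at k)" for k
    proof -
      have "(v has_vector_derivative (of_real (u1 k) * (of_real (u2 k) * g k) + of_real (w1 k) * P k)
          - (of_real (u2 k) * (of_real (u1 k) * g k) + of_real (w2 k) * Q k)) (at k)"
        unfolding v_def by (intro has_vector_derivative_diff has_vector_derivative_mult r u1 u2 P Q)
      then show ?thesis unfolding v'_def by (simp add: algebra_simps)
    qed
    show "(v' has_vector_derivative of_real (q k) * v k - g k) (at k)" for k
    proof -
      have "(v' has_vector_derivative (of_real (w1 k) * (of_real (u2 k) * g k) + of_real (q k * u1 k) * P k)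
          - (of_real (w2 k) * (of_real (u1 k) * g k) + of_real (q k * u2 k) * Q k)) (at k)"
        unfolding v'_def by (intro has_vector_derivative_diff has_vector_derivative_mult r u1 u2 P Q)
      also have "(of_real (w1 k) * (of_real (u2 k) * g k) + of_real (q k * u1 k) * P k)
          - (of_real (w2 k) * (of_real (u1 k) * g k) + of_real (q k * u2 k) * Q k)
        = of_real (q k) * v k - of_real (u1 k * w2 k - w1 k * u2 k) * g k"
        unfolding v_def by (simp add: algebra_simps)
      finally show ?thesis unfolding W by simp
    qed
    have "v k = 0" if "N < \<bar>k\<bar>" for k unfolding v_def using P(2)[OF that] Q(2)[OF that] by simp
    then show "compact_supp v" unfolding compact_supp_def by blast
  qed
qed

text \<open>Linearity is expressed through a single operation \<open>sub\<close>, which stands for \<open>g - c h\<close> on a space of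
  functions without a vector space type.\<close>

lemma functional_vanishing_on_kernel:
  fixes L l :: "'a \<Rightarrow> complex" and sub :: "'a \<Rightarrow> complex \<Rightarrow> 'a \<Rightarrow> 'a"
  assumes S: "\<And>g h c. g \<in> S \<Longrightarrow> h \<in> S \<Longrightarrow> sub g c h \<in> S"
    and L: "\<And>g h c. g \<in> S \<Longrightarrow> h \<in> S \<Longrightarrow> L (sub g c h) = L g - c * L h"
    and l: "\<And>g h c. g \<in> S \<Longrightarrow> h \<in> S \<Longrightarrow> l (sub g c h) = l g - c * l h"
    and ker: "\<And>g. g \<in> S \<Longrightarrow> l g = 0 \<Longrightarrow> L g = 0"
  shows "\<exists>a. \<forall>g\<in>S. L g = a * l g"
proof (cases "\<exists>h\<in>S. l h \<noteq> 0")
  case True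
  then obtain h where h: "h \<in> S" "l h \<noteq> 0" by blast
  have "L g = L h / l h * l g" if "g \<in> S" for g
  proof -
    have "l (sub g (l g / l h) h) = 0" using l[OF that h(1)] h(2) by simp
    then have "L (sub g (l g / l h) h) = 0" using S[OF that h(1)] ker by blast
    then show ?thesis using L[OF that h(1)] by (simp add: field_simps)
  qed
  then show ?thesis by blast
qed (use ker in auto)

lemma functional_combination:
  fixes L l1 l2 :: "'a \<Rightarrow> complex" and sub :: "'a \<Rightarrow> complex \<Rightarrow> 'a \<Rightarrow> 'a"
  assumes S: "\<And>g h c. g \<in> S \<Longrightarrow> h \<in> S \<Longrightarrow> sub g c h \<in> S"
    and L: "\<And>g h c. g \<in> S \<Longrightarrow> h \<in> S \<Longrightarrow> L (sub g c h) = L g - c * L h"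
    and l1: "\<And>g h c. g \<in> S \<Longrightarrow> h \<in> S \<Longrightarrow> l1 (sub g c h) = l1 g - c * l1 h"
    and l2: "\<And>g h c. g \<in> S \<Longrightarrow> h \<in> S \<Longrightarrow> l2 (sub g c h) = l2 g - c * l2 h"
    and ker: "\<And>g. g \<in> S \<Longrightarrow> l1 g = 0 \<Longrightarrow> l2 g = 0 \<Longrightarrow> L g = 0"
  shows "\<exists>a b. \<forall>g\<in>S. L g = a * l1 g + b * l2 g"
proof -
  obtain b where b: "\<And>g. g \<in> {g \<in> S. l1 g = 0} \<Longrightarrow> L g = b * l2 g"
    using functional_vanishing_on_kernel[of "{g \<in> S. l1 g = 0}" sub L l2] S L l1 l2 ker by (auto simp: Ball_def)
  have "\<exists>a. \<forall>g\<in>S. L g - b * l2 g = a * l1 g"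
  proof (rule functional_vanishing_on_kernel[of S sub "\<lambda>g. L g - b * l2 g" l1])
    fix g h c assume gh: "g \<in> S" "h \<in> S"
    show "L (sub g c h) - b * l2 (sub g c h) = L g - b * l2 g - c * (L h - b * l2 h)"
      unfolding L[OF gh] l2[OF gh] by (simp add: algebra_simps)
  qed (use S l1 b in auto)
  then show ?thesis by (metis add.commute diff_add_cancel)
qed

section \<open>Decay of square-integrable solutions\<close>

lemma weighted_mono:
  fixes f f' :: "real \<Rightarrow> real"
  assumes "\<And>x. a \<le> x \<Longrightarrow> (f has_real_derivative f' x) (at x)" "\<And>x. a \<le> x \<Longrightarrow> 0 \<le> f' x" "a \<le> x" "x \<le> y"
  shows "f x \<le> f y"
  by (rule DERIV_nonneg_imp_nondecreasing[OF assms(4)]) (use assms in \<open>meson order_trans\<close>)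

lemma not_integrable_lower_bound:
  fixes f :: "real \<Rightarrow> real"
  assumes f: "integrable lborel f" "\<And>x. 0 \<le> f x" and d: "0 < d" "\<And>x. a \<le> x \<Longrightarrow> d \<le> f x"
  shows False
proof -
  obtain n :: nat where n: "(LINT x|lborel. f x) / d < real n" using reals_Archimedean2 by blast
  have "real n * d = (LINT x|lborel. indicator {a..a + real n} x * d)" by simp
  also have "\<dots> \<le> (LINT x|lborel. f x)"
  proof (rule integral_mono[OF _ f(1)])
    show "integrable lborel (\<lambda>x. indicator {a..a + real n} x * d)"
      by (intro integrable_mult_left integrable_real_indicator) (auto simp: emeasure_lborel_Icc_eq)
    show "indicator {a..a + real n} x * d \<le> f x" for x using f d(2)[of x] by (auto simp: indicator_def)
  qed
  finally show False using n d(1) by (simp add: field_simps)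
qed

text \<open>With \<open>f = r\<^sup>2\<close> one has \<open>f'' \<ge> c\<^sup>2 f\<close> far out, so \<open>f' + c f\<close> grows exponentially once it is positive. That
  would keep \<open>f\<close> away from zero, against integrability; hence \<open>f' \<le> - c f\<close>.\<close>

lemma airy_L2_decay_far:
  fixes r s :: "real \<Rightarrow> real"
  assumes r: "\<And>k. 0 \<le> k \<Longrightarrow> (r has_real_derivative s k) (at k)"
    and s: "\<And>k. 0 \<le> k \<Longrightarrow> (s has_real_derivative (k - \<mu>) * r k) (at k)"
    and int: "integrable lborel (\<lambda>k. (r k)\<^sup>2)" and c: "0 < c"
  shows "\<exists>K\<ge>0. \<forall>k\<ge>K. (r k)\<^sup>2 * exp (c * k) \<le> (r K)\<^sup>2 * exp (c * K)"
proof -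
  \<comment> \<open>beyond this point \<open>k - \<mu>\<close> is at least \<open>c\<^sup>2\<close>\<close>
  define K where "K = \<bar>\<mu>\<bar> + c\<^sup>2"
  have K: "0 \<le> K" "\<And>k. K \<le> k \<Longrightarrow> c\<^sup>2 \<le> 2 * (k - \<mu>)"
  proof -
    show "0 \<le> K" unfolding K_def by simp
    show "c\<^sup>2 \<le> 2 * (k - \<mu>)" if "K \<le> k" for k
      using that zero_le_power2[of c] abs_ge_self[of \<mu>] unfolding K_def by argo
  qed
  define f where "f = (\<lambda>k. (r k)\<^sup>2)"
  define f' where "f' = (\<lambda>k. 2 * r k * s k)"
  define f'' where "f'' = (\<lambda>k. 2 * (s k)\<^sup>2 + 2 * (k - \<mu>) * f k)"
  have df: "(f has_real_derivative f' k) (at k)" if "K \<le> k" for k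
    unfolding f_def f'_def using K(1) that by (auto intro!: derivative_eq_intros r)
  have df': "(f' has_real_derivative f'' k) (at k)" if "K \<le> k" for k
    unfolding f''_def f'_def f_def using K(1) that by (auto intro!: derivative_eq_intros r s simp: power2_eq_square algebra_simps)
  have f0: "0 \<le> f k" for k unfolding f_def by simp
  have f''_ge: "c\<^sup>2 * f k \<le> f'' k" if "K \<le> k" for k
    using mult_right_mono[OF K(2)[OF that] f0[of k]] zero_le_power2[of "s k"] unfolding f''_def by linarith
  define w where "w = (\<lambda>k. f' k + c * f k)"
  have w_le: "w k0 \<le> 0" if k0: "K \<le> k0" for k0
  proof (rule ccontr)
    assume "\<not> w k0 \<le> 0"
    then have w0: "0 < w k0" by simp
    have w_grow: "w k0 \<le> w k" if "k0 \<le> k" for k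
    proof -
      have "w k0 * exp (- c * k0) \<le> w k * exp (- c * k)"
      proof (rule weighted_mono[where f = "\<lambda>k. w k * exp (- c * k)" and a = k0 and f' = "\<lambda>k. (f'' k - c\<^sup>2 * f k) * exp (- c * k)"])
        fix x assume x: "k0 \<le> x"
        show "((\<lambda>k. w k * exp (- c * k)) has_real_derivative (f'' x - c\<^sup>2 * f x) * exp (- c * x)) (at x)"
          unfolding w_def using x k0 by (auto intro!: derivative_eq_intros df df' simp: power2_eq_square algebra_simps)
        show "0 \<le> (f'' x - c\<^sup>2 * f x) * exp (- c * x)" using f''_ge[of x] x k0 by simp
      qed (use that in auto)
      also have "\<dots> = w k * exp (- c * (k - k0)) * exp (- c * k0)"
        by (simp add: algebra_simps flip: exp_add)
      finally have w1: "w k0 \<le> w k * exp (- c * (k - k0))" by simp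
      with w0 have "0 < w k * exp (- c * (k - k0))" by linarith
      then have "0 < w k" by (simp add: zero_less_mult_iff)
      then have "w k * exp (- c * (k - k0)) \<le> w k" using c that by (intro mult_left_le) auto
      with w1 show ?thesis by linarith
    qed
    define d where "d = w k0 / c"
    have d0: "0 < d" unfolding d_def using w0 c by simp
    have f_ge: "d / 2 \<le> f k" if "k0 + 1 / c \<le> k" for k
    proof -
      have k: "k0 \<le> k" "1 \<le> c * (k - k0)" 
      proof -
        have "1 / c \<le> k - k0" using that by simp
        then show "1 \<le> c * (k - k0)" using c by (simp add: divide_le_eq mult.commute)
        show "k0 \<le> k" using that c by (meson add_increasing2 divide_nonneg_pos order_trans zero_le_one le_add_same_cancel1)
      qed
      have "(f k0 - d) * exp (c * k0) \<le> (f k - d) * exp (c * k)"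
      proof (rule weighted_mono[where f = "\<lambda>k. (f k - d) * exp (c * k)" and a = k0 and f' = "\<lambda>k. (w k - w k0) * exp (c * k)"])
        fix x assume x: "k0 \<le> x"
        show "((\<lambda>k. (f k - d) * exp (c * k)) has_real_derivative (w x - w k0) * exp (c * x)) (at x)"
          unfolding w_def d_def using x k0 c by (auto intro!: derivative_eq_intros df simp: field_simps)
        show "0 \<le> (w x - w k0) * exp (c * x)" using w_grow[OF x] by simp
      qed (use k in auto)
      also have "\<dots> = (f k - d) * exp (c * (k - k0)) * exp (c * k0)" by (simp add: algebra_simps flip: exp_add)
      finally have "f k0 - d \<le> (f k - d) * exp (c * (k - k0))" by simp
      then have 1: "- d \<le> (f k - d) * exp (c * (k - k0))" using f0[of k0] by linarith
      have e2: "2 \<le> exp (c * (k - k0))" using exp_ge_add_one_self[of "c * (k - k0)"] k(2) by linarith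
      show "d / 2 \<le> f k"
      proof (rule ccontr)
        assume "\<not> d / 2 \<le> f k"
        then have "f k - d < - (d / 2)" by simp
        then have "(f k - d) * exp (c * (k - k0)) < - (d / 2) * exp (c * (k - k0))" by (intro mult_strict_right_mono) auto
        also have "\<dots> \<le> - (d / 2) * 2" using d0 e2 by (intro mult_left_mono_neg) auto
        finally show False using 1 by simp
      qed
    qed
    show False
      by (rule not_integrable_lower_bound[where f = f and d = "d / 2" and a = "k0 + 1 / c"])
         (use int f0 d0 f_ge in \<open>auto simp: f_def\<close>)
  qed
  have "f k * exp (c * k) \<le> f K * exp (c * K)" if "K \<le> k" for k
  proof -
    have "- (f K * exp (c * K)) \<le> - (f k * exp (c * k))"
    proof (rule weighted_mono[where f = "\<lambda>k. - (f k * exp (c * k))" and a = K and f' = "\<lambda>k. - (w k * exp (c * k))"])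
      fix x assume x: "K \<le> x"
      show "((\<lambda>k. - (f k * exp (c * k))) has_real_derivative - (w x * exp (c * x))) (at x)"
        unfolding w_def using x by (auto intro!: derivative_eq_intros df simp: algebra_simps)
      show "0 \<le> - (w x * exp (c * x))" using w_le[OF x] by (simp add: mult_nonpos_nonneg)
    qed (use that in auto)
    then show ?thesis by simp
  qed
  then show ?thesis using K(1) unfolding f_def by blast
qed

lemma airy_L2_decay_value:
  fixes r s :: "real \<Rightarrow> real"
  assumes r: "\<And>k. 0 \<le> k \<Longrightarrow> (r has_real_derivative s k) (at k)"
    and s: "\<And>k. 0 \<le> k \<Longrightarrow> (s has_real_derivative (k - \<mu>) * r k) (at k)"
    and int: "integrable lborel (\<lambda>k. (r k)\<^sup>2)" and c: "0 < c"
  shows "\<exists>C. \<forall>k\<ge>0. \<bar>r k\<bar> \<le> C * exp (- c * k)"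
proof -
  obtain K where K: "0 \<le> K" and far: "\<And>k. K \<le> k \<Longrightarrow> (r k)\<^sup>2 * exp (2 * c * k) \<le> (r K)\<^sup>2 * exp (2 * c * K)"
    using airy_L2_decay_far[OF r s int, of "2 * c"] c by auto
  have "isCont r k" if "0 \<le> k" for k using r[OF that] by (rule DERIV_isCont)
  then have "continuous_on {0..K} r" by (intro continuous_at_imp_continuous_on) simp
  then have "continuous_on {0..K} (\<lambda>k. \<bar>r k\<bar> * exp (c * k))" by (intro continuous_intros)
  then have "compact ((\<lambda>k. \<bar>r k\<bar> * exp (c * k)) ` {0..K})" by (intro compact_continuous_image) auto
  then have "bounded ((\<lambda>k. \<bar>r k\<bar> * exp (c * k)) ` {0..K})" by (rule compact_imp_bounded)
  then obtain B where "\<forall>x\<in>(\<lambda>k. \<bar>r k\<bar> * exp (c * k)) ` {0..K}. norm x \<le> B" unfolding bounded_iff ..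
  then have B: "norm (\<bar>r k\<bar> * exp (c * k)) \<le> B" if "k \<in> {0..K}" for k using that by simp
  have sq: "(\<bar>r k\<bar> * exp (c * k))\<^sup>2 = (r k)\<^sup>2 * exp (2 * c * k)" for k
    by (simp add: power_mult_distrib exp_double[symmetric] mult_ac)
  have "\<bar>r k\<bar> * exp (c * k) \<le> B" if "0 \<le> k" for k
  proof (cases "k \<le> K")
    case True then show ?thesis using B[of k] that by simp
  next
    case False
    then have "(\<bar>r k\<bar> * exp (c * k))\<^sup>2 \<le> (\<bar>r K\<bar> * exp (c * K))\<^sup>2" unfolding sq using far[of k] by simp
    then have "\<bar>r k\<bar> * exp (c * k) \<le> \<bar>r K\<bar> * exp (c * K)" by (rule power2_le_imp_le) simp
    also have "\<dots> \<le> B" using B[of K] K by simp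
    finally show ?thesis .
  qed
  then have "\<forall>k\<ge>0. \<bar>r k\<bar> \<le> B * exp (- c * k)" by (simp add: exp_minus field_simps)
  then show ?thesis by blast
qed

text \<open>The derivative is controlled through the mean value theorem on \<open>[k, k + 1]\<close> by \<open>r\<close> and \<open>r''\<close>; decay of \<open>r\<close> at the
  rate \<open>c + 1\<close> absorbs the linear factor in \<open>r'' = (k - \<mu>) r\<close>.\<close>

lemma airy_L2_decay:
  fixes r s :: "real \<Rightarrow> real"
  assumes r: "\<And>k. 0 \<le> k \<Longrightarrow> (r has_real_derivative s k) (at k)"
    and s: "\<And>k. 0 \<le> k \<Longrightarrow> (s has_real_derivative (k - \<mu>) * r k) (at k)"
    and int: "integrable lborel (\<lambda>k. (r k)\<^sup>2)" and c: "0 < c"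
  shows "\<exists>C. \<forall>k\<ge>0. \<bar>r k\<bar> \<le> C * exp (- c * k) \<and> \<bar>s k\<bar> \<le> C * exp (- c * k)"
proof -
  obtain C where C: "\<And>k. 0 \<le> k \<Longrightarrow> \<bar>r k\<bar> \<le> C * exp (- (c + 1) * k)"
    using airy_L2_decay_value[OF r s int, of "c + 1"] c by auto
  have C0: "0 \<le> C" using C[of 0] by (simp add: order_trans[OF abs_ge_zero])
  have step: "exp (- (c + 1) * k) \<le> exp (- c * k)" if "0 \<le> k" for k using that by (simp add: algebra_simps)
  have rb: "\<bar>r k\<bar> \<le> C * exp (- c * k)" if "0 \<le> k" for k
    using C[OF that] mult_left_mono[OF step[OF that] C0] by linarith
  have sb: "\<bar>s k\<bar> \<le> (3 + \<bar>\<mu>\<bar>) * C * exp (- c * k)" if k: "0 \<le> k" for k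
  proof -
    obtain \<xi> where \<xi>: "k < \<xi>" "\<xi> < k + 1" "r (k + 1) - r k = s \<xi>"
      using MVT2[of k "k + 1" r s] r k by auto
    obtain \<eta> where \<eta>: "k < \<eta>" "\<eta> < \<xi>" "s \<xi> - s k = (\<xi> - k) * ((\<eta> - \<mu>) * r \<eta>)"
      using MVT2[of k \<xi> s "\<lambda>k. (k - \<mu>) * r k"] s k \<xi> by auto
    have mono: "\<bar>r x\<bar> \<le> C * exp (- (c + 1) * k)" if "k \<le> x" for x
    proof -
      have "exp (- (c + 1) * x) \<le> exp (- (c + 1) * k)" using that c by simp
      then show ?thesis using C[of x] that k mult_left_mono[of _ _ C] C0 by (meson order_trans)
    qed
    have "\<bar>s \<xi>\<bar> \<le> 2 * (C * exp (- (c + 1) * k))"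
      using mono[of "k + 1"] mono[of k] unfolding \<xi>(3)[symmetric] by linarith
    also have "\<dots> \<le> 2 * (C * exp (- c * k))" using mult_left_mono[OF step[OF k] C0] by linarith
    finally have 1: "\<bar>s \<xi>\<bar> \<le> 2 * (C * exp (- c * k))" .
    have "\<bar>(\<xi> - k) * ((\<eta> - \<mu>) * r \<eta>)\<bar> \<le> 1 * (((1 + k) * (1 + \<bar>\<mu>\<bar>)) * (C * exp (- (c + 1) * k)))"
      unfolding abs_mult
    proof (intro mult_mono)
      have "\<bar>\<eta> - \<mu>\<bar> \<le> 1 + k + \<bar>\<mu>\<bar>" using \<eta> \<xi> k by linarith
      also have "\<dots> \<le> (1 + k) * (1 + \<bar>\<mu>\<bar>)" using k by (simp add: algebra_simps)
      finally show "\<bar>\<eta> - \<mu>\<bar> \<le> (1 + k) * (1 + \<bar>\<mu>\<bar>)" .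
    qed (use \<xi> \<eta> k mono[of \<eta>] C0 in auto)
    also have "\<dots> \<le> (exp k * (1 + \<bar>\<mu>\<bar>)) * (C * exp (- (c + 1) * k))"
      using exp_ge_add_one_self[of k] C0 by (simp add: mult_right_mono)
    also have "\<dots> = (1 + \<bar>\<mu>\<bar>) * (C * (exp k * exp (- (c + 1) * k)))" by simp
    also have "exp k * exp (- (c + 1) * k) = exp (- c * k)" by (simp add: algebra_simps flip: exp_add)
    finally have "\<bar>s \<xi> - s k\<bar> \<le> (1 + \<bar>\<mu>\<bar>) * (C * exp (- c * k))" unfolding \<eta>(3) .
    with 1 have "\<bar>s k\<bar> \<le> 2 * (C * exp (- c * k)) + (1 + \<bar>\<mu>\<bar>) * (C * exp (- c * k))" by linarith
    then show ?thesis by (simp add: algebra_simps)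
  qed
  have "C * exp (- c * k) \<le> (3 + \<bar>\<mu>\<bar>) * C * exp (- c * k)" for k
    using C0 by (intro mult_right_mono mult_right_mono[of 1 "3 + \<bar>\<mu>\<bar>" C, simplified]) auto
  then show ?thesis using rb sb by (meson order_trans)
qed

lemma complex_solution_decay:
  fixes u w :: "real \<Rightarrow> complex"
  assumes u: "\<And>k. 0 \<le> k \<Longrightarrow> (u has_vector_derivative w k) (at k)"
    and w: "\<And>k. 0 \<le> k \<Longrightarrow> (w has_vector_derivative of_real (k - \<mu>) * u k) (at k)"
    and [measurable]: "u \<in> borel_measurable borel"
    and int: "in_L2 u" and c: "0 < c"
  shows "\<exists>C. \<forall>k\<ge>0. cmod (u k) \<le> C * exp (- c * k) \<and> cmod (w k) \<le> C * exp (- c * k)"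
proof -
  have "\<exists>C. \<forall>k\<ge>0. \<bar>Re (u k)\<bar> \<le> C * exp (- c * k) \<and> \<bar>Re (w k)\<bar> \<le> C * exp (- c * k)"
  proof (rule airy_L2_decay[OF _ _ _ c])
    show "((\<lambda>k. Re (u k)) has_real_derivative Re (w k)) (at k)" if "0 \<le> k" for k
      using bounded_linear.has_vector_derivative[OF bounded_linear_Re u[OF that]]
      by (simp add: has_real_derivative_iff_has_vector_derivative)
    show "((\<lambda>k. Re (w k)) has_real_derivative (k - \<mu>) * Re (u k)) (at k)" if "0 \<le> k" for k
      using bounded_linear.has_vector_derivative[OF bounded_linear_Re w[OF that]]
      by (simp add: has_real_derivative_iff_has_vector_derivative)
    show "integrable lborel (\<lambda>k. (Re (u k))\<^sup>2)"
      by (rule Bochner_Integration.integrable_bound[OF int]) (auto intro!: abs_le_square_iff[THEN iffD1] simp: abs_Re_le_cmod)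
  qed
  then obtain C1 where C1: "\<And>k. 0 \<le> k \<Longrightarrow> \<bar>Re (u k)\<bar> \<le> C1 * exp (- c * k) \<and> \<bar>Re (w k)\<bar> \<le> C1 * exp (- c * k)" by blast
  have "\<exists>C. \<forall>k\<ge>0. \<bar>Im (u k)\<bar> \<le> C * exp (- c * k) \<and> \<bar>Im (w k)\<bar> \<le> C * exp (- c * k)"
  proof (rule airy_L2_decay[OF _ _ _ c])
    show "((\<lambda>k. Im (u k)) has_real_derivative Im (w k)) (at k)" if "0 \<le> k" for k
      using bounded_linear.has_vector_derivative[OF bounded_linear_Im u[OF that]]
      by (simp add: has_real_derivative_iff_has_vector_derivative)
    show "((\<lambda>k. Im (w k)) has_real_derivative (k - \<mu>) * Im (u k)) (at k)" if "0 \<le> k" for k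
      using bounded_linear.has_vector_derivative[OF bounded_linear_Im w[OF that]]
      by (simp add: has_real_derivative_iff_has_vector_derivative)
    show "integrable lborel (\<lambda>k. (Im (u k))\<^sup>2)"
      by (rule Bochner_Integration.integrable_bound[OF int]) (auto intro!: abs_le_square_iff[THEN iffD1] simp: abs_Im_le_cmod)
  qed
  then obtain C2 where C2: "\<And>k. 0 \<le> k \<Longrightarrow> \<bar>Im (u k)\<bar> \<le> C2 * exp (- c * k) \<and> \<bar>Im (w k)\<bar> \<le> C2 * exp (- c * k)" by blast
  have "cmod (u k) \<le> (C1 + C2) * exp (- c * k) \<and> cmod (w k) \<le> (C1 + C2) * exp (- c * k)" if "0 \<le> k" for k
    using C1[OF that] C2[OF that] cmod_le[of "u k"] cmod_le[of "w k"] unfolding distrib_right by linarith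
  then show ?thesis by blast
qed

section \<open>Asymptotics of the transform of a solution\<close>

text \<open>Decay on the right half-line; decay on the left is expressed through the reflected function.\<close>

definition superexp_decay :: "(real \<Rightarrow> complex) \<Rightarrow> bool" where
  "superexp_decay f \<longleftrightarrow> (\<forall>c>0. \<exists>C. \<forall>k\<ge>0. cmod (f k) \<le> C * exp (- c * k))"

lemma superexp_decayD:
  assumes "superexp_decay f" "0 < c"
  obtains C where "0 \<le> C" "\<And>k. 0 \<le> k \<Longrightarrow> cmod (f k) \<le> C * exp (- c * k)"
proof -
  obtain C where C: "\<And>k. 0 \<le> k \<Longrightarrow> cmod (f k) \<le> C * exp (- c * k)" using assms unfolding superexp_decay_def by blast
  moreover have "0 \<le> C" using C[of 0] by (simp add: order_trans[OF norm_ge_zero])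
  ultimately show thesis using that by blast
qed

lemma superexp_decay_add:
  assumes "superexp_decay f" "superexp_decay g" shows "superexp_decay (\<lambda>k. f k + g k)"
  unfolding superexp_decay_def
proof (intro allI impI)
  fix c :: real assume c: "0 < c"
  obtain C D where C: "\<And>k. 0 \<le> k \<Longrightarrow> cmod (f k) \<le> C * exp (- c * k)" and D: "\<And>k. 0 \<le> k \<Longrightarrow> cmod (g k) \<le> D * exp (- c * k)"
    using superexp_decayD[OF assms(1) c] superexp_decayD[OF assms(2) c] by metis
  have "cmod (f k + g k) \<le> (C + D) * exp (- c * k)" if "0 \<le> k" for k
    using norm_triangle_ineq[of "f k" "g k"] C[OF that] D[OF that] unfolding distrib_right by linarith
  then show "\<exists>C. \<forall>k\<ge>0. cmod (f k + g k) \<le> C * exp (- c * k)" by blast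
qed

lemma superexp_decay_cmult:
  assumes "superexp_decay f" shows "superexp_decay (\<lambda>k. a * f k)"
  unfolding superexp_decay_def
proof (intro allI impI)
  fix c :: real assume c: "0 < c"
  obtain C where C: "\<And>k. 0 \<le> k \<Longrightarrow> cmod (f k) \<le> C * exp (- c * k)" using superexp_decayD[OF assms c] by metis
  have "cmod (a * f k) \<le> (cmod a * C) * exp (- c * k)" if "0 \<le> k" for k
    using mult_left_mono[OF C[OF that], of "cmod a"] by (simp add: norm_mult mult_ac)
  then show "\<exists>C. \<forall>k\<ge>0. cmod (a * f k) \<le> C * exp (- c * k)" by blast
qed

lemma superexp_decay_shift_mult:
  assumes "superexp_decay f" shows "superexp_decay (\<lambda>k. of_real (k - \<mu>) * f k)"
  unfolding superexp_decay_def
proof (intro allI impI)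
  fix c :: real assume c: "0 < c"
  then have c1: "0 < c + 1" by simp
  obtain C where C: "0 \<le> C" "\<And>k. 0 \<le> k \<Longrightarrow> cmod (f k) \<le> C * exp (- (c + 1) * k)" using superexp_decayD[OF assms c1] by metis
  have "cmod (of_real (k - \<mu>) * f k) \<le> ((1 + \<bar>\<mu>\<bar>) * C) * exp (- c * k)" if k: "0 \<le> k" for k
  proof -
    have "\<bar>k - \<mu>\<bar> \<le> (1 + k) * (1 + \<bar>\<mu>\<bar>)" 
    proof -
      have "\<bar>k - \<mu>\<bar> \<le> k + \<bar>\<mu>\<bar>" using k abs_triangle_ineq4[of k \<mu>] by simp
      moreover have "0 \<le> k * \<bar>\<mu>\<bar>" using k by simp
      ultimately show ?thesis by (simp add: algebra_simps)
    qed
    also have "\<dots> \<le> exp k * (1 + \<bar>\<mu>\<bar>)" using exp_ge_add_one_self[of k] by (intro mult_right_mono) auto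
    finally have "\<bar>k - \<mu>\<bar> * cmod (f k) \<le> (exp k * (1 + \<bar>\<mu>\<bar>)) * (C * exp (- (c + 1) * k))"
      by (intro mult_mono C k) auto
    also have "\<dots> = ((1 + \<bar>\<mu>\<bar>) * C) * (exp k * exp (- (c + 1) * k))" by simp
    also have "exp k * exp (- (c + 1) * k) = exp (- c * k)" by (simp add: algebra_simps flip: exp_add)
    finally show ?thesis by (simp add: norm_mult del: of_real_diff)
  qed
  then show "\<exists>C. \<forall>k\<ge>0. cmod (of_real (k - \<mu>) * f k) \<le> C * exp (- c * k)" by blast
qed

lemma integrable_exp_abs: "integrable lborel (\<lambda>k::real. exp (- \<bar>k\<bar>))"
proof (rule Bochner_Integration.integrable_bound[OF integrable_mult_right[OF integrable_inverse_square, of 2]])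
  show "AE k::real in lborel. norm (exp (- \<bar>k\<bar>)) \<le> norm (2 * (1 / (1 + \<bar>k\<bar>))\<^sup>2)"
  proof (rule AE_I2)
    fix k :: real
    have "(1 + \<bar>k\<bar>)\<^sup>2 \<le> 2 * exp \<bar>k\<bar>"
    proof -
      have "1 + \<bar>k\<bar> + \<bar>k\<bar>\<^sup>2 / 2 \<le> exp \<bar>k\<bar>" by (rule exp_lower_Taylor_quadratic) simp
      moreover have "(1 + \<bar>k\<bar>)\<^sup>2 = 1 + 2 * \<bar>k\<bar> + \<bar>k\<bar>\<^sup>2" by (simp add: power2_sum)
      ultimately show ?thesis by linarith
    qed
    then have "exp (- \<bar>k\<bar>) \<le> 2 / (1 + \<bar>k\<bar>)\<^sup>2" by (simp add: exp_minus field_simps)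
    then show "norm (exp (- \<bar>k\<bar>)) \<le> norm (2 * (1 / (1 + \<bar>k\<bar>))\<^sup>2)" by (simp add: power_divide)
  qed
qed measurable

text \<open>The two half-lines are transformed separately because \<open>u\<close> is smooth on each of them but not at 0.\<close>

definition half_fourier :: "(real \<Rightarrow> complex) \<Rightarrow> real \<Rightarrow> complex" where
  "half_fourier f y = (LINT k|lborel. indicator {0..} k *\<^sub>R (iexp (k * y) * f k))"

lemma superexp_decay_integrable:
  assumes r: "superexp_decay f" and m[measurable]: "f \<in> borel_measurable borel"
  shows "integrable lborel (\<lambda>k. indicator {0..} k *\<^sub>R (iexp (k * y) * f k))"
proof -
  obtain C where C: "0 \<le> C" "\<And>k. 0 \<le> k \<Longrightarrow> cmod (f k) \<le> C * exp (- 1 * k)" using superexp_decayD[OF r, of 1] by auto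
  show ?thesis
  proof (rule Bochner_Integration.integrable_bound[OF integrable_mult_right[OF integrable_exp_abs, of C]])
    show "AE k in lborel. cmod (indicator {0..} k *\<^sub>R (iexp (k * y) * f k)) \<le> norm (C * exp (- \<bar>k\<bar>))"
      using C by (intro AE_I2) (auto simp: norm_mult indicator_def)
  qed measurable
qed

lemma half_fourier_bound:
  assumes r: "superexp_decay f" and m: "f \<in> borel_measurable borel"
  shows "\<exists>B. \<forall>y. cmod (half_fourier f y) \<le> B"
proof -
  obtain C where C: "0 \<le> C" "\<And>k. 0 \<le> k \<Longrightarrow> cmod (f k) \<le> C * exp (- 1 * k)" using superexp_decayD[OF r, of 1] by auto
  have "cmod (half_fourier f y) \<le> (LINT k|lborel. C * exp (- \<bar>k\<bar>))" for y
  proof -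
    have "cmod (half_fourier f y) \<le> (LINT k|lborel. cmod (indicator {0..} k *\<^sub>R (iexp (k * y) * f k)))"
      unfolding half_fourier_def by (rule integral_norm_bound)
    also have "\<dots> \<le> (LINT k|lborel. C * exp (- \<bar>k\<bar>))"
      by (rule integral_mono'[OF integrable_mult_right[OF integrable_exp_abs]]) (use C in \<open>auto simp: norm_mult indicator_def\<close>)
    finally show ?thesis .
  qed
  then show ?thesis by blast
qed

lemma half_fourier_parts:
  assumes d: "\<And>k. 0 \<le> k \<Longrightarrow> (f has_vector_derivative f' k) (at k)"
    and c: "continuous_on UNIV f" and c': "continuous_on UNIV f'"
    and r: "superexp_decay f" and r': "superexp_decay f'" and y: "y \<noteq> 0"
  shows "half_fourier f y = (\<i> / of_real y) * (f 0 + half_fourier f' y)"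
proof -
  have [measurable]: "f \<in> borel_measurable borel" "f' \<in> borel_measurable borel"
    using c c' by (auto intro: borel_measurable_continuous_onI)
  let ?F = "\<lambda>k. iexp (k * y) * f k"
  let ?g = "\<lambda>k. iexp (k * y) * f' k + \<i> * of_real y * (iexp (k * y) * f k)"
  have dF: "(?F has_vector_derivative ?g k) (at k)" if "0 \<le> k" for k
    using has_vector_derivative_mult[OF iexp_has_vector_derivative[where x = y] d[OF that]] by (simp only: mult.assoc)
  have ci: "continuous_on S (\<lambda>k. iexp (k * y))" for S by (intro continuous_intros)
  have fin: "(LINT k|lborel. indicator {0..real n} k *\<^sub>R ?g k) = ?F (real n) - ?F 0" for n
  proof (rule integral_FTC_Icc)
    show "(?F has_vector_derivative ?g k) (at k within {0..real n})" if "0 \<le> k" for k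
      by (rule has_vector_derivative_at_within[OF dF[OF that]])
    show "continuous_on {0..real n} ?g"
      by (rule continuous_on_add[OF continuous_on_mult[OF ci continuous_on_subset[OF c' subset_UNIV]]
            continuous_on_mult[OF continuous_on_const continuous_on_mult[OF ci continuous_on_subset[OF c subset_UNIV]]]])
  qed simp
  have i: "integrable lborel (\<lambda>k. indicator {0..} k *\<^sub>R (iexp (k * y) * f k))" and i': "integrable lborel (\<lambda>k. indicator {0..} k *\<^sub>R (iexp (k * y) * f' k))"
    by (intro superexp_decay_integrable r r'; measurable)+
  have ig: "integrable lborel (\<lambda>k. indicator {0..} k *\<^sub>R ?g k)"
  proof -
    have "integrable lborel (\<lambda>k. indicator {0..} k *\<^sub>R (iexp (k * y) * f' k) + \<i> * of_real y * (indicator {0..} k *\<^sub>R (iexp (k * y) * f k)))"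
      by (intro Bochner_Integration.integrable_add i' integrable_mult_right i)
    then show ?thesis by (simp add: scaleR_add_right)
  qed
  have val: "(LINT k|lborel. indicator {0..} k *\<^sub>R ?g k) = half_fourier f' y + \<i> * of_real y * half_fourier f y"
  proof -
    have "(LINT k|lborel. indicator {0..} k *\<^sub>R ?g k) = (LINT k|lborel. indicator {0..} k *\<^sub>R (iexp (k * y) * f' k) + \<i> * of_real y * (indicator {0..} k *\<^sub>R (iexp (k * y) * f k)))"
      by (simp add: scaleR_add_right)
    also have "\<dots> = half_fourier f' y + \<i> * of_real y * half_fourier f y"
      unfolding half_fourier_def integral_mult_right_zero[symmetric]
      by (intro Bochner_Integration.integral_add i' integrable_mult_right i)
    finally show ?thesis .
  qed
  have lim1: "(\<lambda>n. LINT k|lborel. indicator {0..real n} k *\<^sub>R ?g k) \<longlonglongrightarrow> (LINT k|lborel. indicator {0..} k *\<^sub>R ?g k)"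
  proof (rule integral_dominated_convergence[where w = "\<lambda>k. norm (indicator {0..} k *\<^sub>R ?g k)"])
    show "AE k in lborel. (\<lambda>n. indicator {0..real n} k *\<^sub>R ?g k) \<longlonglongrightarrow> indicator {0..} k *\<^sub>R ?g k"
    proof (rule AE_I2)
      fix k
      have "\<forall>\<^sub>F n in sequentially. k \<le> real n"
        using filterlim_real_sequentially unfolding filterlim_at_top by blast
      then have "\<forall>\<^sub>F n in sequentially. indicator {0..} k *\<^sub>R ?g k = indicator {0..real n} k *\<^sub>R ?g k"
        by eventually_elim (auto simp: indicator_def)
      then show "(\<lambda>n. indicator {0..real n} k *\<^sub>R ?g k) \<longlonglongrightarrow> indicator {0..} k *\<^sub>R ?g k"
        by (rule Lim_transform_eventually[OF tendsto_const])
    qed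
    show "AE k in lborel. norm (indicator {0..real n} k *\<^sub>R ?g k) \<le> norm (indicator {0..} k *\<^sub>R ?g k)" for n
      by (intro AE_I2) (auto simp: indicator_def)
    show "integrable lborel (\<lambda>k. norm (indicator {0..} k *\<^sub>R ?g k))" by (rule integrable_norm[OF ig])
  qed measurable
  obtain C where C: "0 \<le> C" "\<And>k. 0 \<le> k \<Longrightarrow> cmod (f k) \<le> C * exp (- 1 * k)" using superexp_decayD[OF r, of 1] by auto
  have "(\<lambda>n. ?F (real n)) \<longlonglongrightarrow> 0"
  proof (rule Lim_null_comparison)
    show "\<forall>\<^sub>F n in sequentially. cmod (?F (real n)) \<le> C * exp (- real n)"
      using C(2) by (intro always_eventually allI) (auto simp: norm_mult)
    show "(\<lambda>n. C * exp (- real n)) \<longlonglongrightarrow> 0" by real_asymp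
  qed
  then have lim2: "(\<lambda>n. ?F (real n) - ?F 0) \<longlonglongrightarrow> 0 - ?F 0" by (intro tendsto_intros)
  have "half_fourier f' y + \<i> * of_real y * half_fourier f y = 0 - ?F 0"
    using LIMSEQ_unique[OF lim1[unfolded fin val] lim2] .
  then have "\<i> * of_real y * half_fourier f y = - (f 0 + half_fourier f' y)" by (simp add: algebra_simps add_eq_0_iff2)
  then have "(\<i> / of_real y) * (\<i> * of_real y * half_fourier f y) = - ((\<i> / of_real y) * (f 0 + half_fourier f' y))"
    by (simp only: mult_minus_right)
  moreover have "(\<i> / of_real y) * (\<i> * of_real y * half_fourier f y) = - half_fourier f y"
    using y by (simp add: mult.assoc[symmetric])
  ultimately show ?thesis by (simp only: neg_equal_iff_equal)
qed

text \<open>The one-sided derivatives of order 0 to 4 at 0 of a solution of \<open>u'' = (k - \<mu>) u\<close> with \<open>u 0 = a\<close> and \<open>u' 0 = b\<close>, namely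
  \<open>a, b, - \<mu> a, a - \<mu> b, 2 b + \<mu>\<^sup>2 a\<close>, each weighted by the power of \<open>e = \<i> / y\<close> with which repeated
  integration by parts produces it.\<close>

definition kink_expansion :: "real \<Rightarrow> complex \<Rightarrow> complex \<Rightarrow> complex \<Rightarrow> complex" where
  "kink_expansion \<mu> a b e = e * a + e ^ 2 * b - e ^ 3 * of_real \<mu> * a
     + e ^ 4 * (a - of_real \<mu> * b) + e ^ 5 * (2 * b + of_real \<mu> ^ 2 * a)"

text \<open>Six integrations by parts, the last one giving the error term. The successive derivatives of \<open>u\<close> are
  polynomial combinations of \<open>u\<close> and \<open>w = u'\<close>, hence still decay and stay integrable.\<close>

lemma half_fourier_airy_expansion:
  fixes u w :: "real \<Rightarrow> complex" and \<mu> :: real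
  assumes u: "\<And>k. 0 \<le> k \<Longrightarrow> (u has_vector_derivative w k) (at k)"
    and w: "\<And>k. 0 \<le> k \<Longrightarrow> (w has_vector_derivative of_real (k - \<mu>) * u k) (at k)"
    and cu: "continuous_on UNIV u" and cw: "continuous_on UNIV w"
    and ru: "superexp_decay u" and rw: "superexp_decay w"
  shows "\<exists>R. \<forall>y. y \<noteq> 0 \<longrightarrow> (\<forall>e. e = \<i> / of_real y \<longrightarrow>
    cmod (half_fourier u y - kink_expansion \<mu> (u 0) (w 0) e) \<le> R / \<bar>y\<bar> ^ 6)"
proof -
  define p where "p = (\<lambda>k. complex_of_real (k - \<mu>))"
  have dp: "(p has_vector_derivative 1) (at k)" for k
    unfolding p_def by (auto intro!: derivative_eq_intros)
  have cp: "continuous_on UNIV p" unfolding p_def by (intro continuous_intros)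
  have rp: "superexp_decay (\<lambda>k. p k * f k)" if "superexp_decay f" for f unfolding p_def by (rule superexp_decay_shift_mult[OF that])
  have w': "(w has_vector_derivative p k * u k) (at k)" if "0 \<le> k" for k using w[OF that] unfolding p_def .
  define f2 f3 f4 f5 f6 where "f2 = (\<lambda>k. p k * u k)" and "f3 = (\<lambda>k. u k + p k * w k)"
    and "f4 = (\<lambda>k. 2 * w k + p k * (p k * u k))" and "f5 = (\<lambda>k. 4 * (p k * u k) + p k * (p k * w k))"
    and "f6 = (\<lambda>k. 4 * u k + (6 * (p k * w k) + p k * (p k * (p k * u k))))"
  have c: "continuous_on UNIV f2" "continuous_on UNIV f3" "continuous_on UNIV f4" "continuous_on UNIV f5" "continuous_on UNIV f6"
    unfolding f2_def f3_def f4_def f5_def f6_def by (intro continuous_intros cu cw cp)+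
  have r: "superexp_decay f2" "superexp_decay f3" "superexp_decay f4" "superexp_decay f5" "superexp_decay f6"
    unfolding f2_def f3_def f4_def f5_def f6_def by (intro superexp_decay_add superexp_decay_cmult rp ru rw)+
  have d2: "(w has_vector_derivative f2 k) (at k)" if "0 \<le> k" for k using w'[OF that] unfolding f2_def .
  have d3: "(f2 has_vector_derivative f3 k) (at k)" if "0 \<le> k" for k
    using has_vector_derivative_mult[OF dp[of k] u[OF that]] unfolding f2_def f3_def by (simp add: algebra_simps)
  have d4: "(f3 has_vector_derivative f4 k) (at k)" if "0 \<le> k" for k
    using has_vector_derivative_add[OF u[OF that] has_vector_derivative_mult[OF dp[of k] w'[OF that]]]
    unfolding f3_def f4_def by (simp add: algebra_simps)
  have d5: "(f4 has_vector_derivative f5 k) (at k)" if "0 \<le> k" for k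
    using has_vector_derivative_add[OF has_vector_derivative_mult[OF has_vector_derivative_const w'[OF that], of 2]
        has_vector_derivative_mult[OF dp[of k] has_vector_derivative_mult[OF dp[of k] u[OF that]]]]
    unfolding f4_def f5_def by (simp add: algebra_simps)
  have d6: "(f5 has_vector_derivative f6 k) (at k)" if "0 \<le> k" for k
    using has_vector_derivative_add[OF has_vector_derivative_mult[OF has_vector_derivative_const has_vector_derivative_mult[OF dp[of k] u[OF that]], of 4]
        has_vector_derivative_mult[OF dp[of k] has_vector_derivative_mult[OF dp[of k] w'[OF that]]]]
    unfolding f5_def f6_def by (simp add: algebra_simps)
  have "f6 \<in> borel_measurable borel" using c(5) by (rule borel_measurable_continuous_onI)
  from half_fourier_bound[OF r(5) this] obtain B where B: "\<And>y. cmod (half_fourier f6 y) \<le> B" by blast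
  have "cmod (half_fourier u y - kink_expansion \<mu> (u 0) (w 0) e) \<le> (cmod (f5 0) + B) / \<bar>y\<bar> ^ 6"
    if y: "y \<noteq> 0" and e: "e = \<i> / of_real y" for y e
  proof -
    have ex: "half_fourier u y = e * (u 0 + e * (w 0 + e * (f2 0 + e * (f3 0 + e * (f4 0 + e * (f5 0 + half_fourier f6 y))))))"
      unfolding e
      using half_fourier_parts[OF u cu cw ru rw y] half_fourier_parts[OF d2 cw c(1) rw r(1) y]
        half_fourier_parts[OF d3 c(1,2) r(1,2) y] half_fourier_parts[OF d4 c(2,3) r(2,3) y]
        half_fourier_parts[OF d5 c(3,4) r(3,4) y] half_fourier_parts[OF d6 c(4,5) r(4,5) y] by simp
    have v: "f2 0 = - of_real \<mu> * u 0" "f3 0 = u 0 - of_real \<mu> * w 0" "f4 0 = 2 * w 0 + of_real \<mu> ^ 2 * u 0"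
      unfolding f2_def f3_def f4_def p_def by (simp_all add: power2_eq_square)
    have "half_fourier u y - kink_expansion \<mu> (u 0) (w 0) e = e ^ 6 * (f5 0 + half_fourier f6 y)"
      unfolding ex v kink_expansion_def by (simp add: algebra_simps eval_nat_numeral)
    then have "cmod (half_fourier u y - kink_expansion \<mu> (u 0) (w 0) e) = cmod (f5 0 + half_fourier f6 y) / \<bar>y\<bar> ^ 6"
      unfolding e by (simp add: norm_mult norm_power norm_divide power_divide)
    also have "\<dots> \<le> (cmod (f5 0) + B) / \<bar>y\<bar> ^ 6"
      using norm_triangle_ineq[of "f5 0" "half_fourier f6 y"] B[of y] by (intro divide_right_mono) auto
    finally show ?thesis .
  qed
  then show ?thesis by blast
qed

lemma has_vector_derivative_reflect:
  fixes f :: "real \<Rightarrow> complex"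
  assumes "(f has_vector_derivative D) (at (- k))"
  shows "((\<lambda>k. f (- k)) has_vector_derivative - D) (at k)"
proof -
  have "((\<lambda>k. - k) has_vector_derivative - 1) (at k)" for k :: real
    by (rule has_vector_derivative_minus[OF has_vector_derivative_id])
  from vector_diff_chain_at[OF this assms] show ?thesis by (simp add: o_def)
qed

text \<open>Reflecting the left half-line replaces \<open>u' 0\<close> by \<open>- u' 0\<close> and \<open>e\<close> by \<open>- e\<close>. The orders 1 to 3 of the two
  expansions cancel, as \<open>u\<close> is twice continuously differentiable; the jumps \<open>2 u 0\<close> of \<open>u'''\<close> and \<open>4 u' 0\<close> of
  \<open>u''''\<close> survive. So \<open>y\<^sup>4 fourier u y\<close> equals \<open>2 u 0 + 4 \<i> u' 0 / y\<close> up to \<open>O(1 / y\<^sup>2)\<close>, which is nonzero for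
  large \<open>y\<close> unless both initial data vanish.\<close>

lemma airy_transform_zeros_bounded:
  fixes u w :: "real \<Rightarrow> complex" and \<mu> :: real
  assumes u: "\<And>k. (u has_vector_derivative w k) (at k)"
    and w: "\<And>k. (w has_vector_derivative of_real (\<bar>k\<bar> - \<mu>) * u k) (at k)"
    and r: "superexp_decay u" "superexp_decay w" "superexp_decay (\<lambda>k. u (- k))" "superexp_decay (\<lambda>k. - w (- k))"
    and nz: "u 0 \<noteq> 0 \<or> w 0 \<noteq> 0"
  shows "\<exists>Y. \<forall>y. fourier u y = 0 \<longrightarrow> \<bar>y\<bar> \<le> Y"
proof -
  have cu: "continuous_on UNIV u" and cw: "continuous_on UNIV w"
    using u w by (meson continuous_at_imp_continuous_on has_vector_derivative_continuous)+
  define um wm where "um = (\<lambda>k. u (- k))" and "wm = (\<lambda>k. - w (- k))"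
  have [measurable]: "u \<in> borel_measurable borel" "um \<in> borel_measurable borel"
    unfolding um_def by (auto intro!: borel_measurable_continuous_onI cu continuous_on_compose2[OF cu] continuous_intros)
  have um: "(um has_vector_derivative wm k) (at k)" for k
    unfolding um_def wm_def by (rule has_vector_derivative_reflect[OF u])
  have wm: "(wm has_vector_derivative of_real (k - \<mu>) * um k) (at k)" if "0 \<le> k" for k
  proof -
    have "((\<lambda>k. w (- k)) has_vector_derivative - (of_real (\<bar>- k\<bar> - \<mu>) * u (- k))) (at k)"
      by (rule has_vector_derivative_reflect[OF w])
    from has_vector_derivative_minus[OF this] show ?thesis using that unfolding um_def wm_def by simp
  qed
  have cum: "continuous_on UNIV um" and cwm: "continuous_on UNIV wm"
    unfolding um_def wm_def by (auto intro!: continuous_intros continuous_on_compose2[OF cu] continuous_on_compose2[OF cw])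
  have split: "fourier u y = half_fourier u y + half_fourier um (- y)" for y
  proof -
    have i: "integrable lborel (\<lambda>k. indicator {0..} k *\<^sub>R (iexp (k * y) * u k))" "integrable lborel (\<lambda>k. indicator {0..} k *\<^sub>R (iexp (k * (- y)) * um k))"
      by (intro superexp_decay_integrable r r(3)[folded um_def]; measurable)+
    have i': "integrable lborel (\<lambda>k. indicator {..0} k *\<^sub>R (iexp (k * y) * u k))"
      and v': "half_fourier um (- y) = (LINT k|lborel. indicator {..0} k *\<^sub>R (iexp (k * y) * u k))"
    proof -
      have eq: "indicator {0..} (- k) *\<^sub>R (iexp ((- k) * (- y)) * um (- k)) = indicator {..0} k *\<^sub>R (iexp (k * y) * u k)" for k
        unfolding um_def by (simp add: indicator_def)
      show "integrable lborel (\<lambda>k. indicator {..0} k *\<^sub>R (iexp (k * y) * u k))"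
        using lborel_integrable_real_affine[OF i(2), of "-1" 0] unfolding eq[symmetric] by simp
      show "half_fourier um (- y) = (LINT k|lborel. indicator {..0} k *\<^sub>R (iexp (k * y) * u k))"
        unfolding half_fourier_def eq[symmetric]
        using lborel_integral_real_affine[of "-1" "\<lambda>k. indicator {0..} k *\<^sub>R (iexp (k * (- y)) * um k)" 0] by simp
    qed
    have "half_fourier u y + half_fourier um (- y) = (LINT k|lborel. indicator {0..} k *\<^sub>R (iexp (k * y) * u k) + indicator {..0} k *\<^sub>R (iexp (k * y) * u k))"
      unfolding v' unfolding half_fourier_def by (rule Bochner_Integration.integral_add[symmetric, OF i(1) i'])
    also have "\<dots> = fourier u y"
      unfolding fourier_def
    proof (rule integral_cong_AE)
      have "AE k::real in lborel. k \<noteq> 0" by (rule AE_lborel_singleton)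
      then show "AE k in lborel. indicator {0..} k *\<^sub>R (iexp (k * y) * u k) + indicator {..0} k *\<^sub>R (iexp (k * y) * u k) = iexp (k * y) * u k"
        by eventually_elim (auto simp: indicator_def)
    qed measurable
    finally show ?thesis ..
  qed
  obtain R1 where R1: "\<And>y. y \<noteq> 0 \<Longrightarrow> cmod (half_fourier u y - kink_expansion \<mu> (u 0) (w 0) (\<i> / of_real y)) \<le> R1 / \<bar>y\<bar> ^ 6"
    using half_fourier_airy_expansion[of u w \<mu>] u w cu cw r(1,2) by (metis abs_of_nonneg)
  obtain R2 where R2: "\<And>y. y \<noteq> 0 \<Longrightarrow> cmod (half_fourier um y - kink_expansion \<mu> (um 0) (wm 0) (\<i> / of_real y)) \<le> R2 / \<bar>y\<bar> ^ 6"
    using half_fourier_airy_expansion[of um wm \<mu>] um wm cum cwm r(3,4) unfolding um_def wm_def by metis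
  have main: "cmod (2 * u 0 + 4 * (\<i> / of_real y) * w 0) \<le> (R1 + R2) / y\<^sup>2" if z: "fourier u y = 0" and y: "y \<noteq> 0" for y
  proof -
    define e where "e = \<i> / complex_of_real y"
    define S1 where "S1 = kink_expansion \<mu> (u 0) (w 0) e"
    define S2 where "S2 = kink_expansion \<mu> (um 0) (wm 0) (- e)"
    have 1: "cmod (half_fourier u y - S1) \<le> R1 / \<bar>y\<bar> ^ 6" using R1[OF y] unfolding S1_def e_def .
    have me: "- e = \<i> / of_real (- y)" unfolding e_def by simp
    have 2: "cmod (half_fourier um (- y) - S2) \<le> R2 / \<bar>y\<bar> ^ 6" using R2[of "- y"] y unfolding S2_def me by simp
    have "S1 + S2 = e ^ 4 * (2 * u 0 + 4 * e * w 0)"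
      unfolding S1_def S2_def kink_expansion_def um_def wm_def by (simp add: algebra_simps eval_nat_numeral)
    then have "e ^ 4 * (2 * u 0 + 4 * e * w 0) = - ((half_fourier u y - S1) + (half_fourier um (- y) - S2))"
      using z split[of y] by (simp add: algebra_simps)
    then have "cmod (e ^ 4 * (2 * u 0 + 4 * e * w 0)) \<le> (R1 + R2) / \<bar>y\<bar> ^ 6"
      using norm_triangle_ineq[of "half_fourier u y - S1" "half_fourier um (- y) - S2"] 1 2
      by (simp add: add_divide_distrib del: minus_add_distrib)
    then have "cmod (2 * u 0 + 4 * e * w 0) / \<bar>y\<bar> ^ 4 \<le> (R1 + R2) / \<bar>y\<bar> ^ 6"
      unfolding e_def by (simp add: norm_mult norm_power norm_divide power_divide)
    then have "cmod (2 * u 0 + 4 * e * w 0) / \<bar>y\<bar> ^ 4 * \<bar>y\<bar> ^ 4 \<le> (R1 + R2) / \<bar>y\<bar> ^ 6 * \<bar>y\<bar> ^ 4"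
      by (intro mult_right_mono) auto
    also have "(R1 + R2) / \<bar>y\<bar> ^ 6 * \<bar>y\<bar> ^ 4 = (R1 + R2) / y\<^sup>2"
      using y by (simp add: power_eq_if field_simps)
    finally show ?thesis using y unfolding e_def by simp
  qed
  define R where "R = \<bar>R1 + R2\<bar>"
  show ?thesis
  proof (cases "u 0 = 0")
    case True
    then have b: "w 0 \<noteq> 0" using nz by simp
    have "\<bar>y\<bar> \<le> R / (4 * cmod (w 0))" if z: "fourier u y = 0" for y
    proof (cases "y = 0")
      case False
      have "4 * cmod (w 0) / \<bar>y\<bar> \<le> (R1 + R2) / y\<^sup>2"
        using main[OF z False] True by (simp add: norm_mult norm_divide)
      also have "\<dots> \<le> R / y\<^sup>2" unfolding R_def by (intro divide_right_mono) auto
      finally have "4 * cmod (w 0) / \<bar>y\<bar> \<le> R / \<bar>y\<bar>\<^sup>2" by simp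
      moreover obtain z where z: "z = \<bar>y\<bar>" "0 < z" using False by auto
      ultimately have "4 * cmod (w 0) / z * z\<^sup>2 \<le> R / z\<^sup>2 * z\<^sup>2" by (intro mult_right_mono) auto
      then have "4 * cmod (w 0) * \<bar>y\<bar> \<le> R" using z(2) unfolding z(1)[symmetric] by (simp add: power2_eq_square)
      then show ?thesis using b by (simp add: le_divide_eq mult.commute)
    qed (use R_def in auto)
    then show ?thesis by blast
  next
    case False
    define Y where "Y = max 1 ((R + 4 * cmod (w 0)) / (2 * cmod (u 0)))"
    have "\<bar>y\<bar> \<le> Y" if z: "fourier u y = 0" for y
    proof (cases "\<bar>y\<bar> \<le> 1")
      case False
      then have y: "y \<noteq> 0" "1 < \<bar>y\<bar>" by auto
      have "2 * cmod (u 0) = cmod ((2 * u 0 + 4 * (\<i> / of_real y) * w 0) - 4 * (\<i> / of_real y) * w 0)"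
        by (simp add: norm_mult)
      also have "\<dots> \<le> (R1 + R2) / y\<^sup>2 + 4 * cmod (w 0) / \<bar>y\<bar>"
        using norm_triangle_ineq4[of "2 * u 0 + 4 * (\<i> / of_real y) * w 0" "4 * (\<i> / of_real y) * w 0"] main[OF z y(1)]
        by (simp add: norm_mult norm_divide)
      also have "(R1 + R2) / y\<^sup>2 \<le> R / \<bar>y\<bar>"
      proof -
        have "(R1 + R2) / y\<^sup>2 \<le> R / y\<^sup>2" unfolding R_def by (intro divide_right_mono) auto
        also have "\<dots> \<le> R / \<bar>y\<bar>"
        proof (rule divide_left_mono)
          show "\<bar>y\<bar> \<le> y\<^sup>2" using y(2) mult_left_mono[of 1 "\<bar>y\<bar>" "\<bar>y\<bar>"] by (simp add: power2_eq_square)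
        qed (use y R_def in auto)
        finally show ?thesis .
      qed
      finally have "2 * cmod (u 0) \<le> (R + 4 * cmod (w 0)) / \<bar>y\<bar>" by (simp add: add_divide_distrib)
      then have "\<bar>y\<bar> \<le> (R + 4 * cmod (w 0)) / (2 * cmod (u 0))"
        using \<open>u 0 \<noteq> 0\<close> y by (simp add: field_simps)
      then show ?thesis unfolding Y_def by simp
    qed (simp add: Y_def)
    then show ?thesis by blast
  qed
qed

section \<open>Zeros and inversion of the transform\<close>

lemma complex_solution_superexp_decay:
  fixes u w :: "real \<Rightarrow> complex"
  assumes "\<And>k. 0 \<le> k \<Longrightarrow> (u has_vector_derivative w k) (at k)"
    and "\<And>k. 0 \<le> k \<Longrightarrow> (w has_vector_derivative of_real (k - \<mu>) * u k) (at k)"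
    and "u \<in> borel_measurable borel" and "in_L2 u"
  shows "superexp_decay u" "superexp_decay w"
proof -
  have "\<exists>C. \<forall>k\<ge>0. cmod (u k) \<le> C * exp (- c * k) \<and> cmod (w k) \<le> C * exp (- c * k)" if "0 < c" for c
    by (rule complex_solution_decay[OF assms that])
  then show "superexp_decay u" "superexp_decay w" unfolding superexp_decay_def by meson+
qed

lemma two_sided_bound:
  assumes "superexp_decay u" "superexp_decay (\<lambda>k. u (- k))" "0 < c"
  obtains C where "0 \<le> C" "\<And>k. cmod (u k) \<le> C * exp (- c * \<bar>k\<bar>)"
proof -
  obtain C1 where C1: "0 \<le> C1" "\<And>k. 0 \<le> k \<Longrightarrow> cmod (u k) \<le> C1 * exp (- c * k)" using superexp_decayD[OF assms(1,3)] by metis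
  obtain C2 where C2: "0 \<le> C2" "\<And>k. 0 \<le> k \<Longrightarrow> cmod (u (- k)) \<le> C2 * exp (- c * k)" using superexp_decayD[OF assms(2,3)] by metis
  have "cmod (u k) \<le> (C1 + C2) * exp (- c * \<bar>k\<bar>)" for k
  proof (cases "0 \<le> k")
    case True
    have "0 \<le> C2 * exp (- c * k)" using C2(1) by simp
    then show ?thesis using C1(2)[OF True] True unfolding distrib_right by simp
  next
    case False
    have "0 \<le> C1 * exp (c * k)" using C1(1) by simp
    then show ?thesis using C2(2)[of "- k"] False unfolding distrib_right by simp
  qed
  then show thesis using that[of "C1 + C2"] C1(1) C2(1) by simp
qed

lemma integrable_exp_weight:
  fixes u :: "real \<Rightarrow> complex"
  assumes r: "superexp_decay u" "superexp_decay (\<lambda>k. u (- k))" and [measurable]: "u \<in> borel_measurable borel"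
  shows "integrable lborel (\<lambda>k. exp (\<bar>k\<bar> * a) * cmod (u k))"
proof -
  have "0 < \<bar>a\<bar> + 1" by simp
  from two_sided_bound[OF r this] obtain C where C: "0 \<le> C" "\<And>k. cmod (u k) \<le> C * exp (- (\<bar>a\<bar> + 1) * \<bar>k\<bar>)" by metis
  show ?thesis
  proof (rule Bochner_Integration.integrable_bound[OF integrable_mult_right[OF integrable_exp_abs, of C]])
    show "AE k in lborel. norm (exp (\<bar>k\<bar> * a) * cmod (u k)) \<le> norm (C * exp (- \<bar>k\<bar>))"
    proof (rule AE_I2)
      fix k :: real
      have "exp (\<bar>k\<bar> * a) * cmod (u k) \<le> exp (\<bar>k\<bar> * \<bar>a\<bar>) * (C * exp (- (\<bar>a\<bar> + 1) * \<bar>k\<bar>))"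
        by (intro mult_mono C) (auto intro!: mult_left_mono)
      also have "\<dots> = C * (exp (\<bar>k\<bar> * \<bar>a\<bar>) * exp (- (\<bar>a\<bar> + 1) * \<bar>k\<bar>))" by simp
      also have "exp (\<bar>k\<bar> * \<bar>a\<bar>) * exp (- (\<bar>a\<bar> + 1) * \<bar>k\<bar>) = exp (- \<bar>k\<bar>)" by (simp add: algebra_simps flip: exp_add)
      finally show "norm (exp (\<bar>k\<bar> * a) * cmod (u k)) \<le> norm (C * exp (- \<bar>k\<bar>))" using C(1) by simp
    qed
  qed measurable
qed

lemma fourier_power_series:
  fixes u :: "real \<Rightarrow> complex"
  assumes r: "superexp_decay u" "superexp_decay (\<lambda>k. u (- k))" and [measurable]: "u \<in> borel_measurable borel"
  shows "(\<lambda>n. (LINT k|lborel. (\<i> * of_real k) ^ n / fact n * u k) * of_real y ^ n) sums fourier u y"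
proof -
  define f where "f = (\<lambda>n k. (\<i> * of_real (k * y)) ^ n / fact n * u k)"
  have e: "integrable lborel (\<lambda>k. exp (\<bar>k\<bar> * \<bar>y\<bar>) * cmod (u k))" by (rule integrable_exp_weight[OF r]) measurable
  have nf: "norm (f n k) = (\<bar>k\<bar> * \<bar>y\<bar>) ^ n / fact n * cmod (u k)" for n k
    unfolding f_def by (simp add: norm_mult norm_power norm_divide abs_mult power_mult_distrib)
  have es: "(\<lambda>n. (\<bar>k\<bar> * \<bar>y\<bar>) ^ n / fact n) sums exp (\<bar>k\<bar> * \<bar>y\<bar>)" for k
    using exp_converges[of "\<bar>k\<bar> * \<bar>y\<bar>"] by (simp add: scaleR_conv_of_real divide_inverse mult.commute)
  have part: "(\<Sum>i<n. norm (f i k)) \<le> exp (\<bar>k\<bar> * \<bar>y\<bar>) * cmod (u k)" for n k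
  proof -
    have "(\<Sum>i<n. (\<bar>k\<bar> * \<bar>y\<bar>) ^ i / fact i) \<le> exp (\<bar>k\<bar> * \<bar>y\<bar>)"
      using sum_le_suminf[OF sums_summable[OF es[of k]], of "{..<n}"] sums_unique[OF es[of k]] by simp
    then show ?thesis unfolding nf sum_distrib_right[symmetric] by (rule mult_right_mono) simp
  qed
  have fm[measurable]: "f n \<in> borel_measurable borel" for n unfolding f_def by measurable
  have fi: "integrable lborel (f n)" for n
  proof (rule Bochner_Integration.integrable_bound[OF e])
    have "norm (f n k) \<le> exp (\<bar>k\<bar> * \<bar>y\<bar>) * cmod (u k)" for k
      using part[of k "Suc n"] sum_nonneg[of "{..<n}" "\<lambda>i. norm (f i k)"] by simp
    then show "AE k in lborel. norm (f n k) \<le> norm (exp (\<bar>k\<bar> * \<bar>y\<bar>) * cmod (u k))" by simp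
  qed measurable
  have s1: "AE k in lborel. summable (\<lambda>n. norm (f n k))"
    unfolding nf by (intro AE_I2 summable_mult2 sums_summable[OF es])
  have s2: "summable (\<lambda>n. LINT k|lborel. norm (f n k))"
  proof (rule summableI_nonneg_bounded)
    show "(\<Sum>i<n. LINT k|lborel. norm (f i k)) \<le> (LINT k|lborel. exp (\<bar>k\<bar> * \<bar>y\<bar>) * cmod (u k))" for n
    proof -
      have "(\<Sum>i<n. LINT k|lborel. norm (f i k)) = (LINT k|lborel. (\<Sum>i<n. norm (f i k)))"
        using fi by (subst Bochner_Integration.integral_sum) auto
      also have "\<dots> \<le> (LINT k|lborel. exp (\<bar>k\<bar> * \<bar>y\<bar>) * cmod (u k))"
        using fi part by (intro integral_mono e) auto
      finally show ?thesis .
    qed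
  qed simp
  have "(\<lambda>n. LINT k|lborel. f n k) sums (LINT k|lborel. (\<Sum>n. f n k))"
    by (rule sums_integral[OF fi s1 s2])
  also have "(LINT k|lborel. (\<Sum>n. f n k)) = fourier u y"
    unfolding fourier_def
  proof (rule Bochner_Integration.integral_cong[OF refl])
    fix k
    have "(\<lambda>n. (\<i> * of_real (k * y)) ^ n / fact n) sums iexp (k * y)"
      using exp_converges[of "\<i> * of_real (k * y)"] by (simp add: scaleR_conv_of_real divide_inverse mult.commute)
    from sums_mult2[OF this, of "u k"] show "(\<Sum>n. f n k) = iexp (k * y) * u k"
      unfolding f_def by (rule sums_unique[symmetric])
  qed
  also have "(\<lambda>n. LINT k|lborel. f n k) = (\<lambda>n. (LINT k|lborel. (\<i> * of_real k) ^ n / fact n * u k) * of_real y ^ n)"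
  proof
    fix n
    have "f n k = ((\<i> * of_real k) ^ n / fact n * u k) * of_real y ^ n" for k
      unfolding f_def by (simp add: power_mult_distrib)
    then show "(LINT k|lborel. f n k) = (LINT k|lborel. (\<i> * of_real k) ^ n / fact n * u k) * of_real y ^ n" by simp
  qed
  finally show ?thesis .
qed

text \<open>The power series makes the transform the restriction of an entire function, whose zeros cannot
  accumulate on a bounded set.\<close>

lemma fourier_finite_zeros:
  fixes u :: "real \<Rightarrow> complex"
  assumes r: "superexp_decay u" "superexp_decay (\<lambda>k. u (- k))" and m: "u \<in> borel_measurable borel"
    and bd: "\<And>y. fourier u y = 0 \<Longrightarrow> \<bar>y\<bar> \<le> Y" and nz: "\<exists>y. fourier u y \<noteq> 0"
  shows "finite {y. fourier u y = 0}"
proof (rule ccontr)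
  assume inf: "infinite {y. fourier u y = 0}"
  define c where "c = (\<lambda>n. LINT k|lborel. (\<i> * of_real k) ^ n / fact n * u k)"
  have ser: "(\<lambda>n. c n * of_real y ^ n) sums fourier u y" for y
    unfolding c_def by (rule fourier_power_series[OF r m])
  have summ: "summable (\<lambda>n. c n * z ^ n)" for z
    by (rule powser_inside[of c "of_real (norm z + 1)"]) (use sums_summable[OF ser[of "norm z + 1"]] in auto)
  define F where "F = (\<lambda>z. \<Sum>n. c n * z ^ n)"
  have F: "F (of_real y) = fourier u y" for y unfolding F_def using sums_unique[OF ser[of y]] by simp
  have "(F has_field_derivative (\<Sum>n. diffs c n * z ^ n)) (at z)" for z
    unfolding F_def by (rule termdiffs_strong_converges_everywhere[OF summ])
  then have hol: "F holomorphic_on UNIV" by (auto simp: holomorphic_on_open)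
  define Z where "Z = complex_of_real ` {y. fourier u y = 0}"
  have "infinite Z" unfolding Z_def using inf by (simp add: finite_image_iff inj_on_def)
  moreover have "Z \<subseteq> cball 0 Y" unfolding Z_def using bd by auto
  ultimately obtain \<xi> where \<xi>: "\<xi> islimpt Z"
    using Heine_Borel_imp_Bolzano_Weierstrass[OF compact_cball] by blast
  have "F z = 0" if "z \<in> Z" for z using that F unfolding Z_def by auto
  from analytic_continuation[OF hol open_UNIV connected_UNIV subset_UNIV UNIV_I \<xi> this UNIV_I]
  have "F z = 0" for z .
  then show False using nz F by metis
qed

definition cutoff :: "nat \<Rightarrow> real \<Rightarrow> real" where
  "cutoff n k = max 0 (min 1 (real n + 1 - \<bar>k\<bar>))"

lemma cutoff_range: "0 \<le> cutoff n k" "cutoff n k \<le> 1" unfolding cutoff_def by auto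

lemma cutoff_measurable [measurable]: "cutoff n \<in> borel_measurable borel"
  unfolding cutoff_def by measurable

lemma cutoff_lim: "(\<lambda>n. cutoff n k) \<longlonglongrightarrow> 1"
proof -
  have "\<forall>\<^sub>F n in sequentially. \<bar>k\<bar> \<le> real n"
    using filterlim_real_sequentially unfolding filterlim_at_top by blast
  then have "\<forall>\<^sub>F n in sequentially. 1 = cutoff n k" by eventually_elim (simp add: cutoff_def)
  then show ?thesis by (rule Lim_transform_eventually[OF tendsto_const])
qed

lemma cutoff_mult:
  assumes "loc_lipschitz f"
  shows "loc_lipschitz (\<lambda>k. of_real (cutoff n k) * f k)" "compact_supp (\<lambda>k. of_real (cutoff n k) * f k)"
proof -
  show "loc_lipschitz (\<lambda>k. of_real (cutoff n k) * f k)"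
    by (intro loc_lipschitz_mult loc_lipschitz_of_real assms) (auto simp: cutoff_def max_def min_def abs_if)
  have "of_real (cutoff n k) * f k = 0" if "real n + 1 < \<bar>k\<bar>" for k using that unfolding cutoff_def by simp
  then show "compact_supp (\<lambda>k. of_real (cutoff n k) * f k)" unfolding compact_supp_def by blast
qed

text \<open>The function \<open>u\<close> is the Fourier transform of \<open>\<phi>\<close> in the sense of distributions, by duality with the
  multiplication formula; \<open>\<phi>\<close> need not be integrable and \<open>u\<close> may a priori grow.\<close>

definition distributional_transform :: "(real \<Rightarrow> complex) \<Rightarrow> (real \<Rightarrow> complex) \<Rightarrow> bool" where
  "distributional_transform u \<phi> \<longleftrightarrow> (\<forall>g. loc_lipschitz g \<longrightarrow> compact_supp g \<longrightarrow>
     (LINT x|lborel. \<phi> x * fourier g x) = (LINT k|lborel. u k * g k))"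

text \<open>Testing against \<open>cutoff n * cnj u\<close> bounds the integral of \<open>cutoff n * \<bar>u\<bar>\<^sup>2\<close> by its own square root
  times the constant of the Plancherel bound, uniformly in \<open>n\<close>.\<close>

lemma distributional_transform_in_L2:
  assumes [measurable]: "\<phi> \<in> borel_measurable lborel" and \<phi>2: "in_L2 \<phi>"
    and rep: "distributional_transform u \<phi>" and lu: "loc_lipschitz u"
  shows "in_L2 u"
proof -
  have cu: "continuous_on UNIV u" by (rule loc_lipschitz_imp_continuous[OF lu])
  have [measurable]: "u \<in> borel_measurable borel" by (rule borel_measurable_continuous_onI[OF cu])
  have lcu: "loc_lipschitz (\<lambda>k. cnj (u k))"
    using lu unfolding loc_lipschitz_def lipschitz_on_def by (simp add: dist_norm flip: complex_cnj_diff)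
  define K where "K = sqrt (2 * pi * (L2_sq \<phi>))"
  have K0: "0 \<le> K" unfolding K_def by simp
  have bd: "(\<integral>\<^sup>+k. ennreal (cutoff n k * (cmod (u k))\<^sup>2) \<partial>lborel) \<le> ennreal (K\<^sup>2)" for n
  proof -
    define g where "g = (\<lambda>k. of_real (cutoff n k) * cnj (u k))"
    have g: "loc_lipschitz g" "compact_supp g" unfolding g_def by (rule cutoff_mult[OF lcu])+
    note ig = integrable_compact_supp_complex[OF loc_lipschitz_imp_continuous[OF g(1)] g(2)]
    define I where "I = (LINT k|lborel. cutoff n k * (cmod (u k))\<^sup>2)"
    have iI: "integrable lborel (\<lambda>k. cutoff n k * (cmod (u k))\<^sup>2)"
    proof -
      have "compact_supp (\<lambda>k. u k * g k)" by (rule compact_supp_mult[OF g(2)])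
      then have "integrable lborel (\<lambda>k. u k * g k)"
        by (rule integrable_compact_supp_complex(1)[rotated]) (intro continuous_intros cu loc_lipschitz_imp_continuous[OF g(1)])
      moreover have "u k * g k = of_real (cutoff n k * (cmod (u k))\<^sup>2)" for k
        unfolding g_def using complex_norm_square[of "u k"] by (simp add: mult_ac)
      ultimately show ?thesis by (simp only: complex_of_real_integrable_eq)
    qed
    have I0: "0 \<le> I" unfolding I_def using cutoff_range(1) by simp
    have "of_real I = (LINT k|lborel. u k * g k)"
      unfolding I_def integral_complex_of_real[symmetric] g_def
      by (rule Bochner_Integration.integral_cong) (use complex_norm_square in \<open>auto simp: mult_ac\<close>)
    also have "\<dots> = (LINT x|lborel. \<phi> x * fourier g x)" using rep g unfolding distributional_transform_def by simp
    finally have "I = cmod (LINT x|lborel. \<phi> x * fourier g x)" using I0 by (metis norm_of_real abs_of_nonneg)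
    also have "\<dots> \<le> K * sqrt (L2_sq g)"
      unfolding K_def by (rule pairing_fourier_bound(2)[OF _ \<phi>2 ig]) measurable
    also have "\<dots> \<le> K * sqrt I"
      unfolding I_def
    proof (intro mult_left_mono real_sqrt_le_mono integral_mono ig(2) iI K0)
      fix k
      have "(cutoff n k)\<^sup>2 \<le> cutoff n k" using cutoff_range[of n k] by (simp add: power2_eq_square mult_left_le)
      then show "(cmod (g k))\<^sup>2 \<le> cutoff n k * (cmod (u k))\<^sup>2"
        unfolding g_def using cutoff_range(1)[of n k] by (simp add: norm_mult power_mult_distrib mult_right_mono)
    qed
    finally have "I \<le> K * sqrt I" .
    then have "I \<le> K\<^sup>2"
    proof (cases "I = 0")
      case False
      then have s: "0 < sqrt I" using I0 by simp
      have "sqrt I * sqrt I \<le> K * sqrt I" using \<open>I \<le> K * sqrt I\<close> I0 by simp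
      then have "sqrt I \<le> K" using s by (rule mult_right_le_imp_le)
      then have "(sqrt I)\<^sup>2 \<le> K\<^sup>2" using s by (intro power_mono) auto
      then show ?thesis using I0 by simp
    qed simp
    then show ?thesis
      using nn_integral_eq_integral[OF iI] cutoff_range(1) unfolding I_def by (simp add: ennreal_leI)
  qed
  have lim: "(\<lambda>n. ennreal (cutoff n k * (cmod (u k))\<^sup>2)) \<longlonglongrightarrow> ennreal ((cmod (u k))\<^sup>2)" for k
    using tendsto_mult_right[OF cutoff_lim[of k], of "(cmod (u k))\<^sup>2"] by (intro tendsto_ennrealI) simp
  have "(\<integral>\<^sup>+k. ennreal ((cmod (u k))\<^sup>2) \<partial>lborel) = (\<integral>\<^sup>+k. liminf (\<lambda>n. ennreal (cutoff n k * (cmod (u k))\<^sup>2)) \<partial>lborel)"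
    by (rule nn_integral_cong) (use lim_imp_Liminf[OF _ lim] in auto)
  also have "\<dots> \<le> liminf (\<lambda>n. \<integral>\<^sup>+k. ennreal (cutoff n k * (cmod (u k))\<^sup>2) \<partial>lborel)"
    by (rule nn_integral_liminf) measurable
  also have "\<dots> \<le> ennreal (K\<^sup>2)" using bd by (intro Liminf_le) auto
  finally show ?thesis by (intro integrableI_bounded) (auto intro: le_less_trans)
qed

text \<open>Truncation by the cutoffs converges in \<open>L\<^sup>2\<close>, and the Plancherel bound makes the left-hand side
  continuous there; this admits Gaussians as test functions.\<close>

lemma distributional_transform_extends:
  assumes [measurable]: "\<phi> \<in> borel_measurable lborel" and \<phi>2: "in_L2 \<phi>"
    and rep: "distributional_transform u \<phi>" and iu: "integrable lborel u"
    and G: "integrable lborel G" "in_L2 G" "loc_lipschitz G" "\<And>k. cmod (G k) \<le> 1"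
  shows "(LINT x|lborel. \<phi> x * fourier G x) = (LINT k|lborel. u k * G k)"
proof -
  have [measurable]: "u \<in> borel_measurable borel" "G \<in> borel_measurable borel" using iu G by auto
  define g where "g = (\<lambda>n k. of_real (cutoff n k) * G k)"
  have g: "loc_lipschitz (g n)" "compact_supp (g n)" for n unfolding g_def by (rule cutoff_mult[OF G(3)])+
  note ig = integrable_compact_supp_complex[OF loc_lipschitz_imp_continuous[OF g(1)] g(2)]
  have [measurable]: "g n \<in> borel_measurable borel" for n using ig(1)[of n] by auto
  define K where "K = sqrt (2 * pi * (L2_sq \<phi>))"
  have eq: "(LINT x|lborel. \<phi> x * fourier (g n) x) = (LINT k|lborel. u k * g n k)" for n
    using rep g unfolding distributional_transform_def by simp
  have g_le: "cmod (g n k) \<le> cmod (G k)" for n k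
    unfolding g_def using cutoff_range[of n k] by (simp add: norm_mult mult_left_le_one_le)
  have g_lim: "(\<lambda>n. g n k) \<longlonglongrightarrow> G k" for k
    unfolding g_def using tendsto_mult[OF tendsto_of_real[OF cutoff_lim[of k]] tendsto_const[of "G k"]] by simp
  have r: "(\<lambda>n. LINT k|lborel. u k * g n k) \<longlonglongrightarrow> (LINT k|lborel. u k * G k)"
  proof (rule integral_dominated_convergence[where w = "\<lambda>k. cmod (u k)"])
    show "AE k in lborel. (\<lambda>n. u k * g n k) \<longlonglongrightarrow> u k * G k" by (intro AE_I2 tendsto_intros g_lim)
    show "AE k in lborel. norm (u k * g n k) \<le> cmod (u k)" for n
      using order_trans[OF g_le G(4)] by (auto simp: norm_mult intro!: mult_left_le)
  qed (use iu in auto)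
  have i2: "integrable lborel (\<lambda>k. (cmod (G k - g n k))\<^sup>2)" and iG: "integrable lborel (\<lambda>k. G k - g n k)" for n
  proof -
    have "cmod (G k - g n k) \<le> cmod (G k)" for k
    proof -
      have "G k - g n k = of_real (1 - cutoff n k) * G k" unfolding g_def by (simp add: algebra_simps)
      then show ?thesis using cutoff_range[of n k] by (simp add: norm_mult mult_left_le_one_le del: of_real_diff)
    qed
    then show "integrable lborel (\<lambda>k. (cmod (G k - g n k))\<^sup>2)"
      by (intro Bochner_Integration.integrable_bound[OF G(2)]) (auto intro!: power_mono)
    show "integrable lborel (\<lambda>k. G k - g n k)" using G(1) ig(1) by simp
  qed
  have n2: "(\<lambda>n. LINT k|lborel. (cmod (G k - g n k))\<^sup>2) \<longlonglongrightarrow> (LINT k::real|lborel. 0)"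
  proof (rule integral_dominated_convergence[where w = "\<lambda>k. (cmod (G k))\<^sup>2"])
    show "AE k in lborel. (\<lambda>n. (cmod (G k - g n k))\<^sup>2) \<longlonglongrightarrow> 0"
    proof (rule AE_I2)
      fix k
      have "(\<lambda>n. (cmod (G k - g n k))\<^sup>2) \<longlonglongrightarrow> (cmod (G k - G k))\<^sup>2" by (intro tendsto_intros g_lim)
      then show "(\<lambda>n. (cmod (G k - g n k))\<^sup>2) \<longlonglongrightarrow> 0" by simp
    qed
    show "AE k in lborel. norm ((cmod (G k - g n k))\<^sup>2) \<le> (cmod (G k))\<^sup>2" for n
    proof (rule AE_I2)
      fix k
      have "G k - g n k = of_real (1 - cutoff n k) * G k" unfolding g_def by (simp add: algebra_simps)
      then have "cmod (G k - g n k) \<le> cmod (G k)" using cutoff_range[of n k] by (simp add: norm_mult mult_left_le_one_le del: of_real_diff)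
      then show "norm ((cmod (G k - g n k))\<^sup>2) \<le> (cmod (G k))\<^sup>2" by (simp add: power_mono)
    qed
  qed (use G(2) in auto)
  have l: "(\<lambda>n. (LINT x|lborel. \<phi> x * fourier G x) - (LINT x|lborel. \<phi> x * fourier (g n) x)) \<longlonglongrightarrow> 0"
  proof (rule Lim_null_comparison)
    show "\<forall>\<^sub>F n in sequentially. cmod ((LINT x|lborel. \<phi> x * fourier G x) - (LINT x|lborel. \<phi> x * fourier (g n) x)) \<le> K * sqrt (LINT k|lborel. (cmod (G k - g n k))\<^sup>2)"
    proof (intro always_eventually allI)
      fix n
      have "(LINT x|lborel. \<phi> x * fourier G x) - (LINT x|lborel. \<phi> x * fourier (g n) x) = (LINT x|lborel. \<phi> x * fourier G x - \<phi> x * fourier (g n) x)"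
        by (intro Bochner_Integration.integral_diff[symmetric] pairing_fourier_bound \<phi>2 G ig) simp_all
      also have "\<dots> = (LINT x|lborel. \<phi> x * fourier (\<lambda>k. G k - g n k) x)"
        using fourier_diff[OF G(1) ig(1)[of n], of 1] by (simp add: right_diff_distrib)
      finally show "cmod ((LINT x|lborel. \<phi> x * fourier G x) - (LINT x|lborel. \<phi> x * fourier (g n) x)) \<le> K * sqrt (LINT k|lborel. (cmod (G k - g n k))\<^sup>2)"
        unfolding K_def using pairing_fourier_bound(2)[OF _ \<phi>2 iG i2, of n] by simp
    qed
    have "(\<lambda>n. K * sqrt (LINT k|lborel. (cmod (G k - g n k))\<^sup>2)) \<longlonglongrightarrow> K * sqrt (LINT k::real|lborel. 0)"
      by (intro tendsto_intros n2)
    then show "(\<lambda>n. K * sqrt (LINT k|lborel. (cmod (G k - g n k))\<^sup>2)) \<longlonglongrightarrow> 0" by simp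
  qed
  have "(\<lambda>n. (LINT x|lborel. \<phi> x * fourier G x) - (LINT k|lborel. u k * g n k)) \<longlonglongrightarrow> (LINT x|lborel. \<phi> x * fourier G x) - (LINT k|lborel. u k * G k)"
    by (intro tendsto_intros r)
  from LIMSEQ_unique[OF this l[unfolded eq]] show ?thesis by simp
qed

text \<open>For \<open>G\<close> a modulated Gaussian, \<open>fourier G\<close> is a multiple of a normal density centred at \<open>y\<close>; letting the density
  concentrate flattens \<open>G\<close> to the pure exponential.\<close>

lemma fourier_inversion:
  fixes \<phi> :: "real \<Rightarrow> complex"
  assumes c: "continuous_on UNIV \<phi>" and \<phi>2: "in_L2 \<phi>"
    and rep: "distributional_transform u \<phi>" and iu: "integrable lborel u"
  shows "of_real (2 * pi) * \<phi> y = fourier u (- y)"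
proof -
  have [measurable]: "\<phi> \<in> borel_measurable borel" by (rule borel_measurable_continuous_onI[OF c])
  have [measurable]: "u \<in> borel_measurable borel" using iu by auto
  define w where "w = (\<lambda>(n::nat) k::real. exp (- (k / Suc n)\<^sup>2 / 2))"
  have w_n: "w n k = sqrt (2 * pi) * Suc n * normal_density 0 (Suc n) k" for n k
    unfolding w_def by (rule gaussian_eq_normal_density) simp
  have w01: "0 \<le> w n k" "w n k \<le> 1" for n k unfolding w_def by auto
  have [measurable]: "w n \<in> borel_measurable borel" for n unfolding w_def by measurable
  define G where "G = (\<lambda>n k. of_real (w n k) * iexp (k * (- y)))"
  have [measurable]: "G n \<in> borel_measurable borel" for n unfolding G_def by measurable
  have Gn: "cmod (G n k) = w n k" for n k unfolding G_def using w01[of n k] by (simp add: norm_mult)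
  have iw: "integrable lborel (w n)" for n unfolding w_n by simp
  have G1: "integrable lborel (G n)" for n
    by (rule Bochner_Integration.integrable_bound[OF iw[of n]]) (use Gn w01 in auto)
  have G2: "in_L2 (G n)" for n
    by (rule Bochner_Integration.integrable_bound[OF iw[of n]]) (use w01 in \<open>auto simp: Gn power2_eq_square mult_left_le\<close>)
  have G3: "loc_lipschitz (G n)" for n
    unfolding G_def
  proof (rule loc_lipschitz_mult)
    have "(w n has_real_derivative w n k * (- (k / Suc n) / Suc n)) (at k)" for k
      unfolding w_def by (auto intro!: derivative_eq_intros simp: power2_eq_square)
    from has_vector_derivative_of_real[OF this]
    show "loc_lipschitz (\<lambda>k. complex_of_real (w n k))"
      by (rule loc_lipschitz_C1) (auto simp: w_def simp del: of_nat_Suc intro!: continuous_intros)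
    show "loc_lipschitz (\<lambda>k. iexp (k * - y))"
      by (rule loc_lipschitz_C1[OF iexp_has_vector_derivative]) (intro continuous_intros)
  qed
  have FG: "fourier (G n) x = of_real (2 * pi * normal_density y (1 / Suc n) x)" for n x
  proof -
    have "fourier (G n) x = (LINT k|lborel. of_real (sqrt (2 * pi) * Suc n) * (iexp ((x - y) * k) * of_real (normal_density 0 (Suc n) k)))"
      unfolding fourier_def G_def w_n
      by (rule Bochner_Integration.integral_cong[OF refl]) (simp add: algebra_simps flip: exp_add)
    also have "\<dots> = of_real (sqrt (2 * pi) * Suc n) * of_real (exp (- (real (Suc n) * (x - y))\<^sup>2 / 2))"
      by (simp only: integral_mult_right_zero normal_density_fourier[OF of_nat_0_less_iff[THEN iffD2, OF zero_less_Suc]])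
    also have "exp (- (real (Suc n) * (x - y))\<^sup>2 / 2) = sqrt (2 * pi) * (1 / Suc n) * normal_density 0 (1 / Suc n) (x - y)"
      using gaussian_eq_normal_density[of "1 / Suc n" "x - y"] by (simp add: mult.commute)
    also have "normal_density 0 (1 / Suc n) (x - y) = normal_density y (1 / Suc n) x" unfolding normal_density_def by simp
    also have "complex_of_real (sqrt (2 * pi) * Suc n) * of_real (sqrt (2 * pi) * (1 / Suc n) * normal_density y (1 / Suc n) x) = of_real (2 * pi * normal_density y (1 / Suc n) x)"
    proof -
      have "sqrt (2 * pi) * Suc n * (sqrt (2 * pi) * (1 / Suc n) * normal_density y (1 / Suc n) x) = (sqrt (2 * pi) * sqrt (2 * pi)) * normal_density y (1 / Suc n) x"
        by (simp add: field_simps del: real_sqrt_mult_self)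
      also have "\<dots> = 2 * pi * normal_density y (1 / Suc n) x" by simp
      finally show ?thesis by (simp only: of_real_mult[symmetric])
    qed
    finally show ?thesis .
  qed
  have eq: "of_real (2 * pi) * (LINT x|lborel. \<phi> x * of_real (normal_density y (1 / Suc n) x)) = (LINT k|lborel. u k * G n k)" for n
  proof -
    have "(LINT x|lborel. \<phi> x * fourier (G n) x) = (LINT k|lborel. u k * G n k)"
      by (rule distributional_transform_extends[OF _ \<phi>2 rep iu G1 G2 G3]) (use Gn w01 in auto)
    moreover have "(LINT x|lborel. \<phi> x * fourier (G n) x) = (LINT x|lborel. of_real (2 * pi) * (\<phi> x * of_real (normal_density y (1 / Suc n) x)))"
      unfolding FG by (rule Bochner_Integration.integral_cong[OF refl]) simp
    ultimately show ?thesis by simp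
  qed
  have l1: "(\<lambda>n. of_real (2 * pi) * (LINT x|lborel. \<phi> x * of_real (normal_density y (1 / Suc n) x))) \<longlonglongrightarrow> of_real (2 * pi) * \<phi> y"
    by (intro tendsto_intros gaussian_approx_identity c \<phi>2)
  have l2: "(\<lambda>n. LINT k|lborel. u k * G n k) \<longlonglongrightarrow> (LINT k|lborel. u k * iexp (k * (- y)))"
  proof (rule integral_dominated_convergence[where w = "\<lambda>k. cmod (u k)"])
    show "AE k in lborel. (\<lambda>n. u k * G n k) \<longlonglongrightarrow> u k * iexp (k * (- y))"
    proof (rule AE_I2)
      fix k :: real
      have "(\<lambda>n. w n k) \<longlonglongrightarrow> 1" unfolding w_def by (rule gaussian_weight_lim)
      then have "(\<lambda>n. u k * G n k) \<longlonglongrightarrow> u k * (of_real 1 * iexp (k * (- y)))"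
        unfolding G_def by (intro tendsto_intros)
      then show "(\<lambda>n. u k * G n k) \<longlonglongrightarrow> u k * iexp (k * (- y))" by simp
    qed
    show "AE k in lborel. norm (u k * G n k) \<le> cmod (u k)" for n
      using w01 by (auto simp: norm_mult Gn intro!: mult_left_le)
  qed (use iu in auto)
  have "of_real (2 * pi) * \<phi> y = (LINT k|lborel. u k * iexp (k * (- y)))"
    using LIMSEQ_unique[OF l1 l2[folded eq]] .
  also have "\<dots> = fourier u (- y)" unfolding fourier_def by (simp only: mult.commute[of "u _"])
  finally show ?thesis .
qed

section \<open>Finiteness of the zero set\<close>

context cauchy_motion
begin

text \<open>The compactly supported solutions of the inhomogeneous Airy equation show that the functional
  \<open>g \<mapsto> \<integral> \<phi> (fourier g)\<close> vanishes whenever \<open>g\<close> is orthogonal to the two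
  homogeneous solutions, so it is integration against one of their combinations.\<close>

lemma eigenfunction_representation:
  assumes H: "cauchy_oscillator M X \<phi> (\<lambda>x. of_real \<mu> * \<phi> x)"
  obtains u w where "\<And>k. (u has_vector_derivative w k) (at k)"
    "\<And>k. (w has_vector_derivative of_real (\<bar>k\<bar> - \<mu>) * u k) (at k)"
    "u 0 = 0 \<Longrightarrow> w 0 = 0 \<Longrightarrow> u = (\<lambda>_. 0)" "distributional_transform u \<phi>"
proof -
  have [measurable]: "\<phi> \<in> borel_measurable borel" and \<phi>2: "in_L2 \<phi>"
    using H unfolding cauchy_oscillator_def semigroup_operator_def square_integrable_def by auto
  obtain u1 w1 where 1: "\<And>k. (u1 has_real_derivative w1 k) (at k)"
    "\<And>k. (w1 has_real_derivative (\<bar>k\<bar> - \<mu>) * u1 k) (at k)" "u1 0 = 1" "w1 0 = 0"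
    using airy_line[where \<mu> = \<mu> and a = 1 and b = 0] by blast
  obtain u2 w2 where 2: "\<And>k. (u2 has_real_derivative w2 k) (at k)"
    "\<And>k. (w2 has_real_derivative (\<bar>k\<bar> - \<mu>) * u2 k) (at k)" "u2 0 = 0" "w2 0 = 1"
    using airy_line[where \<mu> = \<mu> and a = 0 and b = 1] by blast
  have c1: "continuous_on UNIV u1" and c2: "continuous_on UNIV u2"
    using 1(1) 2(1) by (meson DERIV_isCont continuous_at_imp_continuous_on)+
  define S where "S = {g. loc_lipschitz g \<and> compact_supp g}"
  define L where "L = (\<lambda>g. LINT x|lborel. \<phi> x * fourier g x)"
  define l1 where "l1 = (\<lambda>g. LINT k|lborel. complex_of_real (u1 k) * g k)"
  define l2 where "l2 = (\<lambda>g. LINT k|lborel. complex_of_real (u2 k) * g k)"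
  define sub where "sub = (\<lambda>g c (h :: real \<Rightarrow> complex) k. g k - c * h k :: complex)"
  have int: "integrable lborel g" "in_L2 g" if "g \<in> S" for g
    using integrable_compact_supp_complex[of g] loc_lipschitz_imp_continuous[of g] that unfolding S_def by auto
  have intm: "integrable lborel (\<lambda>k. of_real (f k) * g k)" if "g \<in> S" "continuous_on UNIV f" for g and f :: "real \<Rightarrow> real"
    using that loc_lipschitz_imp_continuous[of g] unfolding S_def
    by (intro integrable_compact_supp_complex(1) compact_supp_mult) (auto intro!: continuous_intros)
  have lin: "(LINT k|lborel. of_real (f k) * sub g c h k) = (LINT k|lborel. of_real (f k) * g k) - c * (LINT k|lborel. of_real (f k) * h k)"
    if "g \<in> S" "h \<in> S" "continuous_on UNIV f" for g h c and f :: "real \<Rightarrow> real"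
  proof -
    have "(LINT k|lborel. of_real (f k) * sub g c h k) = (LINT k|lborel. of_real (f k) * g k - c * (of_real (f k) * h k))"
      unfolding sub_def by (simp add: algebra_simps)
    then show ?thesis using intm[OF that(1,3)] intm[OF that(2,3)] by simp
  qed
  have "\<exists>a b. \<forall>g\<in>S. L g = a * l1 g + b * l2 g"
  proof (rule functional_combination[where sub = sub])
    fix g h c assume gh: "g \<in> S" "h \<in> S"
    show "sub g c h \<in> S" using gh unfolding S_def sub_def by (auto intro: loc_lipschitz_diff compact_supp_diff)
    show "l1 (sub g c h) = l1 g - c * l1 h" unfolding l1_def by (rule lin[OF gh c1])
    show "l2 (sub g c h) = l2 g - c * l2 h" unfolding l2_def by (rule lin[OF gh c2])
    have "L (sub g c h) = (LINT x|lborel. \<phi> x * fourier g x - c * (\<phi> x * fourier h x))"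
      unfolding L_def sub_def fourier_diff[OF int(1)[OF gh(1)] int(1)[OF gh(2)]] by (simp add: algebra_simps)
    then show "L (sub g c h) = L g - c * L h"
      unfolding L_def using pairing_fourier_bound(1)[OF _ \<phi>2 int[OF gh(1)]] pairing_fourier_bound(1)[OF _ \<phi>2 int[OF gh(2)]] by simp
  next
    fix g assume g: "g \<in> S" and z: "l1 g = 0" "l2 g = 0"
    have gl: "loc_lipschitz g" and gs: "compact_supp g" using g unfolding S_def by auto
    have W: "u1 0 * w2 0 - w1 0 * u2 0 = 1" using 1 2 by simp
    obtain v v' where v: "\<And>k. (v has_vector_derivative v' k) (at k)"
      "\<And>k. (v' has_vector_derivative of_real (\<bar>k\<bar> - \<mu>) * v k - g k) (at k)" "compact_supp v"
      using variation_of_parameters[OF 1(1,2) 2(1,2) W loc_lipschitz_imp_continuous[OF gl] gs z[unfolded l1_def l2_def]] by blast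
    have lv: "loc_lipschitz v"
    proof (rule loc_lipschitz_C1[OF v(1)])
      show "continuous_on UNIV v'"
        using v(2) by (meson continuous_at_imp_continuous_on has_vector_derivative_continuous)
    qed
    have lk: "loc_lipschitz (\<lambda>k. of_real (\<bar>k\<bar> - \<mu>))" by (rule loc_lipschitz_of_real) auto
    have "loc_lipschitz (\<lambda>k. of_real (\<bar>k\<bar> - \<mu>) * v k - 1 * g k)"
      by (rule loc_lipschitz_diff[OF loc_lipschitz_mult[OF lk lv] gl])
    then have "loc_lipschitz (\<lambda>k. of_real (\<bar>k\<bar> - \<mu>) * v k - g k)" by simp
    from weak_eigen_equation[OF H v(1,2) this v(3)] show "L g = 0" unfolding L_def by simp
  qed
  then obtain a b where ab: "\<And>g. g \<in> S \<Longrightarrow> L g = a * l1 g + b * l2 g" by blast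
  define u where "u = (\<lambda>k. a * of_real (u1 k) + b * of_real (u2 k))"
  define w where "w = (\<lambda>k. a * of_real (w1 k) + b * of_real (w2 k))"
  have comb: "((\<lambda>k. a * of_real (f1 k) + b * of_real (f2 k)) has_vector_derivative a * of_real D1 + b * of_real D2) (at k)"
    if "(f1 has_real_derivative D1) (at k)" "(f2 has_real_derivative D2) (at k)" for f1 f2 D1 D2 k
    using has_vector_derivative_add[OF has_vector_derivative_mult[OF has_vector_derivative_const has_vector_derivative_of_real[OF that(1)], of a]
        has_vector_derivative_mult[OF has_vector_derivative_const has_vector_derivative_of_real[OF that(2)], of b]] by simp
  show thesis
  proof
    show "(u has_vector_derivative w k) (at k)" for k unfolding u_def w_def by (rule comb[OF 1(1) 2(1)])
    show "(w has_vector_derivative of_real (\<bar>k\<bar> - \<mu>) * u k) (at k)" for k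
      unfolding w_def u_def using comb[OF 1(2) 2(2)] by (simp add: algebra_simps)
    show "u = (\<lambda>_. 0)" if "u 0 = 0" "w 0 = 0" using that 1(3,4) 2(3,4) unfolding u_def w_def by simp
    show "distributional_transform u \<phi>" unfolding distributional_transform_def
    proof (intro allI impI)
      fix g assume "loc_lipschitz g" "compact_supp g"
      then have g: "g \<in> S" unfolding S_def by simp
      have "(LINT k|lborel. u k * g k) = (LINT k|lborel. a * (of_real (u1 k) * g k) + b * (of_real (u2 k) * g k))"
        unfolding u_def by (simp add: algebra_simps)
      also have "\<dots> = a * l1 g + b * l2 g" unfolding l1_def l2_def using intm[OF g c1] intm[OF g c2] by simp
      finally show "(LINT x|lborel. \<phi> x * fourier g x) = (LINT k|lborel. u k * g k)" using ab[OF g] unfolding L_def by simp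
    qed
  qed
qed

end

theorem corollary3p12:
  fixes M :: "'w measure" and X :: "real \<Rightarrow> 'w \<Rightarrow> real"
    and \<phi> :: "real \<Rightarrow> complex" and \<mu> :: real
  assumes "cauchy_process M X"
    and "eigenfunction (cauchy_oscillator M X) \<mu> \<phi>"
    and "continuous_on UNIV \<phi>"
  shows "finite {x. \<phi> x = 0}"
proof -
  have "prob_space M" using assms(1) unfolding cauchy_process_def levy_process_def by blast
  then interpret cauchy_motion M X
    using assms(1) by (intro cauchy_motion.intro cauchy_motion_axioms.intro)
  have H: "cauchy_oscillator M X \<phi> (\<lambda>x. of_real \<mu> * \<phi> x)" and nz: "\<not> (AE x in lborel. \<phi> x = 0)"
    using assms(2) unfolding eigenfunction_def by auto
  have [measurable]: "\<phi> \<in> borel_measurable borel" and \<phi>2: "in_L2 \<phi>"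
    using H unfolding cauchy_oscillator_def semigroup_operator_def square_integrable_def by auto
  obtain u w where u: "\<And>k. (u has_vector_derivative w k) (at k)"
    and w: "\<And>k. (w has_vector_derivative of_real (\<bar>k\<bar> - \<mu>) * u k) (at k)"
    and u0: "u 0 = 0 \<Longrightarrow> w 0 = 0 \<Longrightarrow> u = (\<lambda>_. 0)" and rep: "distributional_transform u \<phi>"
    using eigenfunction_representation[OF H] by blast
  have cw: "continuous_on UNIV w" and cu: "continuous_on UNIV u"
    using u w by (meson continuous_at_imp_continuous_on has_vector_derivative_continuous)+
  have [measurable]: "u \<in> borel_measurable borel" by (rule borel_measurable_continuous_onI[OF cu])
  have u2: "in_L2 u"
    by (rule distributional_transform_in_L2[OF _ \<phi>2 rep loc_lipschitz_C1[OF u cw]]) measurable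
  have um: "((\<lambda>k. u (- k)) has_vector_derivative - w (- k)) (at k)" for k
    by (rule has_vector_derivative_reflect[OF u])
  have wm: "((\<lambda>k. - w (- k)) has_vector_derivative of_real (\<bar>k\<bar> - \<mu>) * u (- k)) (at k)" for k
    using has_vector_derivative_minus[OF has_vector_derivative_reflect[OF w[of "- k"]]] by simp
  have um2: "in_L2 (\<lambda>k. u (- k))"
    using lborel_integrable_real_affine[OF u2, of "-1" 0] by simp
  have ru: "superexp_decay u" "superexp_decay w"
  proof -
    have "(w has_vector_derivative of_real (k - \<mu>) * u k) (at k)" if "0 \<le> k" for k using w[of k] that by simp
    from complex_solution_superexp_decay[OF u this _ u2] show "superexp_decay u" "superexp_decay w" by simp_all
  qed
  have rm: "superexp_decay (\<lambda>k. u (- k))" "superexp_decay (\<lambda>k. - w (- k))"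
  proof -
    have "((\<lambda>k. - w (- k)) has_vector_derivative of_real (k - \<mu>) * u (- k)) (at k)" if "0 \<le> k" for k using wm[of k] that by simp
    from complex_solution_superexp_decay[OF um this _ um2] show "superexp_decay (\<lambda>k. u (- k))" "superexp_decay (\<lambda>k. - w (- k))" by simp_all
  qed
  have iu: "integrable lborel u"
    using integrable_exp_weight[OF ru(1) rm(1), of 0] by (simp add: integrable_norm_iff)
  have inv: "of_real (2 * pi) * \<phi> y = fourier u (- y)" for y by (rule fourier_inversion[OF assms(3) \<phi>2 rep iu])
  have zero: "\<phi> y = 0 \<longleftrightarrow> fourier u (- y) = 0" for y
    unfolding inv[symmetric] by simp
  have nz': "\<exists>y. fourier u y \<noteq> 0"
  proof (rule ccontr)
    assume "\<nexists>y. fourier u y \<noteq> 0"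
    then have "\<phi> y = 0" for y using zero by simp
    then show False using nz by simp
  qed
  have "u 0 \<noteq> 0 \<or> w 0 \<noteq> 0"
  proof (rule ccontr)
    assume "\<not> (u 0 \<noteq> 0 \<or> w 0 \<noteq> 0)"
    then have "u = (\<lambda>_. 0)" using u0 by simp
    then show False using nz' by (simp add: fourier_def)
  qed
  from airy_transform_zeros_bounded[OF u w ru rm this] obtain Y where Y: "\<And>y. fourier u y = 0 \<Longrightarrow> \<bar>y\<bar> \<le> Y" by blast
  have "finite {y. fourier u y = 0}"
    by (rule fourier_finite_zeros[OF ru(1) rm(1) _ Y nz']) measurable
  then have "finite (uminus ` {y. fourier u y = 0})" by (rule finite_imageI)
  moreover have "{x. \<phi> x = 0} \<subseteq> uminus ` {y. fourier u y = 0}"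
  proof
    fix x assume "x \<in> {x. \<phi> x = 0}"
    then have "- x \<in> {y. fourier u y = 0}" using zero[of x] by simp
    then show "x \<in> uminus ` {y. fourier u y = 0}" by (metis image_eqI minus_minus)
  qed
  ultimately show ?thesis by (rule rev_finite_subset)
qed

end
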